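(* Let $\alpha \in (0,\pi)$ and let $q$ be a real-valued function on $(0,\pi)$ with $q' \in L^2_{\mathbb{R}}(0,\pi)$ (i.e. $q$ is absolutely continuous on $[0,\pi]$ with derivative in $L^2_{\mathbb{R}}(0,\pi)$). If $$\mu_n(q,\alpha,\pi-\alpha)=\mu_n(0,\alpha,\pi-\alpha)\quad\text{for all integers } n\ge 0,$$ where $0$ denotes the zero potential, then $q(x)\equiv 0$ on $[0,\pi]$.
   Context: For a real-valued $q \in L^1_{\mathbb{R}}(0,\pi)$ (subscript $\mathbb{R}$ means real-valued) and $\alpha,\beta \in (0,\pi)$, let $L(q,\alpha,\beta)$ denote the Sturm-Liouville boundary value problem $$-y''+q(x)y=\mu y,\quad x\in(0,\pi),\ \mu\in\mathbb{C},$$ $$y(0)\cot\alpha+y'(0)=0,\qquad y(\pi)\cot\beta+y'(\pi)=0.$$ Solutions are understood in the usual sense ($y, y'$ absolutely continuous on $[0,\pi]$, equation satisfied almost everywhere). The spectrum of this problem is discrete and consists of real simple eigenvalues, enumerated increasingly as $\mu_0(q,\alpha,\beta)<\mu_1(q,\alpha,\beta)<\dots<\mu_n(q,\alpha,\beta)<\cdots$, $n\ge 0$. *)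

theory Defs
  imports "HOL-Analysis.Analysis"
begin

text \<open>Absolute continuity of a function on a compact interval \<open>S\<close>, in the epsilon-delta form. A finite
  family of non-overlapping compact subintervals is a division \<open>D\<close> of its own union.\<close>

definition abs_continuous_on :: "real set \<Rightarrow> (real \<Rightarrow> 'a::real_normed_vector) \<Rightarrow> bool" where
  "abs_continuous_on S f \<longleftrightarrow>
     (\<forall>\<epsilon>>0. \<exists>\<delta>>0. \<forall>D. D division_of \<Union>D \<longrightarrow> \<Union>D \<subseteq> S \<longrightarrow> (\<Sum>k\<in>D. Sup k - Inf k) < \<delta> \<longrightarrow>
        (\<Sum>k\<in>D. norm (f (Sup k) - f (Inf k))) < \<epsilon>)"

definition L2_real_on :: "real set \<Rightarrow> (real \<Rightarrow> real) \<Rightarrow> bool" where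
  "L2_real_on S f \<longleftrightarrow>
     f \<in> borel_measurable (lebesgue_on S) \<and> integrable (lebesgue_on S) (\<lambda>x. (f x)\<^sup>2)"

text \<open>\<open>y\<close>, with derivative \<open>y'\<close> (one-sided at the end points), solves \<open>-y'' + q y = \<mu> y\<close>.\<close>

definition sl_solution ::
  "(real \<Rightarrow> real) \<Rightarrow> complex \<Rightarrow> (real \<Rightarrow> complex) \<Rightarrow> (real \<Rightarrow> complex) \<Rightarrow> bool" where
  "sl_solution q \<mu> y y' \<longleftrightarrow>
     (\<forall>x\<in>{0..pi}. (y has_vector_derivative y' x) (at x within {0..pi})) \<and>
     abs_continuous_on {0..pi} y \<and> abs_continuous_on {0..pi} y' \<and>
     (AE x in lebesgue_on {0..pi}. \<exists>y''. (y' has_vector_derivative y'') (at x within {0..pi}) \<and>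
        - y'' + complex_of_real (q x) * y x = \<mu> * y x)"

definition sl_spectrum :: "(real \<Rightarrow> real) \<Rightarrow> real \<Rightarrow> real \<Rightarrow> complex set" where
  "sl_spectrum q \<alpha> \<beta> = {\<mu>. \<exists>y y'. sl_solution q \<mu> y y' \<and> (\<exists>x\<in>{0..pi}. y x \<noteq> 0) \<and>
     y 0 * complex_of_real (cot \<alpha>) + y' 0 = 0 \<and> y pi * complex_of_real (cot \<beta>) + y' pi = 0}"

text \<open>The increasing enumeration \<open>\<mu>\<^sub>0 < \<mu>\<^sub>1 < \<dots>\<close> of the spectrum. It exists for every real integrable
  potential \<open>q\<close>, because the spectrum is then a discrete set of reals that is infinite and bounded
  below; it is unique by \<open>sl_mu_eqI\<close>.\<close>

definition sl_mu :: "(real \<Rightarrow> real) \<Rightarrow> real \<Rightarrow> real \<Rightarrow> nat \<Rightarrow> real" where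
  "sl_mu q \<alpha> \<beta> = (THE m. strict_mono m \<and> range (\<lambda>n. complex_of_real (m n)) = sl_spectrum q \<alpha> \<beta>)"

lemma strict_mono_range_unique:
  fixes f g :: "nat \<Rightarrow> real"
  assumes f: "strict_mono f" and g: "strict_mono g" and r: "range f = range g"
  shows "f = g"
proof
  fix n show "f n = g n"
  proof (induction n rule: less_induct)
    case (less n)
    obtain i j where i: "f n = g i" and j: "g n = f j"
      using r by (metis rangeE rangeI)
    have "\<not> i < n" using less.IH[of i] i f by (metis less_irrefl strict_mono_less)
    moreover have "\<not> j < n" using less.IH[of j] j g by (metis less_irrefl strict_mono_less)
    ultimately have "g n \<le> g i" "f n \<le> f j"
      using strict_mono_less_eq[OF f] strict_mono_less_eq[OF g] by auto
    then show ?case using i j by simp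
  qed
qed

lemma sl_mu_eqI:
  assumes "strict_mono m" and "range (\<lambda>n. complex_of_real (m n)) = sl_spectrum q \<alpha> \<beta>"
  shows "sl_mu q \<alpha> \<beta> = m"
  unfolding sl_mu_def
proof (rule the_equality)
  fix m' :: "nat \<Rightarrow> real"
  assume m': "strict_mono m' \<and> range (\<lambda>n. complex_of_real (m' n)) = sl_spectrum q \<alpha> \<beta>"
  then have "complex_of_real ` range m' = complex_of_real ` range m"
    using assms by (simp add: image_image)
  then have "range m' = range m"
    by (simp add: inj_image_eq_iff inj_of_real)
  then show "m' = m" using m' assms strict_mono_range_unique by blast
qed (use assms in blast)

end

theory Submission
  imports Defs "HOL-Complex_Analysis.Complex_Analysis" "HOL-Real_Asymp.Real_Asymp"
begin

text \<open>Put \<open>h = - cot \<alpha>\<close>. Let \<open>\<phi>\<close> be the solution with \<open>\<phi>(0) = 1\<close>,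
  \<open>\<phi>'(0) = h\<close>, let \<open>\<psi>\<close> be the one with \<open>\<psi>(\<pi>) = 1\<close>, \<open>\<psi>'(\<pi>) = - h\<close>, and let \<open>\<Delta>(\<mu>) = \<phi>'(\<pi>) + h \<phi>(\<pi>)\<close>, whose zeros
  are the eigenvalues, all simple. Index \<open>0\<close> refers to the zero potential. On the circles
  \<open>|\<mu>| = (N + 1/2)\<^sup>2\<close> the functions \<open>\<Delta>\<close> and \<open>\<Delta>\<^sub>0\<close> agree to leading order, so equal spectra force
  \<open>\<Delta> = \<Delta>\<^sub>0\<close>, and the asymptotics as \<open>\<mu> \<rightarrow> -\<infinity>\<close> give \<open>\<integral> q = 0\<close>. At an eigenvalue \<open>\<phi> = \<kappa> \<psi>\<close>, so that
  \<open>\<phi>(\<pi>) = \<kappa>\<close> and \<open>\<psi>(0) = 1/\<kappa>\<close>, while \<open>\<kappa>\<^sub>0 = \<plusminus>1\<close> by symmetry. The residues of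
  \<open>(\<phi>(\<pi>) + \<psi>(0) - 2 \<phi>\<^sub>0(\<pi>)) / \<Delta>\<close> all have the same sign and sum to zero, hence vanish, which forces
  \<open>\<kappa> = \<kappa>\<^sub>0\<close>. Then \<open>\<phi> \<psi>\<^sub>0 - \<phi>\<^sub>0 \<psi>\<close> vanishes at every eigenvalue and is small against \<open>\<Delta>\<close> on the circles,
  so it is zero identically; this gives \<open>\<phi>\<^sup>2 = \<phi>\<^sub>0\<^sup>2\<close> and finally \<open>q = 0\<close>.\<close>

section \<open>Initial value problems with a spectral parameter\<close>

text \<open>One spectrum does not in general determine a potential; the missing data are the
  constants \<open>\<kappa>\<close>. The condition \<open>\<beta> = \<pi> - \<alpha>\<close>
  supplies them. The zero potential is its own reflection, which gives
  \<open>\<kappa>\<^sub>0\<^sup>2 = 1\<close>, and \<open>t + 1/t \<ge> 2\<close> for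
  \<open>t = \<kappa>/\<kappa>\<^sub>0 > 0\<close> turns one vanishing sum into a statement about
  every eigenvalue separately. The numerator is dictated by orders of growth. On circles of radius
  about \<open>N\<^sup>2\<close> the residue sum tends to zero if the quotient is
  \<open>o(N\<^sup>-\<^sup>2)\<close>. As \<open>\<Delta>\<close> has size \<open>N\<close> times an
  exponential, the numerator must lose its term of order \<open>1/\<lambda>\<close>. For
  \<open>\<phi>(\<pi>) + \<psi>(0)\<close> that term differs from the one of the zero potential by a
  multiple of \<open>\<integral> q\<close>, whereas \<open>\<phi>(\<pi>)\<close> alone leaves an
  oscillating integral of \<open>q\<close>. This is why \<open>\<integral> q = 0\<close> has to come
  first. The two uniqueness arguments, for \<open>\<Delta>\<close> and for the cross relation, only
  need a quotient that tends to zero. Comparing functions on circles replaces product expansions and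
  eigenvalue asymptotics: no individual eigenvalue is ever located.\<close>

text \<open>Polynomials in \<open>\<mu>\<close> with continuous coefficients. They make the Picard iterates visibly entire in
  \<open>\<mu>\<close>, without differentiating under the integral sign.\<close>

inductive polyfam :: "(real \<Rightarrow> complex \<Rightarrow> complex) \<Rightarrow> bool" where
  const: "continuous_on {0..pi} c \<Longrightarrow> polyfam (\<lambda>x \<mu>. c x)"
| add: "polyfam f \<Longrightarrow> polyfam g \<Longrightarrow> polyfam (\<lambda>x \<mu>. f x \<mu> + g x \<mu>)"
| param: "polyfam f \<Longrightarrow> polyfam (\<lambda>x \<mu>. \<mu> * f x \<mu>)"

lemma polyfam_entire: "polyfam f \<Longrightarrow> f x holomorphic_on UNIV"
proof (induction rule: polyfam.induct)
  case (add f g)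
  then show ?case using holomorphic_on_add[of "f x" UNIV "g x"] by simp
next
  case (param f)
  then show ?case using holomorphic_on_mult[of "\<lambda>z. z" UNIV "f x"] by (simp add: holomorphic_on_ident)
qed auto

lemma polyfam_continuous:
  "polyfam f \<Longrightarrow> continuous_on ({0..pi} \<times> UNIV) (\<lambda>(x, \<mu>). f x \<mu>)"
proof (induction rule: polyfam.induct)
  case (const c)
  have "continuous_on ({0..pi} \<times> (UNIV::complex set)) (\<lambda>z. c (fst z))"
    by (rule continuous_on_compose2[OF const]) (auto intro!: continuous_intros)
  then show ?case by (simp add: case_prod_beta)
qed (auto simp: case_prod_beta intro!: continuous_intros)

lemma polyfam_continuous_section:
  assumes "polyfam f" shows "continuous_on {0..pi} (\<lambda>x. f x \<mu>)"
proof -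
  have "continuous_on {0..pi} (\<lambda>x. (\<lambda>(x, \<mu>). f x \<mu>) (x, \<mu>))"
    by (rule continuous_on_compose2[OF polyfam_continuous[OF assms]]) (auto intro!: continuous_intros)
  then show ?thesis by simp
qed

lemma polyfam_mult:
  assumes "continuous_on {0..pi} c" "polyfam f"
  shows "polyfam (\<lambda>x \<mu>. c x * f x \<mu>)"
  using assms(2)
proof (induction rule: polyfam.induct)
  case (const d)
  then show ?case by (intro polyfam.const continuous_intros assms)
next
  case (add f g)
  then show ?case by (simp add: distrib_left polyfam.add)
next
  case (param f)
  from polyfam.param[OF param.IH] show ?case by (simp add: mult.left_commute)
qed

text \<open>A polynomial in \<open>\<mu>\<close> is integrated coefficient by coefficient. The
  primitive is matched only for \<open>x\<close> in \<open>{0..pi}\<close>, the only place where the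
  coefficients are controlled.\<close>

lemma polyfam_integral:
  assumes "polyfam f"
  shows "\<exists>g. polyfam g \<and> (\<forall>x\<in>{0..pi}. \<forall>\<mu>. integral {0..x} (\<lambda>t. f t \<mu>) = g x \<mu>)"
  using assms
proof (induction rule: polyfam.induct)
  case (const c)
  have "polyfam (\<lambda>x \<mu>. integral {0..x} c)"
    by (intro polyfam.const indefinite_integral_continuous_1 integrable_continuous_interval const)
  then show ?case by blast
next
  case (add f g)
  then obtain F G where FG: "polyfam F" "polyfam G"
    "\<forall>x\<in>{0..pi}. \<forall>\<mu>. integral {0..x} (\<lambda>t. f t \<mu>) = F x \<mu>"
    "\<forall>x\<in>{0..pi}. \<forall>\<mu>. integral {0..x} (\<lambda>t. g t \<mu>) = G x \<mu>" by blast
  have "integral {0..x} (\<lambda>t. f t \<mu> + g t \<mu>) = F x \<mu> + G x \<mu>" if "x \<in> {0..pi}" for x \<mu>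
  proof -
    have "(\<lambda>t. f t \<mu>) integrable_on {0..x}" "(\<lambda>t. g t \<mu>) integrable_on {0..x}"
      by (rule integrable_continuous_interval, rule continuous_on_subset[OF polyfam_continuous_section],
          use add.hyps that in auto)+
    then show ?thesis using FG that by (simp add: Henstock_Kurzweil_Integration.integral_add)
  qed
  then show ?case using polyfam.add[OF FG(1,2)] by blast
next
  case (param f)
  then obtain F where "polyfam F"
    "\<forall>x\<in>{0..pi}. \<forall>\<mu>. integral {0..x} (\<lambda>t. f t \<mu>) = F x \<mu>" by blast
  then show ?case by (intro exI[of _ "\<lambda>x \<mu>. \<mu> * F x \<mu>"]) (auto intro: polyfam.param)
qed

text \<open>Picard iterates for \<open>y'' = (q - \<mu>) y\<close>, \<open>y(0) = a\<close>, \<open>y'(0) = b\<close>: the pair carries the increments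
  of \<open>y\<close> and of \<open>y'\<close>.\<close>

primrec picard :: "(real \<Rightarrow> real) \<Rightarrow> complex \<Rightarrow> complex \<Rightarrow> nat \<Rightarrow> (real \<Rightarrow> complex \<Rightarrow> complex) \<times> (real \<Rightarrow> complex \<Rightarrow> complex)" where
  "picard q a b 0 = (\<lambda>x \<mu>. a + b * x, \<lambda>x \<mu>. b)"
| "picard q a b (Suc m) =
     (\<lambda>x \<mu>. integral {0..x} (\<lambda>s. integral {0..s} (\<lambda>t. (q t - \<mu>) * fst (picard q a b m) t \<mu>)),
      \<lambda>x \<mu>. integral {0..x} (\<lambda>t. (q t - \<mu>) * fst (picard q a b m) t \<mu>))"

definition sl_sol :: "(real \<Rightarrow> real) \<Rightarrow> complex \<Rightarrow> complex \<Rightarrow> complex \<Rightarrow> real \<Rightarrow> complex" where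
  "sl_sol q a b \<mu> x = (\<Sum>m. fst (picard q a b m) x \<mu>)"

definition sl_sol' :: "(real \<Rightarrow> real) \<Rightarrow> complex \<Rightarrow> complex \<Rightarrow> complex \<Rightarrow> real \<Rightarrow> complex" where
  "sl_sol' q a b \<mu> x = (\<Sum>m. snd (picard q a b m) x \<mu>)"

lemma picard_polyfam:
  assumes q: "continuous_on {0..pi} q"
  shows "\<exists>f g. polyfam f \<and> polyfam g \<and> (\<forall>x\<in>{0..pi}. \<forall>\<mu>. fst (picard q a b m) x \<mu> = f x \<mu> \<and>
           snd (picard q a b m) x \<mu> = g x \<mu>)"
proof (induction m)
  case 0
  have "polyfam (\<lambda>x \<mu>. a + b * x)" "polyfam (\<lambda>x \<mu>. b)"
    by (intro polyfam.const continuous_intros)+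
  then show ?case by fastforce
next
  case (Suc m)
  then obtain f where f: "polyfam f" "\<forall>x\<in>{0..pi}. \<forall>\<mu>. fst (picard q a b m) x \<mu> = f x \<mu>" by blast
  have "continuous_on {0..pi} (\<lambda>x. complex_of_real (q x))" "continuous_on {0..pi} (\<lambda>x. - 1 :: complex)"
    by (intro continuous_intros q)+
  then have "polyfam (\<lambda>x \<mu>. complex_of_real (q x) * f x \<mu> + (- 1) * (\<mu> * f x \<mu>))"
    using f by (intro polyfam.add polyfam_mult polyfam.param) auto
  then obtain g where g: "polyfam g"
    "\<forall>x\<in>{0..pi}. \<forall>\<mu>. integral {0..x} (\<lambda>t. q t * f t \<mu> + (- 1) * (\<mu> * f t \<mu>)) = g x \<mu>"
    using polyfam_integral by blast
  have g': "integral {0..x} (\<lambda>t. (q t - \<mu>) * fst (picard q a b m) t \<mu>) = g x \<mu>"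
    if x: "x \<in> {0..pi}" for x and \<mu> :: complex
  proof -
    have "integral {0..x} (\<lambda>t. (q t - \<mu>) * fst (picard q a b m) t \<mu>)
        = integral {0..x} (\<lambda>t. q t * f t \<mu> + (- 1) * (\<mu> * f t \<mu>))"
      by (rule Henstock_Kurzweil_Integration.integral_cong) (use f(2) x in \<open>auto simp: algebra_simps\<close>)
    then show ?thesis using g x by auto
  qed
  obtain k where k: "polyfam k" "\<forall>x\<in>{0..pi}. \<forall>\<mu>. integral {0..x} (\<lambda>t. g t \<mu>) = k x \<mu>"
    using polyfam_integral[OF g(1)] by blast
  have "integral {0..x} (\<lambda>s. integral {0..s} (\<lambda>t. (q t - \<mu>) * fst (picard q a b m) t \<mu>)) = k x \<mu>"
    if x: "x \<in> {0..pi}" for x and \<mu> :: complex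
  proof -
    have "integral {0..x} (\<lambda>s. integral {0..s} (\<lambda>t. (q t - \<mu>) * fst (picard q a b m) t \<mu>))
        = integral {0..x} (\<lambda>s. g s \<mu>)"
      by (rule Henstock_Kurzweil_Integration.integral_cong) (use g' x in auto)
    then show ?thesis using k x by auto
  qed
  with g' g(1) k(1) show ?case by (intro exI[of _ k] exI[of _ g]) auto
qed

lemma picard_continuous:
  assumes q: "continuous_on {0..pi} q"
  shows "continuous_on ({0..pi} \<times> UNIV) (\<lambda>(x, \<mu>). fst (picard q a b m) x \<mu>)"
    and "continuous_on {0..pi} (\<lambda>x. fst (picard q a b m) x \<mu>)"
    and "continuous_on {0..pi} (\<lambda>x. snd (picard q a b m) x \<mu>)"
    and "x \<in> {0..pi} \<Longrightarrow> fst (picard q a b m) x holomorphic_on UNIV"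
    and "x \<in> {0..pi} \<Longrightarrow> snd (picard q a b m) x holomorphic_on UNIV"
proof -
  obtain f g where fg: "polyfam f" "polyfam g"
     "\<forall>x\<in>{0..pi}. \<forall>\<mu>. fst (picard q a b m) x \<mu> = f x \<mu> \<and> snd (picard q a b m) x \<mu> = g x \<mu>"
    using picard_polyfam[OF q] by blast
  show "continuous_on ({0..pi} \<times> UNIV) (\<lambda>(x, \<mu>). fst (picard q a b m) x \<mu>)"
    using polyfam_continuous[OF fg(1)] by (rule continuous_on_eq) (use fg in auto)
  show "continuous_on {0..pi} (\<lambda>x. fst (picard q a b m) x \<mu>)"
    using polyfam_continuous_section[OF fg(1)] by (rule continuous_on_eq) (use fg in auto)
  show "continuous_on {0..pi} (\<lambda>x. snd (picard q a b m) x \<mu>)"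
    using polyfam_continuous_section[OF fg(2)] by (rule continuous_on_eq) (use fg in auto)
  assume x: "x \<in> {0..pi}"
  have "fst (picard q a b m) x = f x" "snd (picard q a b m) x = g x" using fg x by auto
  then show "fst (picard q a b m) x holomorphic_on UNIV" "snd (picard q a b m) x holomorphic_on UNIV"
    using polyfam_entire fg by auto
qed

lemma integral_monomial:
  assumes "0 \<le> (x::real)"
  shows "integral {0..x} (\<lambda>t. t ^ m) = x ^ Suc m / Suc m"
proof -
  have "((\<lambda>t::real. t ^ Suc m / Suc m) has_real_derivative t ^ m) (at t within {0..x})" for t
    by (rule derivative_eq_intros refl | simp)+
  then have "((\<lambda>t::real. t ^ m) has_integral (x ^ Suc m / Suc m - 0 ^ Suc m / Suc m)) {0..x}"
    by (intro fundamental_theorem_of_calculus[OF assms])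
      (auto simp: has_real_derivative_iff_has_vector_derivative[symmetric])
  then show ?thesis by (simp add: integral_unique)
qed

lemma norm_integral_le:
  fixes f :: "real \<Rightarrow> complex"
  assumes "continuous_on {c..x} f" "continuous_on {c..x} g" "\<And>t. t \<in> {c..x} \<Longrightarrow> norm (f t) \<le> g t"
  shows "norm (integral {c..x} f) \<le> integral {c..x} g"
  by (rule integral_norm_bound_integral) (use assms in \<open>auto intro: integrable_continuous_interval\<close>)

text \<open>One bound serves both components. The first factor dominates
  \<open>norm (a + b * x)\<close> as well as \<open>norm b\<close>. The factor \<open>1 + pi\<close>
  beside \<open>M + R\<close> covers the single integration that yields the
  \<open>y'\<close>-increment (\<open>c = 1\<close> below) and the further one that yields the
  \<open>y\<close>-increment (\<open>c = x\<close>).\<close>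

lemma picard_bound:
  assumes q: "continuous_on {0..pi} q" and Q: "\<And>x. x \<in> {0..pi} \<Longrightarrow> \<bar>q x\<bar> \<le> M"
    and \<mu>: "norm \<mu> \<le> R" and x: "x \<in> {0..pi}"
  shows "norm (fst (picard q a b m) x \<mu>) \<le> (norm a + norm b * (1 + pi)) * ((M + R) * (1 + pi) * x) ^ m / fact m
       \<and> norm (snd (picard q a b m) x \<mu>) \<le> (norm a + norm b * (1 + pi)) * ((M + R) * (1 + pi) * x) ^ m / fact m"
  using x
proof (induction m arbitrary: x)
  case 0
  have "norm (a + b * x) \<le> norm a + norm b * x"
    using norm_triangle_ineq[of a "b * x"] 0 by (simp add: norm_mult)
  also have "\<dots> \<le> norm a + norm b * (1 + pi)" using 0 by (auto intro!: mult_left_mono)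
  finally have 1: "norm (a + b * x) \<le> norm a + norm b * (1 + pi)" .
  have "norm b * 1 \<le> norm b * (1 + pi)" by (intro mult_left_mono) auto
  then have "norm b \<le> norm a + norm b * (1 + pi)" using norm_ge_zero[of a] by linarith
  with 1 show ?case by simp
next
  case (Suc m)
  define A where "A = norm a + norm b * (1 + pi)"
  define K where "K = (M + R) * (1 + pi)"
  have MR: "0 \<le> M" "0 \<le> R" using Q[of 0] \<mu> norm_ge_zero[of \<mu>] by (simp_all only: atLeastAtMost_iff) (use pi_ge_zero in linarith)+
  have A: "0 \<le> A" by (simp add: A_def)
  have K: "0 \<le> K" using MR by (simp add: K_def)
  let ?I = "\<lambda>x. integral {0..x} (\<lambda>t. (q t - \<mu>) * fst (picard q a b m) t \<mu>)"
  have c: "continuous_on {0..pi} (\<lambda>t. (q t - \<mu>) * fst (picard q a b m) t \<mu>)"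
    by (intro continuous_intros q picard_continuous(2)[OF q])
  have I: "norm (?I s) \<le> (M + R) * (A * K ^ m) * s ^ Suc m / fact (Suc m)" if s: "s \<in> {0..pi}" for s
  proof -
    have "norm (?I s) \<le> integral {0..s} (\<lambda>t. ((M + R) * (A * K ^ m) / fact m) * t ^ m)"
    proof (rule norm_integral_le)
      show "continuous_on {0..s} (\<lambda>t. (q t - \<mu>) * fst (picard q a b m) t \<mu>)"
        by (rule continuous_on_subset[OF c]) (use s in auto)
      show "norm ((q t - \<mu>) * fst (picard q a b m) t \<mu>) \<le> (M + R) * (A * K ^ m) / fact m * t ^ m"
        if t: "t \<in> {0..s}" for t
      proof -
        have tp: "t \<in> {0..pi}" using s t by auto
        have "norm (q t - \<mu>) \<le> M + R"
          using norm_triangle_ineq4[of "complex_of_real (q t)" \<mu>] Q[OF tp] \<mu> by simp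
        moreover have "norm (fst (picard q a b m) t \<mu>) \<le> A * (K * t) ^ m / fact m"
          using Suc.IH[OF tp] by (simp add: A_def K_def)
        ultimately have "norm (q t - \<mu>) * norm (fst (picard q a b m) t \<mu>) \<le> (M + R) * (A * (K * t) ^ m / fact m)"
          using MR by (intro mult_mono) auto
        then show ?thesis by (simp add: norm_mult power_mult_distrib mult_ac)
      qed
    qed (intro continuous_intros)
    also have "\<dots> = ((M + R) * (A * K ^ m) / fact m) * (s ^ Suc m / Suc m)"
      using s by (subst Henstock_Kurzweil_Integration.integral_mult_right) (simp only: integral_monomial atLeastAtMost_iff)
    finally show ?thesis by (simp add: divide_simps mult_ac)
  qed
  have le: "(M + R) * (A * K ^ m) * x ^ Suc m / fact (Suc m) * c \<le> A * (K * x) ^ Suc m / fact (Suc m)"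
    if "0 \<le> c" "c \<le> 1 + pi" for c
  proof -
    have "(M + R) * c \<le> K" unfolding K_def using that MR by (intro mult_left_mono) auto
    then have "(M + R) * c * (A * K ^ m * x ^ Suc m) \<le> K * (A * K ^ m * x ^ Suc m)"
      using A K Suc.prems by (intro mult_right_mono) auto
    then show ?thesis by (simp add: divide_simps power_mult_distrib mult_ac)
  qed
  have 1: "norm (?I x) \<le> A * (K * x) ^ Suc m / fact (Suc m)"
    using I[OF Suc.prems] le[of 1] by simp
  \<comment> \<open>The inner bound is frozen at its right end point, so the outer integration costs
    a factor \<open>x\<close> and does not raise the power.\<close>
  have "norm (integral {0..x} ?I) \<le> integral {0..x} (\<lambda>s. (M + R) * (A * K ^ m) * x ^ Suc m / fact (Suc m))"
  proof (rule norm_integral_le)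
    have "continuous_on {0..pi} ?I"
      by (intro indefinite_integral_continuous_1 integrable_continuous_interval c)
    then show "continuous_on {0..x} ?I" by (rule continuous_on_subset) (use Suc.prems in auto)
    show "norm (?I s) \<le> (M + R) * (A * K ^ m) * x ^ Suc m / fact (Suc m)" if s: "s \<in> {0..x}" for s
    proof -
      have "norm (?I s) \<le> (M + R) * (A * K ^ m) * s ^ Suc m / fact (Suc m)" using I s Suc.prems by auto
      also have "\<dots> \<le> (M + R) * (A * K ^ m) * x ^ Suc m / fact (Suc m)"
        using s MR A K by (intro divide_right_mono mult_left_mono power_mono) auto
      finally show ?thesis .
    qed
  qed auto
  also have "\<dots> = (M + R) * (A * K ^ m) * x ^ Suc m / fact (Suc m) * x" using Suc.prems by simp
  also have "\<dots> \<le> A * (K * x) ^ Suc m / fact (Suc m)" using le[of x] Suc.prems by auto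
  finally show ?case using 1 by (simp add: A_def K_def)
qed

section \<open>Convergence of the Picard series\<close>

text \<open>Comparison with the exponential series. Uniformity in \<open>\<mu>\<close> on balls
  transfers holomorphy to the limit; uniformity in both variables gives the joint continuity that
  later allows a limit in \<open>\<mu>\<close> under an integral over \<open>x\<close>.\<close>

lemma picard_uniform:
  assumes q: "continuous_on {0..pi} q"
  shows "uniform_limit ({0..pi} \<times> cball 0 R) (\<lambda>n (x, \<mu>). \<Sum>m<n. fst (picard q a b m) x \<mu>)
           (\<lambda>(x, \<mu>). sl_sol q a b \<mu> x) sequentially" (is ?A)
    and "uniform_limit ({0..pi} \<times> cball 0 R) (\<lambda>n (x, \<mu>). \<Sum>m<n. snd (picard q a b m) x \<mu>)
           (\<lambda>(x, \<mu>). sl_sol' q a b \<mu> x) sequentially" (is ?B)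
proof -
  have "bounded (q ` {0..pi})" by (intro compact_imp_bounded compact_continuous_image q) auto
  then obtain M where "\<forall>y\<in>q ` {0..pi}. norm y \<le> M" unfolding bounded_iff by blast
  then have M: "\<And>x. x \<in> {0..pi} \<Longrightarrow> \<bar>q x\<bar> \<le> M" by simp
  define A where "A = norm a + norm b * (1 + pi)"
  define K where "K = (M + R) * (1 + pi) * pi"
  have s: "summable (\<lambda>m. A * (K ^ m / fact m))"
    by (intro summable_mult) (use summable_exp[of K] in \<open>simp add: divide_inverse mult.commute\<close>)
  have *: "norm (fst (picard q a b m) x \<mu>) \<le> A * (K ^ m / fact m) \<and> norm (snd (picard q a b m) x \<mu>) \<le> A * (K ^ m / fact m)"
    if "x \<in> {0..pi}" "\<mu> \<in> cball 0 R" for x \<mu> m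
  proof -
    have \<mu>: "norm \<mu> \<le> R" using that by simp
    have MR: "0 \<le> M" "0 \<le> R" using M[of 0] \<mu> norm_ge_zero[of \<mu>] by (simp_all only: atLeastAtMost_iff) (use pi_ge_zero in linarith)+
    have "(M + R) * (1 + pi) * x \<le> K" "0 \<le> (M + R) * (1 + pi) * x"
      using that MR unfolding K_def by (auto intro!: mult_left_mono)
    then have "((M + R) * (1 + pi) * x) ^ m \<le> K ^ m" by (rule power_mono)
    then have "A * ((M + R) * (1 + pi) * x) ^ m / fact m \<le> A * (K ^ m / fact m)"
      by (simp add: A_def divide_right_mono mult_left_mono)
    then show ?thesis using picard_bound[OF q M \<mu> that(1), of a b m] unfolding A_def by linarith
  qed
  have "uniform_limit ({0..pi} \<times> cball 0 R) (\<lambda>n z. \<Sum>m<n. (\<lambda>(x, \<mu>). fst (picard q a b m) x \<mu>) z)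
           (\<lambda>z. \<Sum>m. (\<lambda>(x, \<mu>). fst (picard q a b m) x \<mu>) z) sequentially"
    by (rule Weierstrass_m_test[OF _ s]) (use * in auto)
  then show ?A by (simp add: sl_sol_def case_prod_unfold)
  have "uniform_limit ({0..pi} \<times> cball 0 R) (\<lambda>n z. \<Sum>m<n. (\<lambda>(x, \<mu>). snd (picard q a b m) x \<mu>) z)
           (\<lambda>z. \<Sum>m. (\<lambda>(x, \<mu>). snd (picard q a b m) x \<mu>) z) sequentially"
    by (rule Weierstrass_m_test[OF _ s]) (use * in auto)
  then show ?B by (simp add: sl_sol'_def case_prod_unfold)
qed

lemma picard_section_uniform:
  assumes q: "continuous_on {0..pi} q"
  shows "uniform_limit {0..pi} (\<lambda>n x. \<Sum>m<n. fst (picard q a b m) x \<mu>) (sl_sol q a b \<mu>) sequentially"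
    and "uniform_limit {0..pi} (\<lambda>n x. \<Sum>m<n. snd (picard q a b m) x \<mu>) (sl_sol' q a b \<mu>) sequentially"
  using picard_uniform[OF q, where R="norm \<mu>" and a=a and b=b] unfolding uniform_limit_iff by (auto elim!: eventually_mono)

lemma sl_sol_entire:
  assumes q: "continuous_on {0..pi} q" and x: "x \<in> {0..pi}"
  shows "(\<lambda>\<mu>. sl_sol q a b \<mu> x) holomorphic_on UNIV" "(\<lambda>\<mu>. sl_sol' q a b \<mu> x) holomorphic_on UNIV"
proof -
  have *: "cball z 1 \<subseteq> cball 0 (norm z + 1)" for z :: complex
    by (auto simp: dist_norm) (metis add.commute add_le_cancel_right norm_triangle_sub norm_minus_commute order_trans)
  show "(\<lambda>\<mu>. sl_sol q a b \<mu> x) holomorphic_on UNIV"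
  proof (rule holomorphic_uniform_sequence)
    show "(\<lambda>\<mu>. \<Sum>m<n. fst (picard q a b m) x \<mu>) holomorphic_on UNIV" for n
      by (intro holomorphic_intros picard_continuous(4)[OF q x])
    fix z
    have "uniform_limit (cball z 1) (\<lambda>n \<mu>. \<Sum>m<n. fst (picard q a b m) x \<mu>) (\<lambda>\<mu>. sl_sol q a b \<mu> x) sequentially"
      using picard_uniform(1)[OF q, where R="norm z + 1" and a=a and b=b] * x unfolding uniform_limit_iff
      by (fastforce elim!: eventually_mono)
    then show "\<exists>d>0. cball z d \<subseteq> UNIV \<and> uniform_limit (cball z d)
       (\<lambda>n \<mu>. \<Sum>m<n. fst (picard q a b m) x \<mu>) (\<lambda>\<mu>. sl_sol q a b \<mu> x) sequentially"
      by (intro exI[of _ 1]) auto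
  qed auto
  show "(\<lambda>\<mu>. sl_sol' q a b \<mu> x) holomorphic_on UNIV"
  proof (rule holomorphic_uniform_sequence)
    show "(\<lambda>\<mu>. \<Sum>m<n. snd (picard q a b m) x \<mu>) holomorphic_on UNIV" for n
      by (intro holomorphic_intros picard_continuous(5)[OF q x])
    fix z
    have "uniform_limit (cball z 1) (\<lambda>n \<mu>. \<Sum>m<n. snd (picard q a b m) x \<mu>) (\<lambda>\<mu>. sl_sol' q a b \<mu> x) sequentially"
      using picard_uniform(2)[OF q, where R="norm z + 1" and a=a and b=b] * x unfolding uniform_limit_iff
      by (fastforce elim!: eventually_mono)
    then show "\<exists>d>0. cball z d \<subseteq> UNIV \<and> uniform_limit (cball z d)
       (\<lambda>n \<mu>. \<Sum>m<n. snd (picard q a b m) x \<mu>) (\<lambda>\<mu>. sl_sol' q a b \<mu> x) sequentially"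
      by (intro exI[of _ 1]) auto
  qed auto
qed

lemma sl_sol_continuous:
  assumes q: "continuous_on {0..pi} q"
  shows "continuous_on ({0..pi} \<times> UNIV) (\<lambda>(x, \<mu>). sl_sol q a b \<mu> x)"
    and "continuous_on {0..pi} (sl_sol q a b \<mu>)" "continuous_on {0..pi} (sl_sol' q a b \<mu>)"
proof -
  have c: "continuous_on ({0..pi} \<times> cball 0 R) (\<lambda>(x, \<mu>). sl_sol q a b \<mu> x)" for R
  proof (rule uniform_limit_theorem[OF _ picard_uniform(1)[OF q]])
    have "continuous_on ({0..pi} \<times> cball 0 R) (\<lambda>z. \<Sum>m<n. (\<lambda>(x, \<mu>). fst (picard q a b m) x \<mu>) z)" for n
      by (intro continuous_on_sum continuous_on_subset[OF picard_continuous(1)[OF q]]) auto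
    then show "\<forall>\<^sub>F n in sequentially. continuous_on ({0..pi} \<times> cball 0 R)
        (\<lambda>(x, \<mu>). \<Sum>m<n. fst (picard q a b m) x \<mu>)"
      by (simp add: case_prod_unfold)
  qed simp
  show "continuous_on ({0..pi} \<times> UNIV) (\<lambda>(x, \<mu>). sl_sol q a b \<mu> x)"
    unfolding continuous_on_eq_continuous_within
  proof
    fix z :: "real \<times> complex" assume z: "z \<in> {0..pi} \<times> UNIV"
    let ?R = "norm (snd z) + 1"
    have "continuous (at z within {0..pi} \<times> cball 0 ?R) (\<lambda>(x, \<mu>). sl_sol q a b \<mu> x)"
      using c[of ?R] z unfolding continuous_on_eq_continuous_within by (cases z) auto
    moreover have "at z within {0..pi} \<times> UNIV = at z within {0..pi} \<times> cball 0 ?R"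
      by (rule at_within_nhd[of _ "UNIV \<times> ball 0 ?R"])
        (use z in \<open>auto intro!: open_Times simp: mem_Times_iff\<close>)
    ultimately show "continuous (at z within {0..pi} \<times> UNIV) (\<lambda>(x, \<mu>). sl_sol q a b \<mu> x)" by simp
  qed
  show "continuous_on {0..pi} (sl_sol q a b \<mu>)"
    by (rule uniform_limit_theorem[OF _ picard_section_uniform(1)[OF q]])
      (auto intro!: always_eventually continuous_on_sum picard_continuous[OF q])
  show "continuous_on {0..pi} (sl_sol' q a b \<mu>)"
    by (rule uniform_limit_theorem[OF _ picard_section_uniform(2)[OF q]])
      (auto intro!: always_eventually continuous_on_sum picard_continuous[OF q])
qed

lemma integral_uniform_limit:
  fixes f :: "nat \<Rightarrow> real \<Rightarrow> complex"
  assumes "uniform_limit {0..pi} f g sequentially" "\<And>n. continuous_on {0..pi} (f n)" "x \<in> {0..pi}"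
  shows "(\<lambda>n. integral {0..x} (f n)) \<longlonglongrightarrow> integral {0..x} g"
proof -
  have "uniform_limit (cbox 0 x) f g sequentially"
    using assms(1) by (rule uniform_limit_on_subset) (use assms(3) in auto)
  moreover have "continuous_on (cbox 0 x) (f n)" for n
    using assms(2) by (rule continuous_on_subset) (use assms(3) in auto)
  ultimately obtain I J where "\<And>n. (f n has_integral I n) (cbox 0 x)" "(g has_integral J) (cbox 0 x)" "I \<longlonglongrightarrow> J"
    by (rule uniform_limit_integral_cbox) auto
  moreover from this have "I = (\<lambda>n. integral {0..x} (f n))" "J = integral {0..x} g"
    by (auto simp: fun_eq_iff intro!: integral_unique[symmetric])
  ultimately show ?thesis by simp
qed

lemma sl_sol_integral_eq:
  assumes q: "continuous_on {0..pi} q" and x: "x \<in> {0..pi}"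
  shows "sl_sol q a b \<mu> x = a + integral {0..x} (sl_sol' q a b \<mu>)"
    and "sl_sol' q a b \<mu> x = b + integral {0..x} (\<lambda>t. (q t - \<mu>) * sl_sol q a b \<mu> t)"
proof -
  let ?F = "\<lambda>m t. fst (picard q a b m) t \<mu>" and ?S = "\<lambda>m t. snd (picard q a b m) t \<mu>"
  have sub: "continuous_on {0..x} f" if "continuous_on {0..pi} f" for f :: "real \<Rightarrow> complex"
    using that by (rule continuous_on_subset) (use x in auto)
  have int: "f integrable_on {0..x}" if "continuous_on {0..pi} f" for f :: "real \<Rightarrow> complex"
    using sub[OF that] by (rule integrable_continuous_interval)
  note cF = picard_continuous(2)[OF q, of a b _ \<mu>] and cS = picard_continuous(3)[OF q, of a b _ \<mu>]
  \<comment> \<open>A \<open>y\<close>-increment integrates the \<open>y'\<close>-increment of the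
    same step, but a \<open>y'\<close>-increment integrates the \<open>y\<close>-increment of the
    step before. Hence equal lengths of the partial sums here and lengths shifted by one in
    \<open>S\<close>.\<close>
  have F: "(\<Sum>m<Suc n. ?F m x) = a + integral {0..x} (\<lambda>t. \<Sum>m<Suc n. ?S m t)" for n
  proof (induction n)
    case 0
    then show ?case using x by (simp add: scaleR_conv_of_real mult.commute)
  next
    case (Suc n)
    have "integral {0..x} (\<lambda>t. \<Sum>m<Suc (Suc n). ?S m t)
        = integral {0..x} (\<lambda>t. \<Sum>m<Suc n. ?S m t) + integral {0..x} (?S (Suc n))"
      unfolding sum.lessThan_Suc[of _ "Suc n"]
      by (intro Henstock_Kurzweil_Integration.integral_add int continuous_on_sum cS)
    moreover have "(\<Sum>m<Suc (Suc n). ?F m x) = (\<Sum>m<Suc n. ?F m x) + integral {0..x} (?S (Suc n))"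
      by (simp only: sum.lessThan_Suc picard.simps fst_conv snd_conv)
    ultimately show ?case using Suc.IH by (simp only: add.assoc)
  qed
  have S: "(\<Sum>m<Suc n. ?S m x) = b + integral {0..x} (\<lambda>t. (q t - \<mu>) * (\<Sum>m<n. ?F m t))" for n
  proof (induction n)
    case (Suc n)
    have "integral {0..x} (\<lambda>t. (q t - \<mu>) * (\<Sum>m<Suc n. ?F m t))
        = integral {0..x} (\<lambda>t. (q t - \<mu>) * (\<Sum>m<n. ?F m t)) + integral {0..x} (\<lambda>t. (q t - \<mu>) * ?F n t)"
      unfolding sum.lessThan_Suc distrib_left
      by (intro Henstock_Kurzweil_Integration.integral_add int continuous_intros cF q)
    moreover have "(\<Sum>m<Suc (Suc n). ?S m x) = (\<Sum>m<Suc n. ?S m x) + integral {0..x} (\<lambda>t. (q t - \<mu>) * ?F n t)"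
      by (simp only: sum.lessThan_Suc picard.simps fst_conv snd_conv)
    ultimately show ?case using Suc.IH by (simp only: add.assoc)
  qed simp
  note uF = picard_section_uniform(1)[OF q, where a=a and b=b and \<mu>=\<mu>]
  note uS = picard_section_uniform(2)[OF q, where a=a and b=b and \<mu>=\<mu>]
  show "sl_sol q a b \<mu> x = a + integral {0..x} (sl_sol' q a b \<mu>)"
  proof (rule LIMSEQ_unique)
    show "(\<lambda>n. \<Sum>m<Suc n. ?F m x) \<longlonglongrightarrow> sl_sol q a b \<mu> x"
      using tendsto_uniform_limitI[OF uF x] by (rule LIMSEQ_Suc)
    have "(\<lambda>n. integral {0..x} (\<lambda>t. \<Sum>m<n. ?S m t)) \<longlonglongrightarrow> integral {0..x} (sl_sol' q a b \<mu>)"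
      by (intro integral_uniform_limit[OF uS _ x] continuous_on_sum cS)
    then show "(\<lambda>n. \<Sum>m<Suc n. ?F m x) \<longlonglongrightarrow> a + integral {0..x} (sl_sol' q a b \<mu>)"
      unfolding F by (intro tendsto_add tendsto_const LIMSEQ_Suc)
  qed
  show "sl_sol' q a b \<mu> x = b + integral {0..x} (\<lambda>t. (q t - \<mu>) * sl_sol q a b \<mu> t)"
  proof (rule LIMSEQ_unique)
    show "(\<lambda>n. \<Sum>m<Suc n. ?S m x) \<longlonglongrightarrow> sl_sol' q a b \<mu> x"
      using tendsto_uniform_limitI[OF uS x] by (rule LIMSEQ_Suc)
    have "bounded ((\<lambda>t. q t - \<mu>) ` {0..pi})" "bounded (sl_sol q a b \<mu> ` {0..pi})"
      by (intro compact_imp_bounded compact_continuous_image continuous_intros q sl_sol_continuous[OF q]; simp)+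
    then have "uniform_limit {0..pi} (\<lambda>n t. (q t - \<mu>) * (\<Sum>m<n. ?F m t)) (\<lambda>t. (q t - \<mu>) * sl_sol q a b \<mu> t) sequentially"
      by (intro uniform_lim_mult uniform_limit_const uF)
    then have "(\<lambda>n. integral {0..x} (\<lambda>t. (q t - \<mu>) * (\<Sum>m<n. ?F m t))) \<longlonglongrightarrow> integral {0..x} (\<lambda>t. (q t - \<mu>) * sl_sol q a b \<mu> t)"
      by (intro integral_uniform_limit[OF _ _ x] continuous_intros cF q)
    then show "(\<lambda>n. \<Sum>m<Suc n. ?S m x) \<longlonglongrightarrow> b + integral {0..x} (\<lambda>t. (q t - \<mu>) * sl_sol q a b \<mu> t)"
      unfolding S by (intro tendsto_add tendsto_const)
  qed
qed

lemma sl_sol_0 [simp]: "continuous_on {0..pi} q \<Longrightarrow> sl_sol q a b \<mu> 0 = a" "continuous_on {0..pi} q \<Longrightarrow> sl_sol' q a b \<mu> 0 = b"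
  using sl_sol_integral_eq[of q 0 a b \<mu>] by simp_all

section \<open>Wronskians and uniqueness\<close>

definition sl_ode :: "(real \<Rightarrow> real) \<Rightarrow> complex \<Rightarrow> (real \<Rightarrow> complex) \<Rightarrow> (real \<Rightarrow> complex) \<Rightarrow> bool" where
  "sl_ode q \<mu> y y' \<longleftrightarrow> (\<forall>x\<in>{0..pi}. (y has_vector_derivative y' x) (at x within {0..pi}) \<and>
     (y' has_vector_derivative (q x - \<mu>) * y x) (at x within {0..pi}))"

lemma sl_ode_sl_sol:
  assumes q: "continuous_on {0..pi} q"
  shows "sl_ode q \<mu> (sl_sol q a b \<mu>) (sl_sol' q a b \<mu>)"
  unfolding sl_ode_def
proof (intro ballI conjI)
  fix x assume x: "x \<in> {0..pi}"
  have "((\<lambda>x. a + integral {0..x} (sl_sol' q a b \<mu>)) has_vector_derivative sl_sol' q a b \<mu> x) (at x within {0..pi})"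
    using integral_has_vector_derivative[OF sl_sol_continuous(3)[OF q] x] by (auto intro!: derivative_eq_intros)
  then show "(sl_sol q a b \<mu> has_vector_derivative sl_sol' q a b \<mu> x) (at x within {0..pi})"
    by (rule has_vector_derivative_transform[OF x, rotated]) (rule sl_sol_integral_eq(1)[OF q])
  have "continuous_on {0..pi} (\<lambda>t. (q t - \<mu>) * sl_sol q a b \<mu> t)"
    by (intro continuous_intros q sl_sol_continuous[OF q])
  then have "((\<lambda>x. b + integral {0..x} (\<lambda>t. (q t - \<mu>) * sl_sol q a b \<mu> t)) has_vector_derivative
      (q x - \<mu>) * sl_sol q a b \<mu> x) (at x within {0..pi})"
    using integral_has_vector_derivative[OF _ x] by (auto intro!: derivative_eq_intros)
  then show "(sl_sol' q a b \<mu> has_vector_derivative (q x - \<mu>) * sl_sol q a b \<mu> x) (at x within {0..pi})"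
    by (rule has_vector_derivative_transform[OF x, rotated]) (rule sl_sol_integral_eq(2)[OF q])
qed

text \<open>The derivative of \<open>y * z' - y' * z\<close> is
  \<open>(\<mu> - \<nu>) * (y * z)\<close>, since \<open>q\<close> cancels. Distinct parameters give
  the Lagrange identity behind real and simple eigenvalues; equal ones give a constant
  Wronskian.\<close>

lemma sl_ode_wronskian:
  assumes y: "sl_ode q \<mu> y y'" and z: "sl_ode q \<nu> z z'" and x: "x \<in> {0..pi}"
  shows "((\<lambda>t. (\<mu> - \<nu>) * (y t * z t)) has_integral
    (y x * z' x - y' x * z x) - (y 0 * z' 0 - y' 0 * z 0)) {0..x}"
proof (rule fundamental_theorem_of_calculus)
  show "0 \<le> x" using x by simp
  fix t assume t: "t \<in> {0..x}"
  then have tp: "t \<in> {0..pi}" and sub: "{0..x} \<subseteq> {0..pi}" using x by auto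
  have "(y has_vector_derivative y' t) (at t within {0..x})" "(z has_vector_derivative z' t) (at t within {0..x})"
    "(y' has_vector_derivative (q t - \<mu>) * y t) (at t within {0..x})"
    "(z' has_vector_derivative (q t - \<nu>) * z t) (at t within {0..x})"
    using y z tp has_vector_derivative_within_subset[OF _ sub] unfolding sl_ode_def by blast+
  then show "((\<lambda>t. y t * z' t - y' t * z t) has_vector_derivative (\<mu> - \<nu>) * (y t * z t)) (at t within {0..x})"
    by (auto intro!: derivative_eq_intros simp: algebra_simps)
qed

lemma sl_ode_wronskian_const:
  assumes "sl_ode q \<mu> y y'" "sl_ode q \<mu> z z'" "x \<in> {0..pi}"
  shows "y x * z' x - y' x * z x = y 0 * z' 0 - y' 0 * z 0"
  using sl_ode_wronskian[OF assms] has_integral_unique[OF _ has_integral_0] by force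

text \<open>Cramer's rule for the Wronskians with a fundamental system.\<close>

lemma sl_ode_unique:
  assumes q: "continuous_on {0..pi} q" and y: "sl_ode q \<mu> y y'" and x: "x \<in> {0..pi}"
  shows "y x = sl_sol q (y 0) (y' 0) \<mu> x" "y' x = sl_sol' q (y 0) (y' 0) \<mu> x"
proof -
  let ?u = "sl_sol q (y 0) (y' 0) \<mu>" and ?u' = "sl_sol' q (y 0) (y' 0) \<mu>"
  let ?f = "sl_sol q 1 0 \<mu>" and ?f' = "sl_sol' q 1 0 \<mu>" and ?g = "sl_sol q 0 1 \<mu>" and ?g' = "sl_sol' q 0 1 \<mu>"
  note ode = sl_ode_sl_sol[OF q, of \<mu>]
  have 1: "?f x * ?g' x - ?f' x * ?g x = 1"
    using sl_ode_wronskian_const[OF ode ode x, of 1 0 0 1] q by simp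
  have e: "y x * ?f' x - y' x * ?f x = - y' 0" "?u x * ?f' x - ?u' x * ?f x = - y' 0"
    "y x * ?g' x - y' x * ?g x = y 0" "?u x * ?g' x - ?u' x * ?g x = y 0"
    using sl_ode_wronskian_const[OF y ode x, of 1 0] sl_ode_wronskian_const[OF ode ode x, of "y 0" "y' 0" 1 0]
      sl_ode_wronskian_const[OF y ode x, of 0 1] sl_ode_wronskian_const[OF ode ode x, of "y 0" "y' 0" 0 1] q
    by simp_all
  have 2: "(y x - ?u x) * ?f' x = (y' x - ?u' x) * ?f x" "(y x - ?u x) * ?g' x = (y' x - ?u' x) * ?g x"
    using e by algebra+
  have "y x - ?u x = (y x - ?u x) * (?f x * ?g' x - ?f' x * ?g x)" using 1 by simp
  also have "\<dots> = ?f x * ((y x - ?u x) * ?g' x) - ((y x - ?u x) * ?f' x) * ?g x" by (simp add: algebra_simps)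
  also have "\<dots> = 0" unfolding 2 by (simp add: algebra_simps)
  finally show "y x = ?u x" by simp
  have "y' x - ?u' x = (y' x - ?u' x) * (?f x * ?g' x - ?f' x * ?g x)" using 1 by simp
  also have "\<dots> = ((y' x - ?u' x) * ?f x) * ?g' x - ?f' x * ((y' x - ?u' x) * ?g x)" by (simp add: algebra_simps)
  also have "\<dots> = 0" unfolding 2[symmetric] by (simp add: algebra_simps)
  finally show "y' x = ?u' x" by simp
qed

section \<open>Absolutely continuous functions\<close>

lemma open_cover_null_set:
  assumes "E \<in> null_sets (lebesgue :: real measure)" "0 < \<delta>"
  obtains U where "open U" "E \<subseteq> U" "U \<in> lmeasurable" "measure lebesgue U < \<delta>"
proof -
  have E: "E \<in> sets lebesgue" using assms by auto
  obtain U where U: "open U" "E \<subseteq> U" "emeasure lebesgue (U - E) < ennreal \<delta>"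
    using sets_lebesgue_outer_open[OF E assms(2)] by metis
  have "emeasure lebesgue U = emeasure lebesgue (U - E)"
    using assms(1) U(1) by (intro emeasure_Diff_null_set[symmetric]) auto
  with U(3) have less: "emeasure lebesgue U < ennreal \<delta>" by simp
  then have "U \<in> lmeasurable" using U(1) by (auto simp: fmeasurable_def intro: order_less_trans)
  moreover from this have "measure lebesgue U < \<delta>"
    using less assms(2) by (simp add: emeasure_eq_measure2 ennreal_less_iff)
  ultimately show ?thesis using that U by blast
qed

text \<open>Cousin's lemma: the intervals tagged in the exceptional null set are controlled by absolute
  continuity, the others by the vanishing derivative.\<close>

lemma abs_continuous_AE_zero_derivative_const:
  fixes f :: "real \<Rightarrow> 'a::real_normed_vector"
  assumes ac: "abs_continuous_on {a..b} f"
    and ae: "AE x in lebesgue_on {a..b}. (f has_vector_derivative 0) (at x within {a..b})"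
    and c: "c \<in> {a..b}"
  shows "f c = f a"
proof -
  define E where "E = {x\<in>{a..b}. \<not> (f has_vector_derivative 0) (at x within {a..b})}"
  have "AE x in lebesgue. x \<in> {a..b} \<longrightarrow> (f has_vector_derivative 0) (at x within {a..b})"
    using ae by (subst (asm) AE_restrict_space_iff) auto
  then obtain N where N: "\<And>x. x \<in> space lebesgue - N \<Longrightarrow> x \<in> {a..b} \<longrightarrow> (f has_vector_derivative 0) (at x within {a..b})"
    "N \<in> null_sets lebesgue" by (rule AE_E3) blast
  have "E \<subseteq> N" unfolding E_def using N(1) by auto
  then have E: "E \<in> null_sets lebesgue"
    using N(2) negligible_subset unfolding negligible_iff_null_sets[symmetric] by blast
  \<comment> \<open>The summand \<open>e\<close> pays for the intervals tagged in \<open>E\<close>,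
    and \<open>e * (c - a)\<close> for all the others.\<close>
  have "norm (f c - f a) \<le> e * (1 + (c - a))" if e: "0 < e" for e
  proof -
    obtain \<delta> where \<delta>: "\<delta> > 0" "\<And>D. D division_of \<Union>D \<Longrightarrow> \<Union>D \<subseteq> {a..b} \<Longrightarrow> (\<Sum>k\<in>D. Sup k - Inf k) < \<delta> \<Longrightarrow>
        (\<Sum>k\<in>D. norm (f (Sup k) - f (Inf k))) < e"
      using ac e unfolding abs_continuous_on_def by meson
    obtain U where U: "open U" "E \<subseteq> U" "U \<in> lmeasurable" "measure lebesgue U < \<delta>"
      using open_cover_null_set[OF E \<delta>(1)] by blast
    have "\<exists>d>0. \<forall>y\<in>{a..b}. \<bar>y - x\<bar> < d \<longrightarrow> norm (f y - f x) \<le> e * \<bar>y - x\<bar>" if "x \<in> {a..b} - E" for x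
    proof -
      have "(f has_derivative (\<lambda>h. 0)) (at x within {a..b})"
        using that by (auto simp: E_def has_vector_derivative_def)
      then show ?thesis using e that by (auto simp: has_derivative_within_alt)
    qed
    then obtain d where d: "\<And>x. x \<in> {a..b} - E \<Longrightarrow> 0 < d x"
      "\<And>x y. x \<in> {a..b} - E \<Longrightarrow> y \<in> {a..b} \<Longrightarrow> \<bar>y - x\<bar> < d x \<Longrightarrow> norm (f y - f x) \<le> e * \<bar>y - x\<bar>"
      by metis
    \<comment> \<open>At exceptional tags the gauge is all of \<open>U\<close>, so their intervals
      together stay inside a set of measure below \<open>\<delta>\<close>. Elsewhere it is the
      radius on which the zero derivative is effective. The unit ball outside \<open>{a..b}\<close>
      is a filler.\<close>
    define \<gamma> where "\<gamma> x = (if x \<in> E then U else if x \<in> {a..b} then ball x (d x) else ball x 1)" for x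
    have "gauge \<gamma>" using U d(1) by (auto simp: gauge_def \<gamma>_def)
    then obtain p where p: "p tagged_division_of {a..c}" "\<gamma> fine p" by (rule fine_division_exists_real)
    have fin: "finite p" using p(1) by auto
    let ?g = "\<lambda>k. norm (f (Sup k) - f (Inf k))"
    define p1 where "p1 = {z\<in>p. fst z \<in> E}"
    have box: "\<exists>u v. k = {u..v} \<and> u \<le> x \<and> x \<le> v \<and> a \<le> u \<and> v \<le> c" if xk: "(x, k) \<in> p" for x k
    proof -
      obtain u v where "k = {u..v}" using tagged_division_ofD(4)[OF p(1) xk] by auto
      then show ?thesis using tagged_division_ofD(2,3)[OF p(1) xk] by auto
    qed
    have "norm (f c - f a) = norm (\<Sum>(x, k)\<in>p. f (Sup k) - f (Inf k))"
      using additive_tagged_division_1[OF _ p(1), of f] c by auto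
    also have "\<dots> \<le> (\<Sum>(x, k)\<in>p. ?g k)"
      using norm_sum[of "\<lambda>(x, k). f (Sup k) - f (Inf k)" p] by (simp add: case_prod_unfold)
    also have "\<dots> = (\<Sum>(x, k)\<in>p1. ?g k) + (\<Sum>(x, k)\<in>p - p1. ?g k)"
      using sum.subset_diff[OF _ fin, of p1 "\<lambda>(x, k). ?g k"] by (simp add: p1_def add.commute)
    also have "(\<Sum>(x, k)\<in>p1. ?g k) \<le> e"
    proof -
      have td: "p1 tagged_division_of \<Union>(snd ` p1)"
        by (rule tagged_partial_division_of_Union_self, rule tagged_partial_division_subset[of p])
          (use p(1) in \<open>auto simp: p1_def tagged_division_of_def\<close>)
      note div = division_of_tagged_division[OF td]
      have box1: "\<exists>u v. k = {u..v} \<and> u \<le> v \<and> a \<le> u \<and> v \<le> c" if k: "k \<in> snd ` p1" for k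
      proof -
        obtain x where "(x, k) \<in> p" using k by (auto simp: p1_def)
        then show ?thesis using box order_trans by blast
      qed
      \<comment> \<open>Passing from tagged pairs to bare intervals needs a function that vanishes
        on every interval without interior. For one-point intervals this is automatic; the empty
        interval, where \<open>Sup\<close> and \<open>Inf\<close> mean nothing, gets the value
        \<open>0\<close>.\<close>
      let ?g' = "\<lambda>k. if k = {} then 0 else ?g k"
      have nz: "?g' (cbox u v) = 0" if "box u v = {}" for u v :: real
        using that by (cases "u = v") auto
      have "Sup k - Inf k = measure lebesgue k" if "k \<in> snd ` p1" for k
        using box1[OF that] by (auto simp: measure_completion)
      then have "(\<Sum>k\<in>snd ` p1. Sup k - Inf k) = (\<Sum>k\<in>snd ` p1. measure lebesgue k)"
        by (rule sum.cong[OF refl])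
      also have "\<dots> = measure lebesgue (\<Union>(snd ` p1))"
      proof (rule measure_negligible_finite_Union[symmetric])
        show "finite (snd ` p1)" using fin by (simp add: p1_def)
        show "S \<in> lmeasurable" if S: "S \<in> snd ` p1" for S
          using box1[OF S] by auto
        \<comment> \<open>Two members overlap in a convex set without interior, which is negligible;
          so the total length is the measure of the union.\<close>
        show "pairwise (\<lambda>S T. negligible (S \<inter> T)) (snd ` p1)"
        proof (rule pairwiseI)
          fix S T assume ST: "S \<in> snd ` p1" "T \<in> snd ` p1" "S \<noteq> T"
          then have "interior (S \<inter> T) = {}" using division_ofD(5)[OF div] by simp
          moreover have "convex (S \<inter> T)"
            using division_ofD(4)[OF div ST(1)] division_ofD(4)[OF div ST(2)] by (auto intro!: convex_Int)
          ultimately show "negligible (S \<inter> T)" by (simp add: negligible_convex_interior)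
        qed
      qed
      also have "\<dots> \<le> measure lebesgue U"
      proof (rule measure_mono_fmeasurable[OF _ _ U(3)])
        show "\<Union>(snd ` p1) \<subseteq> U"
        proof (rule Union_least)
          fix k assume "k \<in> snd ` p1"
          then obtain x where "(x, k) \<in> p" "x \<in> E" by (auto simp: p1_def)
          then show "k \<subseteq> U" using fineD[OF p(2), of x k] by (simp add: \<gamma>_def)
        qed
        show "\<Union>(snd ` p1) \<in> sets lebesgue"
        proof (rule sets.finite_Union)
          show "snd ` p1 \<subseteq> sets lebesgue" using box1 by fastforce
        qed (use fin in \<open>simp add: p1_def\<close>)
      qed
      finally have "(\<Sum>k\<in>snd ` p1. Sup k - Inf k) < \<delta>" using U(4) by simp
      moreover have "\<Union>(snd ` p1) \<subseteq> {a..b}"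
      proof (rule Union_least)
        fix k assume "k \<in> snd ` p1"
        then show "k \<subseteq> {a..b}" using box1[of k] c by auto
      qed
      ultimately have "(\<Sum>k\<in>snd ` p1. ?g k) < e" using \<delta>(2) div by blast
      moreover have "(\<Sum>(x, k)\<in>p1. ?g k) = (\<Sum>(x, k)\<in>p1. ?g' k)"
        by (rule sum.cong[OF refl]) (use tagged_division_ofD(2)[OF td] in fastforce)
      moreover have "(\<Sum>k\<in>snd ` p1. ?g k) = (\<Sum>k\<in>snd ` p1. ?g' k)"
        by (rule sum.cong[OF refl]) (use division_ofD(3)[OF div] in simp)
      ultimately show ?thesis using sum.over_tagged_division_lemma[OF td, of ?g'] nz by simp
    qed
    also have "(\<Sum>(x, k)\<in>p - p1. ?g k) \<le> (\<Sum>(x, k)\<in>p - p1. e * (Sup k - Inf k))"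
    proof (rule sum_mono, clarify)
      fix x k assume xk: "(x, k) \<in> p" "(x, k) \<notin> p1"
      obtain u v where uv: "k = {u..v}" "u \<le> x" "x \<le> v" "a \<le> u" "v \<le> c" using box[OF xk(1)] by blast
      have x: "x \<in> {a..b} - E" using xk uv c by (auto simp: p1_def)
      have "k \<subseteq> ball x (d x)" using p(2) xk(1) x by (auto dest!: fineD simp: \<gamma>_def)
      moreover have "u \<in> k" "v \<in> k" using uv by auto
      ultimately have "v \<in> ball x (d x)" "u \<in> ball x (d x)" by blast+
      then have "\<bar>v - x\<bar> < d x" "\<bar>u - x\<bar> < d x" by (simp_all add: dist_real_def abs_minus_commute)
      then have "norm (f v - f x) \<le> e * (v - x)" "norm (f u - f x) \<le> e * (x - u)"
        using d(2)[OF x, of v] d(2)[OF x, of u] uv c by auto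
      moreover have "norm (f v - f u) \<le> norm (f v - f x) + norm (f u - f x)"
        using norm_triangle_ineq4[of "f v - f x" "f u - f x"] by simp
      moreover have "e * (v - x) + e * (x - u) = e * (v - u)" by (simp add: right_diff_distrib)
      ultimately have "norm (f v - f u) \<le> e * (v - u)" by linarith
      then show "?g k \<le> e * (Sup k - Inf k)" using uv by simp
    qed
    also have "\<dots> \<le> (\<Sum>(x, k)\<in>p. e * (Sup k - Inf k))"
    proof (rule sum_mono2[OF fin])
      fix z assume "z \<in> p - (p - p1)"
      then show "0 \<le> (case z of (x, k) \<Rightarrow> e * (Sup k - Inf k))"
        using box[of "fst z" "snd z"] e by (cases z) auto
    qed auto
    also have "\<dots> = e * (\<Sum>(x, k)\<in>p. Sup k - Inf k)" by (simp add: sum_distrib_left case_prod_unfold)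
    also have "(\<Sum>(x, k)\<in>p. Sup k - Inf k) = c - a"
      using additive_tagged_division_1[OF _ p(1), of "\<lambda>x. x"] c by auto
    finally show ?thesis by (simp add: algebra_simps)
  qed
  then have *: "norm (f c - f a) \<le> e * (1 + (c - a))" if "0 < e" for e using that by blast
  have pos: "0 < 1 + (c - a)" using c by simp
  have "norm (f c - f a) \<le> 0 + e" if "0 < e" for e
    using *[of "e / (1 + (c - a))"] pos that by simp
  then show ?thesis using field_le_epsilon[of "norm (f c - f a)" 0] by auto
qed

lemma abs_continuous_on_imp_continuous_on:
  fixes f :: "real \<Rightarrow> 'a::real_normed_vector"
  assumes "abs_continuous_on {a..b} f"
  shows "continuous_on {a..b} f"
  unfolding continuous_on_iff
proof (intro ballI allI impI)
  fix x and e :: real assume x: "x \<in> {a..b}" and "0 < e"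
  then obtain d where d: "0 < d" "\<And>D. D division_of \<Union>D \<Longrightarrow> \<Union>D \<subseteq> {a..b} \<Longrightarrow> (\<Sum>k\<in>D. Sup k - Inf k) < d \<Longrightarrow>
      (\<Sum>k\<in>D. norm (f (Sup k) - f (Inf k))) < e"
    using assms unfolding abs_continuous_on_def by meson
  have *: "norm (f v - f u) < e" if "u \<le> v" "u \<in> {a..b}" "v \<in> {a..b}" "v - u < d" for u v
    using d(2)[of "{{u..v}}"] that division_of_self[of u v] by auto
  have "dist (f y) (f x) < e" if "y \<in> {a..b}" "dist y x < d" for y
    using *[of x y] *[of y x] that x by (cases "x \<le> y") (auto simp: dist_norm norm_minus_commute)
  then show "\<exists>d>0. \<forall>y\<in>{a..b}. dist y x < d \<longrightarrow> dist (f y) (f x) < e" using d(1) by blast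
qed

lemma lipschitz_imp_abs_continuous_on:
  fixes f :: "real \<Rightarrow> 'a::real_normed_vector"
  assumes "\<And>x y. x \<in> {a..b} \<Longrightarrow> y \<in> {a..b} \<Longrightarrow> norm (f y - f x) \<le> B * \<bar>y - x\<bar>"
  shows "abs_continuous_on {a..b} f"
  unfolding abs_continuous_on_def
proof (intro allI impI)
  fix e :: real assume e: "0 < e"
  define d where "d = e / (\<bar>B\<bar> + 1)"
  have "(\<Sum>k\<in>D. norm (f (Sup k) - f (Inf k))) < e"
    if D: "D division_of \<Union>D" "\<Union>D \<subseteq> {a..b}" "(\<Sum>k\<in>D. Sup k - Inf k) < d" for D
  proof -
    have "norm (f (Sup k) - f (Inf k)) \<le> (\<bar>B\<bar> + 1) * (Sup k - Inf k)" if k: "k \<in> D" for k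
    proof -
      obtain u v where uv: "k = {u..v}" using division_ofD(4)[OF D(1) k] by auto
      then have "u \<le> v" using division_ofD(3)[OF D(1) k] by auto
      moreover have "{u..v} \<subseteq> {a..b}" using D(2) k uv by blast
      ultimately have "norm (f v - f u) \<le> B * (v - u)" using assms[of u v] by auto
      also have "\<dots> \<le> (\<bar>B\<bar> + 1) * (v - u)" using \<open>u \<le> v\<close> by (intro mult_right_mono) auto
      finally show ?thesis using uv \<open>u \<le> v\<close> by simp
    qed
    then have "(\<Sum>k\<in>D. norm (f (Sup k) - f (Inf k))) \<le> (\<Sum>k\<in>D. (\<bar>B\<bar> + 1) * (Sup k - Inf k))"
      by (rule sum_mono)
    also have "\<dots> = (\<bar>B\<bar> + 1) * (\<Sum>k\<in>D. Sup k - Inf k)" by (simp add: sum_distrib_left)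
    also have "\<dots> < (\<bar>B\<bar> + 1) * d" using D(3) by (intro mult_strict_left_mono) auto
    finally show ?thesis by (simp add: d_def)
  qed
  moreover have "0 < d" using e by (simp add: d_def)
  ultimately show "\<exists>d>0. \<forall>D. D division_of \<Union>D \<longrightarrow> \<Union>D \<subseteq> {a..b} \<longrightarrow> (\<Sum>k\<in>D. Sup k - Inf k) < d \<longrightarrow>
        (\<Sum>k\<in>D. norm (f (Sup k) - f (Inf k))) < e" by blast
qed

lemma C1_imp_abs_continuous_on:
  fixes f :: "real \<Rightarrow> 'a::real_normed_vector"
  assumes f: "\<And>x. x \<in> {a..b} \<Longrightarrow> (f has_vector_derivative f' x) (at x within {a..b})"
    and f': "continuous_on {a..b} f'"
  shows "abs_continuous_on {a..b} f"
proof -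
  have "bounded (f' ` {a..b})" by (intro compact_imp_bounded compact_continuous_image f') auto
  then obtain B where "\<forall>y\<in>f' ` {a..b}. norm y \<le> B" unfolding bounded_iff by blast
  then have B: "\<And>x. x \<in> {a..b} \<Longrightarrow> norm (f' x) \<le> B" by simp
  show ?thesis
  proof (rule lipschitz_imp_abs_continuous_on)
    fix x y assume xy: "x \<in> {a..b}" "y \<in> {a..b}"
    show "norm (f y - f x) \<le> B * \<bar>y - x\<bar>"
      using differentiable_bound[of "{a..b}" f "\<lambda>x h. h *\<^sub>R f' x" B y x] f B xy
      by (auto simp: has_vector_derivative_def onorm_scaleR_left real_norm_def onorm_id)
  qed
qed

lemma abs_continuous_on_diff:
  fixes f g :: "real \<Rightarrow> 'a::real_normed_vector"
  assumes f: "abs_continuous_on S f" and g: "abs_continuous_on S g"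
  shows "abs_continuous_on S (\<lambda>x. f x - g x)"
  unfolding abs_continuous_on_def
proof (intro allI impI)
  fix e :: real assume "0 < e"
  then have e: "0 < e / 2" by simp
  obtain d where d: "d > 0" "\<And>D. D division_of \<Union>D \<Longrightarrow> \<Union>D \<subseteq> S \<Longrightarrow> (\<Sum>k\<in>D. Sup k - Inf k) < d \<Longrightarrow>
        (\<Sum>k\<in>D. norm (f (Sup k) - f (Inf k))) < e / 2"
    using f e unfolding abs_continuous_on_def by meson
  obtain d' where d': "d' > 0" "\<And>D. D division_of \<Union>D \<Longrightarrow> \<Union>D \<subseteq> S \<Longrightarrow> (\<Sum>k\<in>D. Sup k - Inf k) < d' \<Longrightarrow>
        (\<Sum>k\<in>D. norm (g (Sup k) - g (Inf k))) < e / 2"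
    using g e unfolding abs_continuous_on_def by meson
  have "(\<Sum>k\<in>D. norm (f (Sup k) - g (Sup k) - (f (Inf k) - g (Inf k)))) < e"
    if D: "D division_of \<Union>D" "\<Union>D \<subseteq> S" "(\<Sum>k\<in>D. Sup k - Inf k) < min d d'" for D
  proof -
    have "(\<Sum>k\<in>D. norm (f (Sup k) - g (Sup k) - (f (Inf k) - g (Inf k))))
        \<le> (\<Sum>k\<in>D. norm (f (Sup k) - f (Inf k)) + norm (g (Sup k) - g (Inf k)))"
    proof (rule sum_mono)
      fix k
      show "norm (f (Sup k) - g (Sup k) - (f (Inf k) - g (Inf k)))
          \<le> norm (f (Sup k) - f (Inf k)) + norm (g (Sup k) - g (Inf k))"
        using norm_triangle_ineq4[of "f (Sup k) - f (Inf k)" "g (Sup k) - g (Inf k)"] by (simp add: algebra_simps)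
    qed
    also have "\<dots> < e / 2 + e / 2"
      unfolding sum.distrib using d(2)[of D] d'(2)[of D] D by (intro add_strict_mono) auto
    finally show ?thesis by simp
  qed
  then show "\<exists>d>0. \<forall>D. D division_of \<Union>D \<longrightarrow> \<Union>D \<subseteq> S \<longrightarrow> (\<Sum>k\<in>D. Sup k - Inf k) < d \<longrightarrow>
        (\<Sum>k\<in>D. norm (f (Sup k) - g (Sup k) - (f (Inf k) - g (Inf k)))) < e"
    using d(1) d'(1) by (intro exI[of _ "min d d'"]) auto
qed

section \<open>Eigenvalues as zeros of an entire function\<close>

text \<open>Subtracting from \<open>y'\<close> the primitive of \<open>(q - \<mu>) * y\<close>
  leaves an absolutely continuous function whose derivative is zero almost everywhere, hence a
  constant. As the integrand is continuous, the equation then holds at every point.\<close>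

lemma sl_solution_iff_sl_ode:
  assumes q: "continuous_on {0..pi} q"
  shows "sl_solution q \<mu> y y' \<longleftrightarrow> sl_ode q \<mu> y y'"
proof
  assume s: "sl_solution q \<mu> y y'"
  then have y: "(y has_vector_derivative y' x) (at x within {0..pi})" if "x \<in> {0..pi}" for x
    using that by (auto simp: sl_solution_def)
  then have cy: "continuous_on {0..pi} y"
    using has_vector_derivative_continuous continuous_on_eq_continuous_within by blast
  let ?h = "\<lambda>t. (q t - \<mu>) * y t"
  have ch: "continuous_on {0..pi} ?h" by (intro continuous_intros q cy)
  note dI = integral_has_vector_derivative[OF ch]
  let ?g = "\<lambda>x. y' x - integral {0..x} ?h"
  have "abs_continuous_on {0..pi} ?g"
    using s by (intro abs_continuous_on_diff C1_imp_abs_continuous_on[OF dI ch]) (auto simp: sl_solution_def)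
  moreover have "AE x in lebesgue_on {0..pi}. (?g has_vector_derivative 0) (at x within {0..pi})"
  proof -
    have "AE x in lebesgue_on {0..pi}. x \<in> {0..pi} \<and> (\<exists>y''. (y' has_vector_derivative y'') (at x within {0..pi}) \<and>
        - y'' + complex_of_real (q x) * y x = \<mu> * y x)"
    proof (rule AE_conjI)
      show "AE x in lebesgue_on {0..pi}. x \<in> {0..pi}" by (rule AE_I2) simp
    qed (use s in \<open>simp add: sl_solution_def\<close>)
    then show ?thesis
    proof (eventually_elim, elim conjE exE)
      fix x y'' assume x: "x \<in> {0..pi}" and y'': "(y' has_vector_derivative y'') (at x within {0..pi})"
        "- y'' + complex_of_real (q x) * y x = \<mu> * y x"
      have "y'' = ?h x" using y''(2) by (simp add: algebra_simps add_eq_0_iff)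
      then show "(?g has_vector_derivative 0) (at x within {0..pi})"
        using has_vector_derivative_diff[OF y''(1) dI[OF x]] by simp
    qed
  qed
  ultimately have const: "?g x = ?g 0" if "x \<in> {0..pi}" for x
    using abs_continuous_AE_zero_derivative_const that by blast
  have "(y' has_vector_derivative ?h x) (at x within {0..pi})" if x: "x \<in> {0..pi}" for x
  proof (rule has_vector_derivative_transform[OF x])
    show "((\<lambda>x. y' 0 + integral {0..x} ?h) has_vector_derivative ?h x) (at x within {0..pi})"
      using dI[OF x] by (auto intro!: derivative_eq_intros)
    show "y' t = y' 0 + integral {0..t} ?h" if "t \<in> {0..pi}" for t
      using const[OF that] by (simp add: algebra_simps)
  qed
  with y show "sl_ode q \<mu> y y'" by (simp add: sl_ode_def)
next
  assume o: "sl_ode q \<mu> y y'"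
  then have d: "(y has_vector_derivative y' x) (at x within {0..pi})"
    "(y' has_vector_derivative (q x - \<mu>) * y x) (at x within {0..pi})" if "x \<in> {0..pi}" for x
    using that by (auto simp: sl_ode_def)
  have cy: "continuous_on {0..pi} y" "continuous_on {0..pi} y'"
    using d has_vector_derivative_continuous continuous_on_eq_continuous_within by blast+
  have "abs_continuous_on {0..pi} y" by (rule C1_imp_abs_continuous_on[OF d(1) cy(2)])
  moreover have "abs_continuous_on {0..pi} y'"
    by (rule C1_imp_abs_continuous_on[OF d(2)]) (auto intro!: continuous_intros q cy)
  moreover have "AE x in lebesgue_on {0..pi}. \<exists>y''. (y' has_vector_derivative y'') (at x within {0..pi}) \<and>
        - y'' + complex_of_real (q x) * y x = \<mu> * y x"
    using d(2) by (intro AE_I2 exI conjI) (auto simp: algebra_simps)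
  ultimately show "sl_solution q \<mu> y y'" using d(1) by (simp add: sl_solution_def)
qed

text \<open>Characteristic function of \<open>y'(0) = h y(0)\<close>, \<open>y'(\<pi>) + h y(\<pi>) = 0\<close>.\<close>

definition sl_char :: "(real \<Rightarrow> real) \<Rightarrow> real \<Rightarrow> complex \<Rightarrow> complex" where
  "sl_char q h \<mu> = sl_sol' q 1 h \<mu> pi + h * sl_sol q 1 h \<mu> pi"

lemma sl_ode_scale:
  assumes y: "sl_ode q \<mu> y y'"
  shows "sl_ode q \<mu> (\<lambda>x. c * y x) (\<lambda>x. c * y' x)"
  unfolding sl_ode_def
proof (intro ballI conjI)
  fix x assume "x \<in> {0..pi}"
  then have d: "(y has_vector_derivative y' x) (at x within {0..pi})"
    "(y' has_vector_derivative (q x - \<mu>) * y x) (at x within {0..pi})"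
    using y by (auto simp: sl_ode_def)
  show "((\<lambda>x. c * y x) has_vector_derivative c * y' x) (at x within {0..pi})"
    using d(1) by (rule has_vector_derivative_mult_right)
  show "((\<lambda>x. c * y' x) has_vector_derivative (q x - \<mu>) * (c * y x)) (at x within {0..pi})"
    using has_vector_derivative_mult_right[OF d(2), of c] by (simp only: mult.left_commute)
qed

text \<open>Since \<open>cot (pi - \<alpha>) = - cot \<alpha>\<close>, the same number
  \<open>h\<close> governs both ends, and reflecting the interval changes the problem only by
  reflecting \<open>q\<close>. An eigenfunction is \<open>y 0\<close> times the solution with data
  \<open>(1, h)\<close>, so the condition at \<open>pi\<close> alone decides.\<close>

lemma sl_spectrum_eq:
  assumes q: "continuous_on {0..pi} q"
  shows "sl_spectrum q \<alpha> (pi - \<alpha>) = {\<mu>. sl_char q (- cot \<alpha>) \<mu> = 0}"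
proof -
  let ?h = "- cot \<alpha>"
  have cot: "cot (pi - \<alpha>) = ?h" by (simp add: cot_def)
  note sl_solution_iff_sl_ode[OF q, simp]
  have "\<mu> \<in> sl_spectrum q \<alpha> (pi - \<alpha>) \<longleftrightarrow> sl_char q ?h \<mu> = 0" for \<mu>
  proof
    assume "\<mu> \<in> sl_spectrum q \<alpha> (pi - \<alpha>)"
    then obtain y y' :: "real \<Rightarrow> complex" and x where y: "sl_ode q \<mu> y y'" "x \<in> {0..pi}" "y x \<noteq> 0"
      "y' 0 = ?h * y 0" "y pi * ?h + y' pi = 0"
      by (auto simp: sl_spectrum_def cot add_eq_0_iff mult.commute)
    let ?f = "sl_sol q 1 ?h \<mu>" and ?f' = "sl_sol' q 1 ?h \<mu>"
    have eq: "y t = y 0 * ?f t \<and> y' t = y 0 * ?f' t" if "t \<in> {0..pi}" for t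
      using sl_ode_unique[OF q y(1) that]
        sl_ode_unique[OF q sl_ode_scale[OF sl_ode_sl_sol[OF q], of \<mu> "y 0" 1 ?h] that] q y(4)
      by (simp add: mult.commute)
    have "y 0 \<noteq> 0" using eq[OF y(2)] y(3) by auto
    moreover have "y 0 * sl_char q ?h \<mu> = 0"
      using y(5) eq[of pi] by (simp add: sl_char_def algebra_simps)
    ultimately show "sl_char q ?h \<mu> = 0" by simp
  next
    assume "sl_char q ?h \<mu> = 0"
    then have "sl_sol q 1 ?h \<mu> pi * complex_of_real (cot (pi - \<alpha>)) + sl_sol' q 1 ?h \<mu> pi = 0"
      by (simp add: sl_char_def cot algebra_simps)
    moreover have "\<exists>x\<in>{0..pi}. sl_sol q 1 ?h \<mu> x \<noteq> 0" using q by (intro bexI[of _ 0]) auto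
    ultimately show "\<mu> \<in> sl_spectrum q \<alpha> (pi - \<alpha>)"
      unfolding sl_spectrum_def mem_Collect_eq
      by (intro exI[of _ "sl_sol q 1 ?h \<mu>"] exI[of _ "sl_sol' q 1 ?h \<mu>"])
        (use q sl_ode_sl_sol[OF q] in simp)
  qed
  then show ?thesis by blast
qed

section \<open>Conjugation and reflection\<close>

lemma sl_ode_cnj:
  assumes "sl_ode q \<mu> y y'"
  shows "sl_ode q (cnj \<mu>) (\<lambda>x. cnj (y x)) (\<lambda>x. cnj (y' x))"
  unfolding sl_ode_def
proof (intro ballI conjI)
  fix x assume "x \<in> {0..pi}"
  then have d: "(y has_vector_derivative y' x) (at x within {0..pi})"
    "(y' has_vector_derivative (q x - \<mu>) * y x) (at x within {0..pi})"
    using assms by (auto simp: sl_ode_def)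
  show "((\<lambda>x. cnj (y x)) has_vector_derivative cnj (y' x)) (at x within {0..pi})"
    using d(1) by (rule has_vector_derivative_cnj)
  show "((\<lambda>x. cnj (y' x)) has_vector_derivative (q x - cnj \<mu>) * cnj (y x)) (at x within {0..pi})"
    using has_vector_derivative_cnj[OF d(2)] by simp
qed

lemma sl_ode_reflect:
  assumes "sl_ode q \<mu> y y'"
  shows "sl_ode (\<lambda>x. q (pi - x)) \<mu> (\<lambda>x. y (pi - x)) (\<lambda>x. - y' (pi - x))"
  unfolding sl_ode_def
proof (intro ballI conjI)
  fix x assume x: "x \<in> {0..pi}"
  then have "pi - x \<in> {0..pi}" by auto
  then have d: "(y has_vector_derivative y' (pi - x)) (at (pi - x) within {0..pi})"
    "(y' has_vector_derivative (q (pi - x) - \<mu>) * y (pi - x)) (at (pi - x) within {0..pi})"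
    using assms by (auto simp: sl_ode_def)
  have im: "(\<lambda>x. pi - x) ` {0..pi} = {0..pi}" by (simp add: image_diff_atLeastAtMost)
  have r: "((\<lambda>x. pi - x) has_vector_derivative -1) (at x within {0..pi})"
    by (auto intro!: derivative_eq_intros)
  have c: "((\<lambda>x. f (pi - x)) has_vector_derivative - D) (at x within {0..pi})"
    if "(f has_vector_derivative D) (at (pi - x) within {0..pi})" for f :: "real \<Rightarrow> complex" and D
    using vector_diff_chain_within[OF r, of f D] that im by (simp add: o_def)
  show "((\<lambda>x. y (pi - x)) has_vector_derivative - y' (pi - x)) (at x within {0..pi})"
    by (rule c[OF d(1)])
  show "((\<lambda>x. - y' (pi - x)) has_vector_derivative (q (pi - x) - \<mu>) * y (pi - x)) (at x within {0..pi})"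
    using has_vector_derivative_minus[OF c[OF d(2)]] by simp
qed

lemma continuous_reflect:
  fixes q :: "real \<Rightarrow> real"
  assumes "continuous_on {0..pi} q" shows "continuous_on {0..pi} (\<lambda>x. q (pi - x))"
  by (rule continuous_on_compose2[OF assms]) (auto intro!: continuous_intros)

lemma sl_sol_cnj:
  assumes q: "continuous_on {0..pi} q" and x: "x \<in> {0..pi}"
  shows "sl_sol q (cnj a) (cnj b) (cnj \<mu>) x = cnj (sl_sol q a b \<mu> x)"
    "sl_sol' q (cnj a) (cnj b) (cnj \<mu>) x = cnj (sl_sol' q a b \<mu> x)"
  using sl_ode_unique[OF q sl_ode_cnj[OF sl_ode_sl_sol[OF q]] x, of a b \<mu>] q by simp_all

lemma sl_char_cnj:
  assumes q: "continuous_on {0..pi} q"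
  shows "sl_char q h (cnj \<mu>) = cnj (sl_char q h \<mu>)"
  using sl_sol_cnj[OF q, of pi 1 "of_real h" \<mu>] by (simp add: sl_char_def)

lemma sl_char_entire:
  assumes q: "continuous_on {0..pi} q"
  shows "sl_char q h holomorphic_on UNIV"
proof -
  have "(\<lambda>\<mu>. sl_sol' q 1 h \<mu> pi + h * sl_sol q 1 h \<mu> pi) holomorphic_on UNIV"
    by (intro holomorphic_intros sl_sol_entire[OF q]) auto
  then show ?thesis by (simp add: sl_char_def[abs_def])
qed

section \<open>Consequences of the Lagrange identity: real and simple eigenvalues\<close>

lemma sl_sol_lagrange:
  fixes h :: real
  assumes q: "continuous_on {0..pi} q" and x: "x \<in> {0..pi}"
  shows "sl_sol q 1 h \<mu> x * sl_sol' q 1 h \<nu> x - sl_sol' q 1 h \<mu> x * sl_sol q 1 h \<nu> x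
    = (\<mu> - \<nu>) * integral {0..x} (\<lambda>t. sl_sol q 1 h \<mu> t * sl_sol q 1 h \<nu> t)"
  using integral_unique[OF sl_ode_wronskian[OF sl_ode_sl_sol[OF q] sl_ode_sl_sol[OF q] x, of \<mu> \<nu> 1 h 1 h]] q
  by simp

text \<open>Real initial data make the solution at \<open>cnj \<mu>\<close> the conjugate of the one
  at \<open>\<mu>\<close>, so the integrand is a squared modulus; it equals 1 at the left end. The
  upper limit is left free in order to treat zeros at interior points as well.\<close>

lemma sl_sol_norm_integral_pos:
  fixes h :: real
  assumes q: "continuous_on {0..pi} q" and x: "0 < x" "x \<le> pi"
  obtains I where "0 < I" "integral {0..x} (\<lambda>t. sl_sol q 1 h \<mu> t * sl_sol q 1 h (cnj \<mu>) t) = complex_of_real I"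
proof
  let ?f = "\<lambda>t. (norm (sl_sol q 1 h \<mu> t))\<^sup>2"
  have c: "continuous_on {0..x} ?f"
    by (intro continuous_intros continuous_on_subset[OF sl_sol_continuous(2)[OF q]]) (use x in auto)
  have "integral {0..x} ?f \<noteq> 0"
  proof
    assume "integral {0..x} ?f = 0"
    then have "?f 0 = 0" using integral_eq_0_iff[OF c x(1)] x by auto
    then show False using q by simp
  qed
  moreover have "0 \<le> integral {0..x} ?f"
    by (rule Henstock_Kurzweil_Integration.integral_nonneg) (auto intro: integrable_continuous_interval c)
  ultimately show "0 < integral {0..x} ?f" by simp
  have "integral {0..x} (\<lambda>t. sl_sol q 1 h \<mu> t * sl_sol q 1 h (cnj \<mu>) t) = integral {0..x} (\<lambda>t. complex_of_real (?f t))"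
  proof (rule Henstock_Kurzweil_Integration.integral_cong)
    fix t assume "t \<in> {0..x}"
    then have "t \<in> {0..pi}" using x by auto
    then show "sl_sol q 1 h \<mu> t * sl_sol q 1 h (cnj \<mu>) t = complex_of_real (?f t)"
      using sl_sol_cnj(1)[OF q, of t 1 "of_real h" \<mu>] by (simp del: of_real_power add: complex_norm_square)
  qed
  also have "\<dots> = complex_of_real (integral {0..x} ?f)"
    using has_integral_of_real[OF integrable_integral[OF integrable_continuous_interval[OF c]]]
    by (rule integral_unique)
  finally show "integral {0..x} (\<lambda>t. sl_sol q 1 h \<mu> t * sl_sol q 1 h (cnj \<mu>) t) = complex_of_real (integral {0..x} ?f)" .
qed

lemma sl_char_zero_real:
  assumes q: "continuous_on {0..pi} q" and z: "sl_char q h \<mu> = 0"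
  shows "\<mu> = complex_of_real (Re \<mu>)"
proof -
  obtain I where I: "0 < I" "integral {0..pi} (\<lambda>t. sl_sol q 1 h \<mu> t * sl_sol q 1 h (cnj \<mu>) t) = complex_of_real I"
    using sl_sol_norm_integral_pos[OF q pi_gt_zero order_refl] by blast
  have z': "sl_char q h (cnj \<mu>) = 0" using z by (simp add: sl_char_cnj[OF q])
  have "(\<mu> - cnj \<mu>) * complex_of_real I = 0"
    using sl_sol_lagrange[OF q, of pi h \<mu> "cnj \<mu>"] z z' unfolding I(2) sl_char_def
    by (simp add: eq_neg_iff_add_eq_0[symmetric])
  then have "cnj \<mu> = \<mu>" using I(1) by simp
  then show ?thesis by (simp add: complex_eq_iff)
qed

text \<open>A zero at \<open>x\<close> would make the solution an eigenfunction on
  \<open>{0..x}\<close> with a Dirichlet condition at \<open>x\<close>, and such eigenvalues are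
  real by the same identity. This lets the end of the proof divide by the solution at
  \<open>\<i>\<close>.\<close>

lemma sl_sol_nonreal_nonzero:
  fixes h :: real
  assumes q: "continuous_on {0..pi} q" and x: "x \<in> {0..pi}" and \<mu>: "Im \<mu> \<noteq> 0"
  shows "sl_sol q 1 h \<mu> x \<noteq> 0"
proof
  assume z: "sl_sol q 1 h \<mu> x = 0"
  then have "0 < x" "x \<le> pi" using q x by (cases "x = 0"; simp)+
  then obtain I where I: "0 < I" "integral {0..x} (\<lambda>t. sl_sol q 1 h \<mu> t * sl_sol q 1 h (cnj \<mu>) t) = complex_of_real I"
    using sl_sol_norm_integral_pos[OF q] by blast
  have "sl_sol q 1 h (cnj \<mu>) x = 0" using sl_sol_cnj(1)[OF q x, of 1 "of_real h" \<mu>] z by simp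
  then have "(\<mu> - cnj \<mu>) * complex_of_real I = 0"
    using sl_sol_lagrange[OF q x, of h \<mu> "cnj \<mu>"] z unfolding I(2) by simp
  then have "cnj \<mu> = \<mu>" using I(1) by simp
  then show False using \<mu> by (simp add: complex_eq_iff)
qed

text \<open>The boundary condition at \<open>\<mu>\<close> reduces the Lagrange identity to
  \<open>?k * sl_char q h \<nu> = (\<mu> - \<nu>) * J \<nu>\<close>. Dividing by
  \<open>\<nu> - \<mu>\<close> and letting \<open>\<nu>\<close> tend to \<open>\<mu>\<close> uses
  only continuity of \<open>J\<close>. The formula yields simple zeros and, later, the signs of the
  residues.\<close>

lemma sl_char_deriv:
  assumes q: "continuous_on {0..pi} q" and z: "sl_char q h \<mu> = 0"
  obtains I where "0 < I" "sl_sol q 1 h \<mu> pi * deriv (sl_char q h) \<mu> = - complex_of_real I"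
proof -
  define J where "J \<nu> = integral {0..pi} (\<lambda>t. sl_sol q 1 h \<mu> t * sl_sol q 1 h \<nu> t)" for \<nu>
  let ?k = "sl_sol q 1 h \<mu> pi"
  have cont: "continuous_on UNIV J"
  proof -
    have "continuous_on (UNIV \<times> cbox 0 pi) (\<lambda>z. sl_sol q 1 h \<mu> (snd z) * (\<lambda>(x, \<mu>). sl_sol q 1 h \<mu> x) (snd z, fst z))"
      by (intro continuous_on_mult continuous_on_compose2[OF sl_sol_continuous(2)[OF q]]
          continuous_on_compose2[OF sl_sol_continuous(1)[OF q]] continuous_intros) auto
    then have "continuous_on UNIV (\<lambda>\<nu>. integral (cbox 0 pi) (\<lambda>t. sl_sol q 1 h \<mu> t * sl_sol q 1 h \<nu> t))"
      by (intro integral_continuous_on_param) (simp add: case_prod_unfold)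
    then show ?thesis by (simp add: J_def[abs_def])
  qed
  have L: "?k * sl_char q h \<nu> = (\<mu> - \<nu>) * J \<nu>" for \<nu>
    using sl_sol_lagrange[OF q, of pi h \<mu> \<nu>] z unfolding J_def sl_char_def
    by (simp add: eq_neg_iff_add_eq_0[symmetric] algebra_simps)
  have "(sl_char q h has_field_derivative deriv (sl_char q h) \<mu>) (at \<mu>)"
    using sl_char_entire[OF q] by (intro holomorphic_derivI) auto
  then have "((\<lambda>\<nu>. ?k * (sl_char q h \<nu> / (\<nu> - \<mu>))) \<longlongrightarrow> ?k * deriv (sl_char q h) \<mu>) (at \<mu>)"
    using z by (intro tendsto_intros) (simp add: has_field_derivative_iff)
  moreover have "((\<lambda>\<nu>. - J \<nu>) \<longlongrightarrow> - J \<mu>) (at \<mu>)"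
    using cont by (intro tendsto_intros) (simp add: continuous_on_eq_continuous_at isCont_def)
  then have "((\<lambda>\<nu>. ?k * (sl_char q h \<nu> / (\<nu> - \<mu>))) \<longlongrightarrow> - J \<mu>) (at \<mu>)"
  proof (rule Lim_transform_eventually)
    show "\<forall>\<^sub>F \<nu> in at \<mu>. - J \<nu> = ?k * (sl_char q h \<nu> / (\<nu> - \<mu>))"
      unfolding eventually_at_filter
    proof (intro always_eventually allI impI)
      fix \<nu> assume "\<nu> \<noteq> \<mu>"
      then have "- J \<nu> = (\<mu> - \<nu>) * J \<nu> / (\<nu> - \<mu>)" by (simp add: divide_simps) (simp add: algebra_simps)
      then show "- J \<nu> = ?k * (sl_char q h \<nu> / (\<nu> - \<mu>))" by (simp add: L[symmetric])
    qed
  qed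
  ultimately have eq: "?k * deriv (sl_char q h) \<mu> = - J \<mu>"
    by (rule tendsto_unique[rotated]) auto
  have "cnj \<mu> = \<mu>" using sl_char_zero_real[OF q z] by (metis complex_cnj_complex_of_real)
  then obtain I where "0 < I" "J \<mu> = complex_of_real I"
    using sl_sol_norm_integral_pos[OF q pi_gt_zero order_refl, of h \<mu>] unfolding J_def by metis
  then show ?thesis using that eq by simp
qed

lemma sl_char_simple_zeros:
  assumes q: "continuous_on {0..pi} q" and z: "sl_char q h \<mu> = 0"
  shows "deriv (sl_char q h) \<mu> \<noteq> 0"
  using sl_char_deriv[OF q z] by (metis mult_zero_right neg_equal_0_iff_equal of_real_eq_0_iff less_irrefl)

text \<open>At an eigenvalue the reflected solution has initial data \<open>?k\<close> times
  \<open>(1, h)\<close>, so uniqueness applies. The solution for the reflected potential, evaluated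
  at \<open>pi - x\<close>, is the \<open>\<psi>\<close> of the overview, and \<open>?k\<close> is
  \<open>\<kappa>\<close>.\<close>

lemma sl_char_zero_reflect:
  assumes q: "continuous_on {0..pi} q" and z: "sl_char q h \<mu> = 0" and x: "x \<in> {0..pi}"
  shows "sl_sol q 1 h \<mu> (pi - x) = sl_sol q 1 h \<mu> pi * sl_sol (\<lambda>x. q (pi - x)) 1 h \<mu> x"
proof -
  let ?k = "sl_sol q 1 h \<mu> pi"
  note q' = continuous_reflect[OF q]
  have "- sl_sol' q 1 h \<mu> pi = ?k * h" using z by (simp add: sl_char_def add_eq_0_iff mult.commute)
  then show ?thesis
    using sl_ode_unique(1)[OF q' sl_ode_reflect[OF sl_ode_sl_sol[OF q]] x, of 1 h \<mu>]
      sl_ode_unique(1)[OF q' sl_ode_scale[OF sl_ode_sl_sol[OF q'], of \<mu> ?k 1 h] x] q'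
    by simp
qed

lemma sl_char_zero_norming:
  assumes q: "continuous_on {0..pi} q" and z: "sl_char q h \<mu> = 0"
  shows "sl_sol q 1 h \<mu> pi * sl_sol (\<lambda>x. q (pi - x)) 1 h \<mu> pi = 1"
  using sl_char_zero_reflect[OF q z, of pi] q by simp

section \<open>Sums of residues over simple zeros\<close>

text \<open>The residue is taken as a limit because \<open>f p\<close> may vanish; the singularity
  is then removable and both sides are \<open>0\<close>.\<close>

lemma residue_quotient_simple_zero:
  fixes f g :: "complex \<Rightarrow> complex"
  assumes f: "f holomorphic_on UNIV" and g: "g holomorphic_on UNIV" and p: "g p = 0" "deriv g p \<noteq> 0"
  shows "residue (\<lambda>z. f z / g z) p = f p / deriv g p"
proof -
  have "(g has_field_derivative deriv g p) (at p)"
    using g by (intro holomorphic_derivI) auto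
  then have lim: "((\<lambda>w. g w / (w - p)) \<longlongrightarrow> deriv g p) (at p)"
    using p(1) by (simp add: has_field_derivative_iff)
  have "\<forall>\<^sub>F w in at p. g w / (w - p) \<noteq> 0"
    using tendsto_imp_eventually_ne[OF lim p(2)] .
  then obtain S where S: "open S" "p \<in> S" "\<And>w. w \<in> S \<Longrightarrow> w \<noteq> p \<Longrightarrow> g w \<noteq> 0"
    by (auto simp: eventually_at_topological)
  have "((\<lambda>w. f w / (g w / (w - p))) \<longlongrightarrow> f p / deriv g p) (at p)"
  proof (intro tendsto_divide lim p)
    have "continuous_on UNIV f" using f by (rule holomorphic_on_imp_continuous_on)
    then show "f \<midarrow>p\<rightarrow> f p" by (simp add: continuous_on_eq_continuous_at isCont_def)
  qed
  then have "((\<lambda>w. f w / g w * (w - p)) \<longlongrightarrow> f p / deriv g p) (at p)" by simp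
  moreover have "(\<lambda>z. f z / g z) holomorphic_on S - {p}"
    using S(3) by (intro holomorphic_intros holomorphic_on_subset[OF f] holomorphic_on_subset[OF g]) auto
  ultimately show ?thesis using residue_simple'[OF S(1,2)] by blast
qed

lemma finite_zeros_cball:
  fixes g :: "complex \<Rightarrow> complex"
  assumes g: "g holomorphic_on UNIV" and nz: "g w \<noteq> 0"
  shows "finite {z\<in>cball 0 r. g z = 0}"
proof (cases "g constant_on UNIV")
  case True
  then have "g z \<noteq> 0" for z using nz by (auto simp: constant_on_def)
  then show ?thesis by simp
next
  case False
  then show ?thesis using holomorphic_compact_finite_zeros[OF g _ _ compact_cball, of 0 r] by (simp add: connected_UNIV)
qed

lemma sum_residues_bound:
  fixes f g :: "complex \<Rightarrow> complex"
  assumes f: "f holomorphic_on UNIV" and g: "g holomorphic_on UNIV"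
    and simple: "\<And>z. g z = 0 \<Longrightarrow> deriv g z \<noteq> 0"
    and r: "0 < r" and nz: "\<And>z. norm z = r \<Longrightarrow> g z \<noteq> 0"
    and bound: "\<And>z. norm z = r \<Longrightarrow> norm (f z / g z) \<le> B"
  shows "norm (\<Sum>z | norm z < r \<and> g z = 0. f z / deriv g z) \<le> B * r"
proof -
  let ?Z = "{z. norm z < r \<and> g z = 0}" and ?c = "circlepath 0 r" and ?h = "\<lambda>z. f z / g z"
  have nzr: "g (of_real r) \<noteq> 0" using nz r by simp
  have fin: "finite {z\<in>cball 0 t. g z = 0}" for t by (rule finite_zeros_cball[OF g nzr])
  have finZ: "finite ?Z" by (rule finite_subset[OF _ fin[of r]]) auto
  \<comment> \<open>The residue theorem wants an open set around the closed disc, hence the radius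
    \<open>r + 1\<close>. Zeros beyond the circle come along and drop out through winding number
    zero.\<close>
  let ?P = "{z\<in>cball 0 (r + 1). g z = 0}"
  have eq: "contour_integral ?c ?h = 2 * pi * \<i> * (\<Sum>p\<in>?P. winding_number ?c p * residue ?h p)"
  proof (rule Residue_theorem[where S = "ball 0 (r + 1)"])
    show "?h holomorphic_on ball 0 (r + 1) - ?P"
      by (intro holomorphic_intros holomorphic_on_subset[OF f] holomorphic_on_subset[OF g]) auto
    show "path_image ?c \<subseteq> ball 0 (r + 1) - ?P" using nz r by (auto simp: path_image_circlepath)
    show "\<forall>z. z \<notin> ball 0 (r + 1) \<longrightarrow> winding_number ?c z = 0"
      using r by (auto intro!: winding_number_zero_outside[of _ "cball 0 r"])
  qed (use fin in auto)
  also have "(\<Sum>p\<in>?P. winding_number ?c p * residue ?h p) = (\<Sum>p\<in>?Z. f p / deriv g p)"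
  proof (rule sum.mono_neutral_cong_right)
    show "\<forall>i\<in>?P - ?Z. winding_number ?c i * residue ?h i = 0"
    proof
      fix i assume i: "i \<in> ?P - ?Z"
      then have "r < norm i" using nz[of i] by (cases "norm i = r") auto
      then have "winding_number ?c i = 0"
        using r by (intro winding_number_zero_outside[of _ "cball 0 r"]) auto
      then show "winding_number ?c i * residue ?h i = 0" by simp
    qed
    show "winding_number ?c i * residue ?h i = f i / deriv g i" if "i \<in> ?Z" for i
      using that winding_number_circlepath[of i 0 r] residue_quotient_simple_zero[OF f g _ simple, of i]
      by (simp add: dist_norm)
  qed (use fin in auto)
  finally have eq: "contour_integral ?c ?h = 2 * pi * \<i> * (\<Sum>p\<in>?Z. f p / deriv g p)" .
  have "?h contour_integrable_on ?c"
    by (rule contour_integrable_continuous_circlepath)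
      (intro continuous_intros holomorphic_on_imp_continuous_on holomorphic_on_subset[OF f] holomorphic_on_subset[OF g];
       use nz r in \<open>auto simp: path_image_circlepath\<close>)
  then have "(?h has_contour_integral 2 * pi * \<i> * (\<Sum>p\<in>?Z. f p / deriv g p)) ?c"
    using eq has_contour_integral_integral by force
  moreover have "0 \<le> B" using order_trans[OF norm_ge_zero bound[of "of_real r"]] r by simp
  ultimately have "norm (2 * pi * \<i> * (\<Sum>p\<in>?Z. f p / deriv g p)) \<le> B * (2 * pi * r)"
    using r bound by (intro has_contour_integral_bound_circlepath) auto
  then have "2 * pi * norm (\<Sum>p\<in>?Z. f p / deriv g p) \<le> 2 * pi * (B * r)"
    by (simp add: norm_mult mult_ac)
  then show ?thesis by simp
qed

text \<open>The residue theorem is applied to \<open>f z / (g z * (z - w))\<close>. At the zeros of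
  \<open>g\<close> the function \<open>f\<close> vanishes too, so only \<open>w\<close> contributes,
  with residue \<open>f w / g w\<close>. The extra factor \<open>z - w\<close> compensates the
  length of the circle, so that no rate of decay is needed.\<close>

lemma entire_eq_0_of_circle_decay:
  fixes f g :: "complex \<Rightarrow> complex" and r B :: "nat \<Rightarrow> real"
  assumes f: "f holomorphic_on UNIV" and g: "g holomorphic_on UNIV"
    and simple: "\<And>z. g z = 0 \<Longrightarrow> deriv g z \<noteq> 0" and zero: "\<And>z. g z = 0 \<Longrightarrow> f z = 0"
    and r: "filterlim r at_top sequentially" and B: "B \<longlonglongrightarrow> 0"
    and ev: "\<forall>\<^sub>F N in sequentially. \<forall>z. norm z = r N \<longrightarrow> g z \<noteq> 0 \<and> norm (f z / g z) \<le> B N"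
  shows "f w = 0"
proof (cases "g w = 0")
  case False
  let ?g = "\<lambda>z. g z * (z - w)"
  have g': "?g holomorphic_on UNIV" by (intro holomorphic_intros g)
  have d: "deriv ?g z = deriv g z * (z - w) + g z" for z
  proof (rule DERIV_imp_deriv)
    have "(g has_field_derivative deriv g z) (at z)" using g by (intro holomorphic_derivI) auto
    then show "(?g has_field_derivative deriv g z * (z - w) + g z) (at z)"
      by (auto intro!: derivative_eq_intros)
  qed
  have simple': "deriv ?g z \<noteq> 0" if "?g z = 0" for z using that False simple by (auto simp: d)
  \<comment> \<open>Once the radius exceeds \<open>2 * norm w\<close>, the distance from the circle
    to \<open>w\<close> is at least half the radius; this is the origin of the factor 2.\<close>
  have "\<forall>\<^sub>F N in sequentially. norm (f w / g w) \<le> 2 * B N"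
    using ev filterlim_at_top_dense[THEN iffD1, OF r, rule_format, of "2 * norm w + 1"]
  proof eventually_elim
    case (elim N)
    have rN: "0 < r N" "2 * norm w < r N" using elim norm_ge_zero[of w] by linarith+
    have lower: "r N / 2 \<le> norm (z - w)" if "norm z = r N" for z
      using norm_triangle_ineq2[of z w] rN that by simp
    have "norm (\<Sum>z | norm z < r N \<and> ?g z = 0. f z / deriv ?g z) \<le> 2 * B N / r N * r N"
    proof (rule sum_residues_bound[OF f g' simple' rN(1)])
      fix z :: complex assume z: "norm z = r N"
      show "?g z \<noteq> 0" using elim z lower[OF z] rN by auto
      have "norm (f z / ?g z) = norm (f z / g z) / norm (z - w)" by (simp add: norm_divide norm_mult)
      also have "\<dots> \<le> B N / (r N / 2)"
        using elim z lower[OF z] rN order_trans[OF norm_ge_zero] by (intro frac_le) auto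
      finally show "norm (f z / ?g z) \<le> 2 * B N / r N" by (simp add: field_simps)
    qed
    also have "(\<Sum>z | norm z < r N \<and> ?g z = 0. f z / deriv ?g z) = (\<Sum>z\<in>{w}. f z / deriv ?g z)"
    proof (rule sum.mono_neutral_right)
      have "finite {z\<in>cball 0 (r N). ?g z = 0}"
        by (rule finite_zeros_cball[OF g', of "of_real (r N)"]) (use elim lower[of "of_real (r N)"] rN in auto)
      then show "finite {z. norm z < r N \<and> ?g z = 0}" by (rule rev_finite_subset) auto
        have "norm w < r N" using rN(2) norm_ge_zero[of w] by linarith
      then show "{w} \<subseteq> {z. norm z < r N \<and> ?g z = 0}" by simp
    qed (use zero in auto)
    finally show ?case using rN by (simp add: d)
  qed
  moreover have "(\<lambda>N. 2 * B N) \<longlonglongrightarrow> 0" using tendsto_mult_right_zero[OF B] by simp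
  ultimately have "norm (f w / g w) \<le> 0" by (intro tendsto_lowerbound[where F=sequentially]) auto
  then show ?thesis using False by simp
qed (rule zero)

text \<open>With residues of one sign, a single term is at most the whole sum in absolute value, and
  the sum is at most \<open>B N * r N\<close>. Unlike in the previous criterion, the quotient must
  now beat the radius.\<close>

lemma residues_eq_0_of_circle_decay:
  fixes f g :: "complex \<Rightarrow> complex" and r B :: "nat \<Rightarrow> real"
  assumes f: "f holomorphic_on UNIV" and g: "g holomorphic_on UNIV"
    and simple: "\<And>z. g z = 0 \<Longrightarrow> deriv g z \<noteq> 0" and sign: "\<And>z. g z = 0 \<Longrightarrow> Re (f z / deriv g z) \<le> 0"
    and r: "filterlim r at_top sequentially" and B: "(\<lambda>N. B N * r N) \<longlonglongrightarrow> 0"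
    and ev: "\<forall>\<^sub>F N in sequentially. \<forall>z. norm z = r N \<longrightarrow> g z \<noteq> 0 \<and> norm (f z / g z) \<le> B N"
    and p: "g p = 0"
  shows "Re (f p / deriv g p) = 0"
proof -
  have "\<forall>\<^sub>F N in sequentially. - Re (f p / deriv g p) \<le> B N * r N"
    using ev filterlim_at_top_dense[THEN iffD1, OF r, rule_format, of "norm p"]
  proof eventually_elim
    case (elim N)
    let ?Z = "{z. norm z < r N \<and> g z = 0}"
    have rN: "0 < r N" using elim norm_ge_zero[of p] by linarith
    have "finite {z\<in>cball 0 (r N). g z = 0}"
      by (rule finite_zeros_cball[OF g, of "of_real (r N)"]) (use elim rN in auto)
    then have fin: "finite ?Z" by (rule rev_finite_subset) auto
    have "- Re (f p / deriv g p) = (\<Sum>z\<in>{p}. - Re (f z / deriv g z))" by simp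
    also have "\<dots> \<le> (\<Sum>z\<in>?Z. - Re (f z / deriv g z))"
      by (rule sum_mono2[OF fin]) (use elim p sign in auto)
    also have "\<dots> = - Re (\<Sum>z\<in>?Z. f z / deriv g z)" by (simp add: sum_negf)
    also have "\<dots> \<le> norm (\<Sum>z\<in>?Z. f z / deriv g z)"
      using abs_Re_le_cmod[of "\<Sum>z\<in>?Z. f z / deriv g z"] by linarith
    also have "\<dots> \<le> B N * r N"
      by (rule sum_residues_bound[OF f g simple rN]) (use elim in auto)
    finally show ?case .
  qed
  then have "- Re (f p / deriv g p) \<le> 0"
    by (intro tendsto_lowerbound[OF B]) auto
  then show ?thesis using sign[OF p] by simp
qed

section \<open>Asymptotics in the spectral parameter\<close>

lemma norm_cos_le_exp: "norm (cos (z::complex)) \<le> exp \<bar>Im z\<bar>"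
  and norm_sin_le_exp: "norm (sin (z::complex)) \<le> exp \<bar>Im z\<bar>"
  using cmod_cos_le_exp[of 1 z] cmod_sin_le_exp[of 1 z] by simp_all

text \<open>\<open>k\<close> stands for sine or cosine. The growth over \<open>x - t\<close> from
  the kernel and over \<open>t\<close> from \<open>g\<close> multiply to exactly the growth over
  \<open>x\<close>, so the exponential rate is not worsened.\<close>

lemma kernel_integral_bound:
  fixes k g :: "_ \<Rightarrow> complex" and q :: "real \<Rightarrow> real"
  assumes k: "continuous_on UNIV k" "\<And>z. norm (k z) \<le> exp \<bar>Im z\<bar>"
    and q: "continuous_on {0..pi} q" "\<And>x. x \<in> {0..pi} \<Longrightarrow> \<bar>q x\<bar> \<le> M"
    and g: "continuous_on {0..pi} g" "\<And>x. x \<in> {0..pi} \<Longrightarrow> norm (g x) \<le> G * exp (\<bar>Im l\<bar> * x)"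
    and x: "x \<in> {0..pi}"
  shows "norm (integral {0..x} (\<lambda>t. k (l * (x - t)) * (q t * g t))) \<le> M * pi * G * exp (\<bar>Im l\<bar> * x)"
proof -
  have M: "0 \<le> M" using q(2)[of 0] by simp
  have "0 \<le> G" using order_trans[OF norm_ge_zero g(2)[of 0]] by simp
  have sub: "{0..x} \<subseteq> {0..pi}" using x by auto
  have "norm (integral {0..x} (\<lambda>t. k (l * (x - t)) * (q t * g t))) \<le> integral {0..x} (\<lambda>t. M * G * exp (\<bar>Im l\<bar> * x))"
  proof (rule norm_integral_le)
    show "continuous_on {0..x} (\<lambda>t. k (l * (x - t)) * (q t * g t))"
      by (intro continuous_intros continuous_on_compose2[OF k(1)] continuous_on_subset[OF q(1) sub]
          continuous_on_subset[OF g(1) sub]) auto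
    fix t assume t: "t \<in> {0..x}"
    then have tp: "t \<in> {0..pi}" using sub by auto
    have "norm (k (l * (x - t))) \<le> exp (\<bar>Im l\<bar> * (x - t))"
      using k(2)[of "l * (x - t)"] t by (simp add: abs_mult)
    moreover have "norm (q t * g t) \<le> M * (G * exp (\<bar>Im l\<bar> * t))"
      using q(2)[OF tp] g(2)[OF tp] M unfolding norm_mult by (intro mult_mono) auto
    ultimately have "norm (k (l * (x - t)) * (q t * g t)) \<le> exp (\<bar>Im l\<bar> * (x - t)) * (M * (G * exp (\<bar>Im l\<bar> * t)))"
      unfolding norm_mult[of "k _"] by (intro mult_mono) auto
    also have "\<dots> = M * G * exp (\<bar>Im l\<bar> * (x - t) + \<bar>Im l\<bar> * t)" by (simp add: exp_add)
    also have "\<bar>Im l\<bar> * (x - t) + \<bar>Im l\<bar> * t = \<bar>Im l\<bar> * x" by (simp add: algebra_simps)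
    finally show "norm (k (l * (x - t)) * (q t * g t)) \<le> M * G * exp (\<bar>Im l\<bar> * x)" .
  qed auto
  also have "\<dots> = x * (M * G * exp (\<bar>Im l\<bar> * x))" using x by simp
  also have "\<dots> \<le> pi * (M * G * exp (\<bar>Im l\<bar> * x))" using x M \<open>0 \<le> G\<close> by (intro mult_right_mono) auto
  finally show ?thesis by (simp add: mult_ac)
qed

text \<open>Variation of constants, checked on explicit antiderivatives: differentiating
  \<open>cos (l * (x - t)) * y + sin (l * (x - t)) * y' / l\<close> in \<open>t\<close> cancels
  everything except the term with \<open>q\<close>.\<close>

lemma sl_sol_volterra:
  assumes q: "continuous_on {0..pi} q" and l: "l \<noteq> 0" and x: "x \<in> {0..pi}"
  shows "sl_sol q a b (l\<^sup>2) x = a * cos (l * x) + b * sin (l * x) / l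
      + integral {0..x} (\<lambda>t. sin (l * (x - t)) * (q t * sl_sol q a b (l\<^sup>2) t)) / l" (is ?A)
    and "sl_sol' q a b (l\<^sup>2) x = - a * l * sin (l * x) + b * cos (l * x)
      + integral {0..x} (\<lambda>t. cos (l * (x - t)) * (q t * sl_sol q a b (l\<^sup>2) t))" (is ?B)
proof -
  let ?y = "sl_sol q a b (l\<^sup>2)" and ?y' = "sl_sol' q a b (l\<^sup>2)"
  have d: "(?y has_vector_derivative ?y' t) (at t within {0..x})"
    "(?y' has_vector_derivative (q t - l\<^sup>2) * ?y t) (at t within {0..x})" if "t \<in> {0..x}" for t
  proof -
    have "t \<in> {0..pi}" "{0..x} \<subseteq> {0..pi}" using that x by auto
    then show "(?y has_vector_derivative ?y' t) (at t within {0..x})"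
      "(?y' has_vector_derivative (q t - l\<^sup>2) * ?y t) (at t within {0..x})"
      using sl_ode_sl_sol[OF q, of "l\<^sup>2" a b] has_vector_derivative_within_subset unfolding sl_ode_def by blast+
  qed
  have c: "((\<lambda>t. cos (l * (x - t))) has_vector_derivative l * sin (l * (x - t))) (at t within {0..x})"
    and s: "((\<lambda>t. sin (l * (x - t))) has_vector_derivative - l * cos (l * (x - t))) (at t within {0..x})" for t
  proof -
    have "((\<lambda>z. cos (l * (x - z))) has_field_derivative l * sin (l * (x - t))) (at (complex_of_real t))"
      "((\<lambda>z. sin (l * (x - z))) has_field_derivative - l * cos (l * (x - t))) (at (complex_of_real t))"
      by (auto intro!: derivative_eq_intros)
    from this[THEN has_vector_derivative_real_field]
    show "((\<lambda>t. cos (l * (x - t))) has_vector_derivative l * sin (l * (x - t))) (at t within {0..x})"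
      "((\<lambda>t. sin (l * (x - t))) has_vector_derivative - l * cos (l * (x - t))) (at t within {0..x})"
      by simp_all
  qed
  have "((\<lambda>t. sin (l * (x - t)) * (q t * ?y t) / l) has_integral
      (cos (l * (x - x)) * ?y x + sin (l * (x - x)) * ?y' x / l)
      - (cos (l * (x - 0)) * ?y 0 + sin (l * (x - 0)) * ?y' 0 / l)) {0..x}"
  proof (rule fundamental_theorem_of_calculus)
    fix t assume "t \<in> {0..x}"
    note [derivative_intros] = d[OF this] c[of t] s[of t]
    show "((\<lambda>t. cos (l * (x - t)) * ?y t + sin (l * (x - t)) * ?y' t / l) has_vector_derivative
        sin (l * (x - t)) * (q t * ?y t) / l) (at t within {0..x})"
      by (rule derivative_eq_intros refl)+ (use l in \<open>simp add: field_simps power2_eq_square\<close>)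
  qed (use x in auto)
  from integral_unique[OF this] show ?A using q by (simp add: algebra_simps)
  have "((\<lambda>t. cos (l * (x - t)) * (q t * ?y t)) has_integral
      (- l * sin (l * (x - x)) * ?y x + cos (l * (x - x)) * ?y' x)
      - (- l * sin (l * (x - 0)) * ?y 0 + cos (l * (x - 0)) * ?y' 0)) {0..x}"
  proof (rule fundamental_theorem_of_calculus)
    fix t assume "t \<in> {0..x}"
    note [derivative_intros] = d[OF this] c[of t] s[of t]
    show "((\<lambda>t. - l * sin (l * (x - t)) * ?y t + cos (l * (x - t)) * ?y' t) has_vector_derivative
        cos (l * (x - t)) * (q t * ?y t)) (at t within {0..x})"
      by (rule derivative_eq_intros refl)+ (use l in \<open>simp add: field_simps power2_eq_square\<close>)
  qed (use x in auto)
  from integral_unique[OF this] show ?B using q by (simp add: algebra_simps)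
qed

text \<open>Let \<open>U\<close> be the maximum of the solution divided by the expected exponential.
  In the Volterra equation at the maximum point \<open>x0\<close>, the integral contributes at most
  \<open>U / 2\<close> because \<open>2 * M * pi \<le> norm l\<close>, and is absorbed on the
  left.\<close>

lemma sl_sol_bound:
  fixes h :: real and l :: complex
  assumes q: "continuous_on {0..pi} q" "\<And>x. x \<in> {0..pi} \<Longrightarrow> \<bar>q x\<bar> \<le> M"
    and l: "1 \<le> norm l" "2 * M * pi \<le> norm l" and x: "x \<in> {0..pi}"
  shows "norm (sl_sol q 1 h (l\<^sup>2) x) \<le> 2 * (1 + \<bar>h\<bar>) * exp (\<bar>Im l\<bar> * x)"
proof -
  let ?y = "sl_sol q 1 h (l\<^sup>2)" and ?e = "\<lambda>t. exp (\<bar>Im l\<bar> * t)"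
  have "continuous_on {0..pi} (\<lambda>t. norm (?y t) / ?e t)"
    by (intro continuous_intros sl_sol_continuous[OF q(1)]) auto
  then obtain x0 where x0: "x0 \<in> {0..pi}" "\<And>t. t \<in> {0..pi} \<Longrightarrow> norm (?y t) / ?e t \<le> norm (?y x0) / ?e x0"
    using continuous_attains_sup[of "{0..pi}" "\<lambda>t. norm (?y t) / ?e t"] by auto
  define U where "U = norm (?y x0) / ?e x0"
  have U: "norm (?y t) \<le> U * ?e t" if "t \<in> {0..pi}" for t
    using x0(2)[OF that] by (simp add: U_def[symmetric] pos_divide_le_eq)
  have U0: "0 \<le> U" by (simp add: U_def)
  have l0: "l \<noteq> 0" using l by auto
  let ?I = "integral {0..x0} (\<lambda>t. sin (l * (x0 - t)) * (q t * ?y t))"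
  have I: "norm ?I \<le> M * pi * U * ?e x0"
    by (rule kernel_integral_bound[OF _ norm_sin_le_exp q sl_sol_continuous(2)[OF q(1)] U x0(1)])
      (auto intro!: continuous_intros)
  have c: "norm (cos (l * x0)) \<le> ?e x0" "norm (sin (l * x0)) \<le> ?e x0"
    using norm_cos_le_exp[of "l * x0"] norm_sin_le_exp[of "l * x0"] x0(1) by (auto simp: abs_mult)
  have div: "norm (z / l) \<le> norm z" for z
    using l(1) mult_left_mono[OF l(1), of "norm z"] by (simp add: norm_divide divide_le_eq)
  have "norm (h * sin (l * x0) / l) \<le> \<bar>h\<bar> * ?e x0"
    using order_trans[OF div[of "h * sin (l * x0)"], of "\<bar>h\<bar> * ?e x0"] mult_left_mono[OF c(2), of "\<bar>h\<bar>"]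
    by (simp add: norm_mult)
  moreover have "norm (?I / l) \<le> U * ?e x0 / 2"
  proof -
    have "norm (?I / l) \<le> M * pi * U * ?e x0 / norm l"
      using I by (simp add: norm_divide divide_right_mono)
    also have "\<dots> \<le> (norm l / 2) * (U * ?e x0) / norm l"
      using l U0 mult_right_mono[of "M * pi" "norm l / 2" "U * ?e x0"] by (intro divide_right_mono) auto
    finally show ?thesis using l0 by simp
  qed
  moreover have "norm (?y x0) \<le> norm (cos (l * x0)) + norm (h * sin (l * x0) / l) + norm (?I / l)"
    using sl_sol_volterra(1)[OF q(1) l0 x0(1), of 1 h]
      norm_triangle_ineq[of "cos (l * x0) + h * sin (l * x0) / l" "?I / l"]
      norm_triangle_ineq[of "cos (l * x0)" "h * sin (l * x0) / l"] by simp
  ultimately have "U * ?e x0 \<le> ?e x0 + \<bar>h\<bar> * ?e x0 + U * ?e x0 / 2"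
    using c(1) by (simp add: U_def)
  then have "(U / 2) * ?e x0 \<le> (1 + \<bar>h\<bar>) * ?e x0" by (simp add: algebra_simps)
  then have "U \<le> 2 * (1 + \<bar>h\<bar>)" by simp
  then have "U * ?e x \<le> 2 * (1 + \<bar>h\<bar>) * ?e x" by (intro mult_right_mono) auto
  with U[OF x] show ?thesis by linarith
qed

lemma sl_sol_cos_asymptotics:
  fixes h :: real and l :: complex
  assumes q: "continuous_on {0..pi} q" "\<And>x. x \<in> {0..pi} \<Longrightarrow> \<bar>q x\<bar> \<le> M"
    and l: "1 \<le> norm l" "2 * M * pi \<le> norm l" and x: "x \<in> {0..pi}"
  shows "norm (sl_sol q 1 h (l\<^sup>2) x - cos (l * x))
    \<le> (\<bar>h\<bar> + M * pi * (2 * (1 + \<bar>h\<bar>))) / norm l * exp (\<bar>Im l\<bar> * x)"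
proof -
  let ?y = "sl_sol q 1 h (l\<^sup>2)" and ?e = "exp (\<bar>Im l\<bar> * x)"
  have l0: "l \<noteq> 0" using l by auto
  let ?I = "integral {0..x} (\<lambda>t. sin (l * (x - t)) * (q t * ?y t))"
  have I: "norm ?I \<le> M * pi * (2 * (1 + \<bar>h\<bar>)) * ?e"
    by (rule kernel_integral_bound[OF _ norm_sin_le_exp q sl_sol_continuous(2)[OF q(1)] sl_sol_bound[OF q l] x])
      (auto intro!: continuous_intros)
  have "norm (sin (l * x)) \<le> ?e"
    using norm_sin_le_exp[of "l * x"] x by (auto simp: abs_mult)
  then have "norm (h * sin (l * x)) \<le> \<bar>h\<bar> * ?e" by (auto simp: norm_mult intro!: mult_left_mono)
  then have "norm (h * sin (l * x) + ?I) \<le> (\<bar>h\<bar> + M * pi * (2 * (1 + \<bar>h\<bar>))) * ?e"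
    using I norm_triangle_ineq[of "h * sin (l * x)" ?I] by (simp add: algebra_simps)
  then have "norm ((h * sin (l * x) + ?I) / l) \<le> (\<bar>h\<bar> + M * pi * (2 * (1 + \<bar>h\<bar>))) * ?e / norm l"
    unfolding norm_divide by (rule divide_right_mono) simp
  moreover have "?y x - cos (l * x) = (h * sin (l * x) + ?I) / l"
    using sl_sol_volterra(1)[OF q(1) l0 x, of 1 h] by (simp add: add_divide_distrib)
  ultimately show ?thesis by simp
qed

section \<open>Second-order asymptotics\<close>

text \<open>The Volterra formula at \<open>pi\<close> with the solution under the integral replaced
  by its leading term \<open>cos (l * t)\<close>. In \<open>sl_char_approx\<close> below,
  \<open>h\<close> times the solution at \<open>pi\<close> is replaced by
  \<open>h * cos (l * pi)\<close> too, which explains the coefficient \<open>2 * h\<close>.\<close>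

definition sl_sol_approx :: "(real \<Rightarrow> real) \<Rightarrow> real \<Rightarrow> complex \<Rightarrow> complex" where
  "sl_sol_approx q h l = cos (l * pi) + h * sin (l * pi) / l
     + integral {0..pi} (\<lambda>t. sin (l * (pi - t)) * (q t * cos (l * t))) / l" for l :: complex

definition sl_char_approx :: "(real \<Rightarrow> real) \<Rightarrow> real \<Rightarrow> complex \<Rightarrow> complex" where
  "sl_char_approx q h l = - l * sin (l * pi) + 2 * h * cos (l * pi)
     + integral {0..pi} (\<lambda>t. cos (l * (pi - t)) * (q t * cos (l * t)))" for l :: complex

lemma sl_sol_asymptotics:
  fixes h :: real and l :: complex
  assumes q: "continuous_on {0..pi} q" "\<And>x. x \<in> {0..pi} \<Longrightarrow> \<bar>q x\<bar> \<le> M"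
    and l: "1 \<le> norm l" "2 * M * pi \<le> norm l"
  defines "K \<equiv> \<bar>h\<bar> + M * pi * (2 * (1 + \<bar>h\<bar>))"
  shows "norm (sl_sol q 1 h (l\<^sup>2) pi - sl_sol_approx q h l) \<le> M * pi * K * exp (\<bar>Im l\<bar> * pi) / (norm l)\<^sup>2" (is ?A)
    and "norm (sl_char q h (l\<^sup>2) - sl_char_approx q h l) \<le> (\<bar>h\<bar> + M * pi) * K * exp (\<bar>Im l\<bar> * pi) / norm l" (is ?B)
proof -
  let ?y = "sl_sol q 1 h (l\<^sup>2)" and ?e = "exp (\<bar>Im l\<bar> * pi)"
  have l0: "l \<noteq> 0" using l by auto
  let ?r = "\<lambda>t. ?y t - cos (l * t)"
  have r: "norm (?r x) \<le> (K / norm l) * exp (\<bar>Im l\<bar> * x)" if "x \<in> {0..pi}" for x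
    using sl_sol_cos_asymptotics[OF q l that, of h] by (simp add: K_def)
  have cr: "continuous_on {0..pi} ?r"
    by (intro continuous_intros sl_sol_continuous[OF q(1)])
  have B: "norm (integral {0..pi} (\<lambda>t. k (l * (pi - t)) * (q t * ?r t))) \<le> M * pi * (K / norm l) * ?e"
    and split: "integral {0..pi} (\<lambda>t. k (l * (pi - t)) * (q t * ?y t)) =
      integral {0..pi} (\<lambda>t. k (l * (pi - t)) * (q t * ?r t)) + integral {0..pi} (\<lambda>t. k (l * (pi - t)) * (q t * cos (l * t)))"
    if k: "continuous_on UNIV k" "\<And>z. norm (k z) \<le> exp \<bar>Im z\<bar>" for k :: "complex \<Rightarrow> complex"
  proof -
    show "norm (integral {0..pi} (\<lambda>t. k (l * (pi - t)) * (q t * ?r t))) \<le> M * pi * (K / norm l) * ?e"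
      by (rule kernel_integral_bound[OF k q cr r]) auto
    show "integral {0..pi} (\<lambda>t. k (l * (pi - t)) * (q t * ?y t)) =
      integral {0..pi} (\<lambda>t. k (l * (pi - t)) * (q t * ?r t)) + integral {0..pi} (\<lambda>t. k (l * (pi - t)) * (q t * cos (l * t)))"
      by (subst Henstock_Kurzweil_Integration.integral_add[symmetric])
        (auto simp: algebra_simps intro!: integrable_continuous_interval continuous_intros q(1)
          continuous_on_compose2[OF k(1)] sl_sol_continuous[OF q(1)])
  qed
  have k: "continuous_on UNIV (sin :: complex \<Rightarrow> complex)" "continuous_on UNIV (cos :: complex \<Rightarrow> complex)"
    by (auto intro!: continuous_intros)
  let ?S = "integral {0..pi} (\<lambda>t. sin (l * (pi - t)) * (q t * ?r t))"
  let ?C = "integral {0..pi} (\<lambda>t. cos (l * (pi - t)) * (q t * ?r t))"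
  have pi: "pi \<in> {0..pi}" by simp
  have eq: "?y pi - sl_sol_approx q h l = ?S / l"
    using sl_sol_volterra(1)[OF q(1) l0 pi, of 1 h] split[OF k(1) norm_sin_le_exp]
    by (simp add: sl_sol_approx_def add_divide_distrib)
  show ?A unfolding eq using B[OF k(1) norm_sin_le_exp] l0
    by (simp add: norm_divide divide_simps power2_eq_square mult_ac)
  have eq2: "sl_char q h (l\<^sup>2) - sl_char_approx q h l = ?C + h * ?r pi"
    using sl_sol_volterra(2)[OF q(1) l0 pi, of 1 h] split[OF k(2) norm_cos_le_exp]
    by (simp add: sl_char_def sl_char_approx_def algebra_simps)
  have "norm (h * ?r pi) \<le> \<bar>h\<bar> * ((K / norm l) * ?e)"
    using mult_left_mono[OF r[OF pi], of "\<bar>h\<bar>"] by (simp add: norm_mult)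
  moreover have "M * pi * (K / norm l) * ?e + \<bar>h\<bar> * ((K / norm l) * ?e) = (\<bar>h\<bar> + M * pi) * K * ?e / norm l"
    by (simp add: algebra_simps add_divide_distrib)
  ultimately show ?B unfolding eq2 using B[OF k(2) norm_cos_le_exp] norm_triangle_ineq[of ?C "h * ?r pi"] by linarith
qed

lemma sl_char_leading_term:
  fixes h :: real and l :: complex
  assumes q: "continuous_on {0..pi} q" "\<And>x. x \<in> {0..pi} \<Longrightarrow> \<bar>q x\<bar> \<le> M"
    and l: "1 \<le> norm l" "2 * M * pi \<le> norm l"
  shows "norm (sl_char q h (l\<^sup>2) + l * sin (l * pi))
     \<le> (\<bar>h\<bar> + (\<bar>h\<bar> + M * pi) * (2 * (1 + \<bar>h\<bar>))) * exp (\<bar>Im l\<bar> * pi)"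
proof -
  let ?y = "sl_sol q 1 h (l\<^sup>2)" and ?e = "exp (\<bar>Im l\<bar> * pi)"
  have l0: "l \<noteq> 0" and pi: "pi \<in> {0..pi}" using l by auto
  let ?I = "integral {0..pi} (\<lambda>t. cos (l * (pi - t)) * (q t * ?y t))"
  have I: "norm ?I \<le> M * pi * (2 * (1 + \<bar>h\<bar>)) * ?e"
    by (rule kernel_integral_bound[OF _ norm_cos_le_exp q sl_sol_continuous(2)[OF q(1)] sl_sol_bound[OF q l] pi])
      (auto intro!: continuous_intros)
  have "norm (cos (l * pi)) \<le> ?e"
    using norm_cos_le_exp[of "l * pi"] by (auto simp: abs_mult)
  then have c: "norm (h * cos (l * pi)) \<le> \<bar>h\<bar> * ?e" by (auto simp: norm_mult intro!: mult_left_mono)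
  have y: "norm (h * ?y pi) \<le> \<bar>h\<bar> * (2 * (1 + \<bar>h\<bar>) * ?e)"
    using sl_sol_bound[OF q l pi, of h] unfolding norm_mult by (auto intro!: mult_left_mono)
  have "sl_char q h (l\<^sup>2) + l * sin (l * pi) = h * cos (l * pi) + ?I + h * ?y pi"
    using sl_sol_volterra(2)[OF q(1) l0 pi, of 1 h] by (simp add: sl_char_def)
  then have "norm (sl_char q h (l\<^sup>2) + l * sin (l * pi)) \<le> norm (h * cos (l * pi)) + norm ?I + norm (h * ?y pi)"
    using norm_triangle_ineq[of "h * cos (l * pi) + ?I" "h * ?y pi"] norm_triangle_ineq[of "h * cos (l * pi)" ?I]
    by simp
  also have "\<dots> \<le> \<bar>h\<bar> * ?e + M * pi * (2 * (1 + \<bar>h\<bar>)) * ?e + \<bar>h\<bar> * (2 * (1 + \<bar>h\<bar>) * ?e)"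
    using c I y by linarith
  finally show ?thesis by (simp add: algebra_simps)
qed

text \<open>A single \<open>C\<close> is both the threshold for \<open>norm l\<close> and the
  constant in every bound. The property is then monotone in \<open>C\<close>, and several potentials
  can share one constant by taking a maximum.\<close>

definition sl_est :: "(real \<Rightarrow> real) \<Rightarrow> real \<Rightarrow> real \<Rightarrow> bool" where
  "sl_est q h C \<longleftrightarrow> 1 \<le> C \<and> (\<forall>l::complex. C \<le> norm l \<longrightarrow>
     (\<forall>x\<in>{0..pi}. norm (sl_sol q 1 h (l\<^sup>2) x) \<le> C * exp (\<bar>Im l\<bar> * x)) \<and>
     norm (sl_sol q 1 h (l\<^sup>2) pi - sl_sol_approx q h l) \<le> C * exp (\<bar>Im l\<bar> * pi) / (norm l)\<^sup>2 \<and>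
     norm (sl_char q h (l\<^sup>2) - sl_char_approx q h l) \<le> C * exp (\<bar>Im l\<bar> * pi) / norm l \<and>
     norm (sl_char q h (l\<^sup>2) + l * sin (l * pi)) \<le> C * exp (\<bar>Im l\<bar> * pi))"

lemma sl_estD:
  fixes l :: complex
  assumes "sl_est q h C" "C \<le> norm l"
  shows "x \<in> {0..pi} \<Longrightarrow> norm (sl_sol q 1 h (l\<^sup>2) x) \<le> C * exp (\<bar>Im l\<bar> * x)"
    "norm (sl_sol q 1 h (l\<^sup>2) pi - sl_sol_approx q h l) \<le> C * exp (\<bar>Im l\<bar> * pi) / (norm l)\<^sup>2"
    "norm (sl_char q h (l\<^sup>2) - sl_char_approx q h l) \<le> C * exp (\<bar>Im l\<bar> * pi) / norm l"
    "norm (sl_char q h (l\<^sup>2) + l * sin (l * pi)) \<le> C * exp (\<bar>Im l\<bar> * pi)"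
  using assms unfolding sl_est_def by blast+

lemma sl_est_mono:
  assumes e: "sl_est q h C" and le: "C \<le> C'"
  shows "sl_est q h C'"
  unfolding sl_est_def
proof (intro conjI allI impI ballI)
  show "1 \<le> C'" using assms by (simp add: sl_est_def)
  have *: "C * a \<le> C' * a" if "0 \<le> a" for a using le that by (rule mult_right_mono)
  fix l :: complex assume "C' \<le> norm l"
  then have l: "C \<le> norm l" using le by simp
  show "norm (sl_sol q 1 h (l\<^sup>2) x) \<le> C' * exp (\<bar>Im l\<bar> * x)" if "x \<in> {0..pi}" for x
    by (rule order_trans[OF sl_estD(1)[OF e l that] *[OF exp_ge_zero]])
  show "norm (sl_sol q 1 h (l\<^sup>2) pi - sl_sol_approx q h l) \<le> C' * exp (\<bar>Im l\<bar> * pi) / (norm l)\<^sup>2"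
    using sl_estD(2)[OF e l] *[of "exp (\<bar>Im l\<bar> * pi) / (norm l)\<^sup>2"] by simp
  show "norm (sl_char q h (l\<^sup>2) - sl_char_approx q h l) \<le> C' * exp (\<bar>Im l\<bar> * pi) / norm l"
    using sl_estD(3)[OF e l] *[of "exp (\<bar>Im l\<bar> * pi) / norm l"] by simp
  show "norm (sl_char q h (l\<^sup>2) + l * sin (l * pi)) \<le> C' * exp (\<bar>Im l\<bar> * pi)"
    by (rule order_trans[OF sl_estD(4)[OF e l] *[OF exp_ge_zero]])
qed

lemma sl_est_exists:
  assumes q: "continuous_on {0..pi} q"
  obtains C where "sl_est q h C"
proof -
  have "bounded (q ` {0..pi})" by (intro compact_imp_bounded compact_continuous_image q) auto
  then obtain M where "\<forall>y\<in>q ` {0..pi}. norm y \<le> M" unfolding bounded_iff by blast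
  then have M: "\<And>x. x \<in> {0..pi} \<Longrightarrow> \<bar>q x\<bar> \<le> M" by simp
  let ?K = "\<bar>h\<bar> + M * pi * (2 * (1 + \<bar>h\<bar>))"
  define A where "A = {1, 2 * M * pi, 2 * (1 + \<bar>h\<bar>), M * pi * ?K, (\<bar>h\<bar> + M * pi) * ?K,
      \<bar>h\<bar> + (\<bar>h\<bar> + M * pi) * (2 * (1 + \<bar>h\<bar>))}"
  define C where "C = Max A"
  have C: "a \<le> C" if "a \<in> A" for a using that by (simp add: C_def A_def del: Max_insert)
  have le: "a * e \<le> C * e" if "a \<in> A" "0 \<le> e" for a e using C[OF that(1)] that(2) by (rule mult_right_mono)
  have "sl_est q h C"
    unfolding sl_est_def
  proof (intro conjI allI impI ballI)
    show "1 \<le> C" by (rule C) (simp add: A_def)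
    fix l :: complex assume "C \<le> norm l"
    moreover have "1 \<le> C" "2 * M * pi \<le> C" by (auto intro!: C simp: A_def)
    ultimately have l: "1 \<le> norm l" "2 * M * pi \<le> norm l" by auto
    show "norm (sl_sol q 1 h (l\<^sup>2) x) \<le> C * exp (\<bar>Im l\<bar> * x)" if "x \<in> {0..pi}" for x
      by (rule order_trans[OF sl_sol_bound[OF q M l that] le[OF _ exp_ge_zero]]) (simp_all add: A_def)
    show "norm (sl_sol q 1 h (l\<^sup>2) pi - sl_sol_approx q h l) \<le> C * exp (\<bar>Im l\<bar> * pi) / (norm l)\<^sup>2"
      using sl_sol_asymptotics(1)[OF q M l, of h] le[of "M * pi * ?K" "exp (\<bar>Im l\<bar> * pi) / (norm l)\<^sup>2"]
      by (simp add: A_def)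
    show "norm (sl_char q h (l\<^sup>2) - sl_char_approx q h l) \<le> C * exp (\<bar>Im l\<bar> * pi) / norm l"
      using sl_sol_asymptotics(2)[OF q M l, of h] le[of "(\<bar>h\<bar> + M * pi) * ?K" "exp (\<bar>Im l\<bar> * pi) / norm l"]
      by (simp add: A_def)
    show "norm (sl_char q h (l\<^sup>2) + l * sin (l * pi)) \<le> C * exp (\<bar>Im l\<bar> * pi)"
      by (rule order_trans[OF sl_char_leading_term[OF q M l] le[OF _ exp_ge_zero]]) (simp_all add: A_def)
  qed
  then show ?thesis by (rule that)
qed

section \<open>Lower bounds on the circles\<close>

text \<open>Radii halfway between integers keep away from the zeros of \<open>sin (l * pi)\<close>.
  If \<open>\<bar>Im l\<bar> \<ge> 1 / 4\<close>, then \<open>exp (2 * a) \<ge> 5 / 2\<close>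
  outweighs the cosine in the formula for the squared modulus. Otherwise
  \<open>\<bar>Re l\<bar>\<close> lies between \<open>N + 1 / 4\<close> and
  \<open>N + 1 / 2\<close>, where that cosine is not positive. The 64 is the square of 8.\<close>

lemma norm_sin_pi_lower:
  fixes l :: complex
  assumes l: "norm l = real N + 1 / 2"
  shows "exp (\<bar>Im l\<bar> * pi) / 8 \<le> norm (sin (l * pi))"
proof -
  define a where "a = \<bar>Im l\<bar> * pi"
  have a: "0 \<le> a" by (simp add: a_def)
  have sq: "(norm (sin (l * pi)))\<^sup>2 = (exp (2 * a) + inverse (exp (2 * a)) - 2 * cos (2 * (\<bar>Re l\<bar> * pi))) / 4"
  proof -
    have c: "cos (2 * (Re l * pi)) = cos (2 * (\<bar>Re l\<bar> * pi))"
      by (cases "0 \<le> Re l") (simp_all add: abs_if)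
    have "exp (2 * (Im l * pi)) + inverse (exp (2 * (Im l * pi))) = exp (2 * a) + inverse (exp (2 * a))"
      by (cases "0 \<le> Im l") (simp_all add: a_def exp_minus[symmetric])
    then show ?thesis unfolding norm_sin_squared using c by simp
  qed
  have aux: "E / 64 \<le> (E + I - 2 * c) / 4" if "5 / 2 \<le> E \<and> c \<le> 1 \<or> 0 < E \<and> c \<le> 0" "0 < I" for E I c :: real
    using that by (auto simp: field_simps)
  have pos: "0 < exp (2 * a)" "0 < inverse (exp (2 * a))" by auto
  have "exp (2 * a) / 64 \<le> (norm (sin (l * pi)))\<^sup>2"
  proof (cases "\<bar>Im l\<bar> \<ge> 1 / 4")
    case True
    then have "pi / 4 \<le> a" using mult_right_mono[OF True, of pi] by (simp add: a_def)
    then have "5 / 2 \<le> 1 + 2 * a" using pi_gt3 by simp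
    then have "5 / 2 \<le> exp (2 * a)" using exp_ge_add_one_self[of "2 * a"] by linarith
    then show ?thesis unfolding sq using pos by (intro aux) auto
  next
    case False
    have "norm l \<le> \<bar>Re l\<bar> + \<bar>Im l\<bar>" by (rule cmod_le)
    then have lo: "real N + 1 / 4 \<le> \<bar>Re l\<bar>" using l False by linarith
    have hi: "\<bar>Re l\<bar> \<le> real N + 1 / 2" using abs_Re_le_cmod[of l] l by simp
    let ?\<theta> = "2 * (\<bar>Re l\<bar> - real N) * pi"
    have "cos (2 * (\<bar>Re l\<bar> * pi)) = cos (?\<theta> + 2 * pi * of_int (int N))" by (simp add: algebra_simps)
    also have "\<dots> = cos ?\<theta>" by (simp only: cos_add cos_int_2pin sin_int_2pin mult_1_right mult_zero_right diff_0_right)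
    also have "\<dots> \<le> 0"
    proof -
      have "1 / 2 * pi \<le> ?\<theta>" by (intro mult_right_mono) (use lo in auto)
      moreover have "?\<theta> \<le> 1 * pi" by (intro mult_right_mono) (use hi in auto)
      ultimately have "0 \<le> cos (pi - ?\<theta>)" using pi_ge_zero by (intro cos_ge_zero) linarith+
      then show ?thesis by simp
    qed
    finally show ?thesis unfolding sq using pos by (intro aux) auto
  qed
  then have "(exp a / 8)\<^sup>2 \<le> (norm (sin (l * pi)))\<^sup>2"
    by (simp add: power_divide exp_double)
  then show ?thesis unfolding a_def[symmetric] by (rule power2_le_imp_le) simp
qed

text \<open>The leading term provides \<open>norm l / 8\<close> times the exponential. The
  assumption \<open>16 * C \<le> real N\<close> lets the error consume at most half of it, leaving
  \<open>1 / 16\<close>.\<close>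

lemma sl_char_circle_lower:
  fixes z :: complex
  assumes e: "sl_est q h C" and N: "16 * C \<le> real N" and z: "norm z = (real N + 1 / 2)\<^sup>2"
  shows "norm (csqrt z) = real N + 1 / 2" "C \<le> norm (csqrt z)"
    "norm (csqrt z) * exp (\<bar>Im (csqrt z)\<bar> * pi) / 16 \<le> norm (sl_char q h z)"
proof -
  let ?l = "csqrt z" and ?e = "exp (\<bar>Im (csqrt z)\<bar> * pi)"
  show l: "norm ?l = real N + 1 / 2" using z by simp
  have C: "1 \<le> C" using e by (simp add: sl_est_def)
  then show C': "C \<le> norm ?l" using l N by simp
  have "norm ?l * (?e / 8) \<le> norm ?l * norm (sin (?l * pi))"
    by (intro mult_left_mono norm_sin_pi_lower[OF l]) auto
  also have "\<dots> = norm (?l * sin (?l * pi))" by (simp add: norm_mult)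
  also have "\<dots> \<le> norm (sl_char q h z + ?l * sin (?l * pi)) + norm (sl_char q h z)"
    using norm_triangle_ineq4[of "sl_char q h z + ?l * sin (?l * pi)" "sl_char q h z"] by simp
  also have "norm (sl_char q h z + ?l * sin (?l * pi)) \<le> C * ?e"
    using sl_estD(4)[OF e C'] by simp
  also have "C * ?e \<le> (norm ?l / 16) * ?e"
    using l N C by (intro mult_right_mono) auto
  finally show "norm ?l * ?e / 16 \<le> norm (sl_char q h z)" by simp
qed

section \<open>The sequence of eigenvalues\<close>

lemma strict_mono_enumeration:
  fixes S :: "real set"
  assumes fin: "\<And>b. finite {x\<in>S. x \<le> b}" and unbdd: "\<And>b. \<exists>x\<in>S. b < x"
  obtains m :: "nat \<Rightarrow> real" where "strict_mono m" "range m = S"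
proof -
  \<comment> \<open>Capping by some member beyond \<open>a\<close> makes the set finite and
    nonempty, so its minimum is the next element.\<close>
  define succ where "succ a = Min {x\<in>S. a < x \<and> x \<le> (SOME y. y \<in> S \<and> a < y)}" for a
  have nxt: "succ a \<in> S \<and> a < succ a \<and> (\<forall>x\<in>S. a < x \<longrightarrow> succ a \<le> x)" for a
  proof -
    define y where "y = (SOME y. y \<in> S \<and> a < y)"
    have y: "y \<in> S \<and> a < y" unfolding y_def by (rule someI_ex) (use unbdd in blast)
    let ?T = "{x\<in>S. a < x \<and> x \<le> y}"
    have T: "finite ?T" by (rule finite_subset[OF _ fin[of y]]) auto
    have "succ a \<in> ?T" unfolding succ_def y_def[symmetric] by (rule Min_in[OF T]) (use y in auto)
    moreover have "succ a \<le> x" if "x \<in> S" "a < x" for x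
    proof (cases "x \<le> y")
      case True
      then show ?thesis unfolding succ_def y_def[symmetric] using T that by (intro Min_le) auto
    next
      case False
      then show ?thesis using \<open>succ a \<in> ?T\<close> by auto
    qed
    ultimately show ?thesis by auto
  qed
  obtain s0 where s0: "s0 \<in> S" using unbdd by blast
  define b0 where "b0 = Min {x\<in>S. x \<le> s0} - 1"
  have b0: "b0 < x" if "x \<in> S" for x
  proof (cases "x \<le> s0")
    case True
    then have "Min {x\<in>S. x \<le> s0} \<le> x" using fin that by (intro Min_le) auto
    then show ?thesis by (simp add: b0_def)
  next
    case False
    moreover have "Min {x\<in>S. x \<le> s0} \<le> s0" using fin s0 by (intro Min_le) auto
    ultimately show ?thesis by (simp add: b0_def)
  qed
  \<comment> \<open>\<open>b0\<close> lies strictly below \<open>S\<close> and is not a member, so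
    the enumeration starts after one step.\<close>
  define m where "m n = (succ ^^ Suc n) b0" for n
  have mS: "m n \<in> S" for n using nxt by (simp add: m_def)
  have mono: "strict_mono m" unfolding strict_mono_Suc_iff using nxt by (simp add: m_def)
  have "x \<in> range m" if x: "x \<in> S" for x
  proof (rule ccontr)
    assume nr: "x \<notin> range m"
    have "m n < x" for n
    proof (induction n)
      case 0
      have "m 0 \<le> x" using nxt[of b0] x b0 by (simp add: m_def)
      then show ?case using nr by (metis less_le rangeI)
    next
      case (Suc n)
      have "m (Suc n) \<le> x" using nxt[of "m n"] x Suc by (simp add: m_def)
      then show ?case using nr by (metis less_le rangeI)
    qed
    then have "range m \<subseteq> {y\<in>S. y \<le> x}" using mS less_imp_le by blast
    then have "finite (range m)" using fin finite_subset by blast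
    then show False using mono finite_imageD strict_mono_imp_inj_on infinite_UNIV_nat by blast
  qed
  then show ?thesis using that mono mS by blast
qed

text \<open>At \<open>l = \<i> * k\<close> the leading term is \<open>k * sinh (k * pi)\<close> in
  modulus, at least a quarter of \<open>k * exp (k * pi)\<close>. This bounds the eigenvalues from
  below.\<close>

lemma sl_char_neg_lower:
  assumes e: "sl_est q h C" and k: "C \<le> k"
  shows "(k / 4 - C) * exp (k * pi) \<le> norm (sl_char q h (- (k\<^sup>2)))"
proof -
  let ?l = "\<i> * complex_of_real k"
  have k1: "1 \<le> k" using e k by (simp add: sl_est_def)
  have l2: "?l\<^sup>2 = complex_of_real (- (k\<^sup>2))" by (simp add: power_mult_distrib)
  have "exp (k * pi) / 4 \<le> sinh (k * pi)"
  proof -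
    have "exp (- (k * pi)) \<le> 1" "1 + k * pi \<le> exp (k * pi)" using k1 exp_ge_add_one_self[of "k * pi"] by auto
    moreover have "1 * 3 \<le> k * pi" using k1 pi_gt3 by (intro mult_mono) auto
    ultimately have "2 * exp (- (k * pi)) \<le> exp (k * pi)" by linarith
    then show ?thesis by (simp add: sinh_field_def)
  qed
  then have "k * (exp (k * pi) / 4) \<le> k * sinh (k * pi)" using k1 by (intro mult_left_mono) auto
  also have "\<dots> = norm (?l * sin (?l * pi))"
  proof -
    have "sin (?l * pi) = \<i> * sinh (complex_of_real (k * pi))"
      using sinh_conv_sin[of "complex_of_real (k * pi)"] by (simp add: mult.assoc)
    also have "sinh (complex_of_real (k * pi)) = complex_of_real (sinh (k * pi))"
      by (simp add: sinh_field_def flip: exp_of_real)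
    finally have "norm (sin (?l * pi)) = \<bar>sinh (k * pi)\<bar>" by (simp add: norm_mult del: of_real_mult)
    moreover have "0 \<le> sinh (k * pi)" using k1 by simp
    ultimately show ?thesis using k1 by (simp add: norm_mult)
  qed
  also have "\<dots> \<le> norm (sl_char q h (?l\<^sup>2) + ?l * sin (?l * pi)) + norm (sl_char q h (?l\<^sup>2))"
    using norm_triangle_ineq4[of "sl_char q h (?l\<^sup>2) + ?l * sin (?l * pi)" "sl_char q h (?l\<^sup>2)"] by simp
  also have "norm (sl_char q h (?l\<^sup>2) + ?l * sin (?l * pi)) \<le> C * exp (k * pi)"
    using sl_estD(4)[OF e, of ?l] k k1 by (simp add: norm_mult)
  finally show ?thesis unfolding l2 by (simp add: algebra_simps)
qed

text \<open>\<open>sl_mu\<close> is a definite description, which says something about the spectrum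
  only once an enumeration is exhibited. The zeros are real and bounded below, and only finitely
  many lie in a disc because the function is entire and nonzero at \<open>\<i>\<close>; sign changes
  along the positive axis produce arbitrarily large ones.\<close>

lemma sl_char_zeros_enum:
  assumes q: "continuous_on {0..pi} q"
  obtains m :: "nat \<Rightarrow> real" where "strict_mono m" "range (\<lambda>n. complex_of_real (m n)) = {\<mu>. sl_char q h \<mu> = 0}"
proof -
  obtain C where e: "sl_est q h C" using sl_est_exists[OF q] .
  have C: "1 \<le> C" using e by (simp add: sl_est_def)
  define S where "S = {x::real. sl_char q h x = 0}"
  \<comment> \<open>With \<open>k > 5 * C\<close> the factor \<open>k / 4 - C\<close> of the lower
    bound is positive.\<close>
  have low: "- ((5 * C)\<^sup>2) \<le> x" if x: "x \<in> S" for x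
  proof (rule ccontr)
    assume "\<not> ?thesis"
    then have "(5 * C)\<^sup>2 < - x" by simp
    then have k: "5 * C < sqrt (- x)" by (rule real_less_rsqrt)
    have pos: "0 < - x" using \<open>(5 * C)\<^sup>2 < - x\<close> zero_le_power2[of "5 * C"] by linarith
    have "(sqrt (- x) / 4 - C) * exp (sqrt (- x) * pi) \<le> norm (sl_char q h (- ((sqrt (- x))\<^sup>2)))"
      using k C by (intro sl_char_neg_lower[OF e]) auto
    moreover have "- ((sqrt (- x))\<^sup>2) = x" using pos by simp
    ultimately have "(sqrt (- x) / 4 - C) * exp (sqrt (- x) * pi) \<le> 0" using x by (simp add: S_def)
    moreover have "0 < (sqrt (- x) / 4 - C) * exp (sqrt (- x) * pi)" using k C by (intro mult_pos_pos) auto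
    ultimately show False by linarith
  qed
  have real: "Im (sl_char q h (complex_of_real x)) = 0" for x
    using sl_char_cnj[OF q, of h "complex_of_real x"] by (simp add: complex_eq_iff)
  have val: "\<bar>Re (sl_char q h (((real N + 1 / 2)\<^sup>2)::real)) + (real N + 1 / 2) * (- 1) ^ N\<bar> \<le> C" if N: "C \<le> real N" for N
  proof -
    let ?l = "complex_of_real (real N + 1 / 2)"
    have "C \<le> norm ?l" using N by (simp del: of_real_add)
    then have "norm (sl_char q h (?l\<^sup>2) + ?l * sin (?l * pi)) \<le> C * exp (\<bar>Im ?l\<bar> * pi)" by (rule sl_estD(4)[OF e])
    moreover have "sin (?l * pi) = complex_of_real ((- 1) ^ N)"
    proof -
      have "sin (?l * pi) = complex_of_real (sin ((real N + 1 / 2) * pi))" by (simp only: sin_of_real of_real_mult[symmetric])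
      also have "sin ((real N + 1 / 2) * pi) = (- 1) ^ N"
        by (simp add: distrib_right sin_add)
      finally show ?thesis .
    qed
    ultimately have n: "norm (sl_char q h (?l\<^sup>2) + ?l * complex_of_real ((- 1) ^ N)) \<le> C" by simp
    have "\<bar>Re (sl_char q h (?l\<^sup>2) + ?l * complex_of_real ((- 1) ^ N))\<bar> \<le> C"
      using abs_Re_le_cmod n by (rule order_trans)
    then show ?thesis by (simp only: plus_complex.sel of_real_mult[symmetric] of_real_power[symmetric] Re_complex_of_real)
  qed
  have unbdd: "\<exists>x\<in>S. b < x" for b
  proof -
    obtain N0 where N0: "max C (\<bar>b\<bar> + 1) < real N0" using reals_Archimedean2 by blast
    \<comment> \<open>\<open>N\<close> is made even so that the leading term is negative at
      \<open>N + 1 / 2\<close> and positive at the next half-integer.\<close>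
    define N where "N = 2 * N0"
    have N: "C < real N" "\<bar>b\<bar> + 1 < real N" using N0 by (auto simp: N_def)
    let ?f = "\<lambda>x::real. Re (sl_char q h x)"
    let ?a = "(real N + 1 / 2)\<^sup>2" and ?b = "(real (Suc N) + 1 / 2)\<^sup>2"
    have "continuous_on UNIV (sl_char q h)" by (rule holomorphic_on_imp_continuous_on[OF sl_char_entire[OF q]])
    then have "continuous_on {?a..?b} (\<lambda>x. sl_char q h (complex_of_real x))"
      by (rule continuous_on_compose2) (auto intro: continuous_on_of_real continuous_on_id)
    then have cont: "continuous_on {?a..?b} ?f" by (rule continuous_on_Re)
    have "\<bar>?f ?a + (real N + 1 / 2)\<bar> \<le> C" "\<bar>?f ?b - (real (Suc N) + 1 / 2)\<bar> \<le> C"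
      using val[of N] val[of "Suc N"] N by (simp_all add: N_def)
    then have "?f ?a \<le> 0" "0 \<le> ?f ?b" using N by (auto simp: abs_if split: if_splits)
    moreover have ab: "?a \<le> ?b" by (intro power_mono) auto
    ultimately obtain x where x: "?a \<le> x" "x \<le> ?b" "?f x = 0" using IVT'[of ?f ?a 0 ?b] cont by blast
    then have "sl_char q h x = 0" using real by (simp add: complex_eq_iff)
    moreover have "b < ?a"
    proof -
      have "b < real N + 1 / 2" using N by linarith
      also have "\<dots> \<le> ?a" using N by (simp add: power2_eq_square)
      finally show ?thesis .
    qed
    ultimately show ?thesis using x by (auto simp: S_def)
  qed
  have fin: "finite {x\<in>S. x \<le> b}" for b
  proof -
    have "sl_char q h \<i> \<noteq> 0" using sl_char_zero_real[OF q, of h \<i>] by (auto simp: complex_eq_iff)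
    then have "finite {z\<in>cball 0 (max ((5 * C)\<^sup>2) b). sl_char q h z = 0}" (is "finite ?F")
      by (rule finite_zeros_cball[OF sl_char_entire[OF q]])
    moreover have "complex_of_real ` {x\<in>S. x \<le> b} \<subseteq> ?F"
    proof
      fix z assume "z \<in> complex_of_real ` {x\<in>S. x \<le> b}"
      then obtain x where x: "z = complex_of_real x" "x \<in> S" "x \<le> b" by auto
      then have "\<bar>x\<bar> \<le> max ((5 * C)\<^sup>2) b" using low[OF x(2)] by (auto simp: abs_if)
      then show "z \<in> ?F" using x by (simp add: S_def)
    qed
    ultimately have "finite (complex_of_real ` {x\<in>S. x \<le> b})" by (rule rev_finite_subset)
    then show ?thesis by (rule finite_imageD) (auto simp: inj_on_def)
  qed
  obtain m :: "nat \<Rightarrow> real" where m: "strict_mono m" "range m = S"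
    using fin unbdd by (rule strict_mono_enumeration[of S])
  have "range (\<lambda>n. complex_of_real (m n)) = complex_of_real ` S" 
    unfolding m(2)[symmetric] by (simp add: image_image)
  also have "\<dots> = {\<mu>. sl_char q h \<mu> = 0}"
  proof
    show "{\<mu>. sl_char q h \<mu> = 0} \<subseteq> complex_of_real ` S"
    proof
      fix z assume z: "z \<in> {\<mu>. sl_char q h \<mu> = 0}"
      then have "z = complex_of_real (Re z)" using sl_char_zero_real[OF q] by blast
      moreover from this have "Re z \<in> S" using z by (metis S_def mem_Collect_eq)
      ultimately show "z \<in> complex_of_real ` S" by blast
    qed
  qed (auto simp: S_def)
  finally show ?thesis using m(1) that by blast
qed

section \<open>Isospectral potentials\<close>

lemma continuous_zero: "continuous_on {0..pi} (\<lambda>x. 0 :: real)"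
  by (rule continuous_on_const)

lemma circle_radii: "filterlim (\<lambda>N. (real N + 1 / 2)\<^sup>2) at_top sequentially"
  and circle_decay: "(\<lambda>N. c / (real N + 1 / 2)) \<longlonglongrightarrow> 0"
  by real_asymp+

text \<open>Both characteristic functions have the leading term \<open>-\<lambda> sin (\<lambda>\<pi>)\<close>, so their difference is
  small against either of them on the circles.\<close>

lemma sl_char_eq_of_zeros:
  assumes q: "continuous_on {0..pi} q" and p: "continuous_on {0..pi} p"
    and zeros: "\<And>z. sl_char p h z = 0 \<Longrightarrow> sl_char q h z = 0"
  shows "sl_char q h z = sl_char p h z"
proof -
  obtain C1 C2 where "sl_est q h C1" "sl_est p h C2" using sl_est_exists[OF q] sl_est_exists[OF p] by metis
  then have e: "sl_est q h (max C1 C2)" "sl_est p h (max C1 C2)" by (auto elim: sl_est_mono)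
  define C where "C = max C1 C2"
  note e = e[folded C_def]
  have "sl_char q h z - sl_char p h z = 0"
  proof (rule entire_eq_0_of_circle_decay[where f = "\<lambda>z. sl_char q h z - sl_char p h z",
      OF _ sl_char_entire[OF p] sl_char_simple_zeros[OF p] _ circle_radii circle_decay])
    show "(\<lambda>z. sl_char q h z - sl_char p h z) holomorphic_on UNIV"
      by (intro holomorphic_intros sl_char_entire q p)
    obtain N0 where N0: "16 * C < real N0" using reals_Archimedean2 by blast
    show "\<forall>\<^sub>F N in sequentially. \<forall>z. norm z = (real N + 1 / 2)\<^sup>2 \<longrightarrow> sl_char p h z \<noteq> 0 \<and>
        norm ((sl_char q h z - sl_char p h z) / sl_char p h z) \<le> 32 * C / (real N + 1 / 2)"
      using eventually_ge_at_top[of N0]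
    proof (eventually_elim, intro allI impI)
      fix N and z :: complex assume "N0 \<le> N" and z: "norm z = (real N + 1 / 2)\<^sup>2"
      then have N: "16 * C \<le> real N" using N0 by linarith
      let ?l = "csqrt z" and ?e = "exp (\<bar>Im (csqrt z)\<bar> * pi)"
      note c = sl_char_circle_lower[OF e(2) N z]
      have "sl_char q h z - sl_char p h z = (sl_char q h z + ?l * sin (?l * pi)) - (sl_char p h z + ?l * sin (?l * pi))" by simp
      also have "norm \<dots> \<le> norm (sl_char q h z + ?l * sin (?l * pi)) + norm (sl_char p h z + ?l * sin (?l * pi))"
        by (rule norm_triangle_ineq4)
      also have "\<dots> \<le> 2 * C * ?e" using sl_estD(4)[OF e(1) c(2)] sl_estD(4)[OF e(2) c(2)] by simp
      finally have "norm (sl_char q h z - sl_char p h z) \<le> 2 * C * ?e" .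
      moreover have pos: "0 < (real N + 1 / 2) * ?e / 16" by (simp add: add_nonneg_pos)
      ultimately have "norm (sl_char q h z - sl_char p h z) / norm (sl_char p h z) \<le> 2 * C * ?e / ((real N + 1 / 2) * ?e / 16)"
        using c(3) e unfolding c(1) by (intro frac_le) (auto simp: sl_est_def)
      also have "\<dots> = 32 * C / (real N + 1 / 2)" by simp
      finally have "norm (sl_char q h z - sl_char p h z) / norm (sl_char p h z) \<le> 32 * C / (real N + 1 / 2)" .
      moreover have "0 < norm (sl_char p h z)" using pos c(3) unfolding c(1) by linarith
      ultimately show "sl_char p h z \<noteq> 0 \<and> norm ((sl_char q h z - sl_char p h z) / sl_char p h z) \<le> 32 * C / (real N + 1 / 2)"
        by (auto simp: norm_divide)
    qed
  qed (use zeros in auto)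
  then show ?thesis by simp
qed

section \<open>The mean of the potential\<close>

lemma integral_reflect_interval:
  fixes f :: "real \<Rightarrow> complex"
  assumes "continuous_on {0..c} f"
  shows "integral {0..c} (\<lambda>t. f (c - t)) = integral {0..c} f"
proof -
  have "(f has_integral integral {0..c} f) (cbox 0 c)"
    using assms by (auto intro: integrable_integral integrable_continuous_interval)
  from has_integral_affinity[OF this, of "-1" c]
  have "((\<lambda>t. f (c - t)) has_integral integral {0..c} f) ((\<lambda>x. c - x) ` {0..c})"
    by (simp add: add.commute)
  then show ?thesis by (simp add: image_diff_atLeastAtMost integral_unique)
qed

lemma cos_imaginary: "cos (\<i> * complex_of_real x) = complex_of_real (cosh x)"
  using cosh_conv_cos[of "complex_of_real x"] by (simp add: cosh_field_def flip: exp_of_real)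

lemma cosh_mult_cosh: "cosh a * (c * cosh b) = c * (cosh (a + b) / 2) + c * cosh (a - b) / 2" for a b c :: real
  by (simp add: cosh_add cosh_diff field_simps)

text \<open>At \<open>l = \<i> * k\<close> the two approximations differ by the integral
  \<open>?J\<close>. The product formula for \<open>cosh\<close> splits off
  \<open>cosh (k * pi) / 2\<close> times the integral of \<open>q\<close>; the rest contains
  \<open>cosh (k * (pi - 2 * t))\<close>, whose integral gains a factor \<open>1 / k\<close>. The
  approximation errors are smaller by \<open>1 / k\<close> as well, so dividing by the exponential
  leaves \<open>O(1 / k)\<close>.\<close>

lemma sl_char_eq_imp_integral_zero:
  assumes q: "continuous_on {0..pi} q" and eq: "\<And>z. sl_char q h z = sl_char (\<lambda>x. 0) h z"
  shows "integral {0..pi} q = 0"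
proof -
  have "bounded (q ` {0..pi})" by (intro compact_imp_bounded compact_continuous_image q) auto
  then obtain M where "\<forall>y\<in>q ` {0..pi}. norm y \<le> M" unfolding bounded_iff by blast
  then have M: "\<And>x. x \<in> {0..pi} \<Longrightarrow> \<bar>q x\<bar> \<le> M" by simp
  have M0: "0 \<le> M" using M[of 0] by simp
  obtain C1 C2 where "sl_est q h C1" "sl_est (\<lambda>x. 0) h C2"
    using sl_est_exists[OF q] sl_est_exists[OF continuous_zero] by metis
  then have e: "sl_est q h (max C1 C2)" "sl_est (\<lambda>x. 0) h (max C1 C2)" by (auto elim: sl_est_mono)
  define C where "C = max C1 C2"
  note e = e[folded C_def]
  have C: "1 \<le> C" using e by (simp add: sl_est_def)
  let ?I = "integral {0..pi} q"
  have bound: "\<bar>?I\<bar> \<le> (8 * C + 2 * M) / k" if k: "C \<le> k" for k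
  proof -
    have k0: "0 < k" using k C by simp
    let ?l = "\<i> * complex_of_real k" and ?e = "exp (k * pi)"
    let ?J = "integral {0..pi} (\<lambda>t. cosh (k * (pi - t)) * (q t * cosh (k * t)))"
    let ?R = "integral {0..pi} (\<lambda>t. q t * cosh (k * (pi - 2 * t)))"
    have cJ: "continuous_on {0..pi} (\<lambda>t. cosh (k * (pi - t)) * (q t * cosh (k * t)))"
      by (intro continuous_intros q)
    have l: "C \<le> norm ?l" "norm ?l = k" using k k0 by (simp_all add: norm_mult)
    have "sl_char_approx q h ?l - sl_char_approx (\<lambda>x. 0) h ?l
        = integral {0..pi} (\<lambda>t. cos (?l * (pi - t)) * (q t * cos (?l * t)))"
      by (simp add: sl_char_approx_def)
    also have "\<dots> = integral {0..pi} (\<lambda>t. complex_of_real (cosh (k * (pi - t)) * (q t * cosh (k * t))))"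
    proof (rule Henstock_Kurzweil_Integration.integral_cong)
      fix t
      have c: "cos (?l * complex_of_real x) = complex_of_real (cosh (k * x))" for x
        using cos_imaginary[of "k * x"] by (simp add: mult.assoc)
      show "cos (?l * (pi - t)) * (q t * cos (?l * t)) = complex_of_real (cosh (k * (pi - t)) * (q t * cosh (k * t)))"
        by (simp only: c of_real_mult)
    qed
    also have "\<dots> = complex_of_real ?J"
      using has_integral_of_real[OF integrable_integral[OF integrable_continuous_interval[OF cJ]]]
      by (rule integral_unique)
    finally have d: "sl_char_approx q h ?l - sl_char_approx (\<lambda>x. 0) h ?l = complex_of_real ?J" .
    have "(sl_char (\<lambda>x. 0) h (?l\<^sup>2) - sl_char_approx (\<lambda>x. 0) h ?l) - (sl_char q h (?l\<^sup>2) - sl_char_approx q h ?l)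
        = complex_of_real ?J" unfolding d[symmetric] eq by simp
    then have "\<bar>?J\<bar> = norm ((sl_char (\<lambda>x. 0) h (?l\<^sup>2) - sl_char_approx (\<lambda>x. 0) h ?l) - (sl_char q h (?l\<^sup>2) - sl_char_approx q h ?l))"
      by (simp only: norm_of_real)
    also have "\<dots> \<le> C * ?e / k + C * ?e / k"
      by (rule order_trans[OF norm_triangle_ineq4 add_mono])
        (use sl_estD(3)[OF e(2) l(1)] sl_estD(3)[OF e(1) l(1)] k0 l(2) in simp_all)
    finally have J: "\<bar>?J\<bar> \<le> 2 * C * ?e / k" by simp
    have "?J = integral {0..pi} (\<lambda>t. q t * (cosh (k * pi) / 2) + q t * cosh (k * (pi - 2 * t)) / 2)"
    proof (rule Henstock_Kurzweil_Integration.integral_cong)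
      fix t
      have "k * (pi - t) + k * t = k * pi" "k * (pi - t) - k * t = k * (pi - 2 * t)"
        by (simp_all add: algebra_simps)
      then show "cosh (k * (pi - t)) * (q t * cosh (k * t)) = q t * (cosh (k * pi) / 2) + q t * cosh (k * (pi - 2 * t)) / 2"
        using cosh_mult_cosh[of "k * (pi - t)" "q t" "k * t"] by (simp only:)
    qed
    also have "\<dots> = ?I * (cosh (k * pi) / 2) + ?R / 2"
      by (subst Henstock_Kurzweil_Integration.integral_add)
        (auto intro!: integrable_continuous_interval continuous_intros q)
    finally have split: "?J = ?I * (cosh (k * pi) / 2) + ?R / 2" .
    have "\<bar>?R\<bar> \<le> integral {0..pi} (\<lambda>t. M * cosh (k * (pi - 2 * t)))"
      unfolding real_norm_def[symmetric]
    proof (rule integral_norm_bound_integral)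
      show "norm (q t * cosh (k * (pi - 2 * t))) \<le> M * cosh (k * (pi - 2 * t))" if "t \<in> {0..pi}" for t
        using mult_right_mono[OF M[OF that], of "cosh (k * (pi - 2 * t))"] by (simp add: abs_mult)
    qed (auto intro!: integrable_continuous_interval continuous_intros q)
    also have "\<dots> = M * (sinh (k * pi) / k)"
    proof -
      have "((\<lambda>t. cosh (k * (pi - 2 * t))) has_integral
          - sinh (k * (pi - 2 * pi)) / (2 * k) - (- sinh (k * (pi - 2 * 0)) / (2 * k))) {0..pi}"
      proof (rule fundamental_theorem_of_calculus)
        show "((\<lambda>t. - sinh (k * (pi - 2 * t)) / (2 * k)) has_vector_derivative cosh (k * (pi - 2 * t))) (at t within {0..pi})" for t
          unfolding has_real_derivative_iff_has_vector_derivative[symmetric]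
          using k0 by (auto intro!: derivative_eq_intros)
      qed simp
      from integral_unique[OF this] show ?thesis using k0 by simp
    qed
    also have "\<dots> \<le> M * (?e / k)"
    proof (intro mult_left_mono divide_right_mono)
      show "sinh (k * pi) \<le> ?e"
        using add_pos_pos[OF exp_gt_zero[of "k * pi"] exp_gt_zero[of "- (k * pi)"]] by (simp add: sinh_field_def)
    qed (use M0 k0 in auto)
    finally have R: "\<bar>?R\<bar> \<le> M * ?e / k" by simp
    have "?e / 2 \<le> cosh (k * pi)" by (simp add: cosh_field_def)
    then have "\<bar>?I\<bar> * (?e / 4) \<le> \<bar>?I\<bar> * (cosh (k * pi) / 2)" by (intro mult_left_mono) auto
    also have "\<dots> = \<bar>?J - ?R / 2\<bar>" unfolding split by (simp add: abs_mult)
    also have "\<dots> \<le> \<bar>?J\<bar> + \<bar>?R\<bar> / 2" using abs_triangle_ineq4[of ?J "?R / 2"] by simp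
    also have "\<dots> \<le> 2 * C * ?e / k + M * ?e / k / 2" using J R by (intro add_mono divide_right_mono) auto
    also have "\<dots> = ((8 * C + 2 * M) / k) * (?e / 4)" using k0 by (simp add: field_simps)
    finally have "\<bar>?I\<bar> * (?e / 4) \<le> ((8 * C + 2 * M) / k) * (?e / 4)" .
    then show ?thesis by (rule mult_right_le_imp_le) simp
  qed
  have "((\<lambda>k. (8 * C + 2 * M) / k) \<longlongrightarrow> 0) at_top" by real_asymp
  moreover have "\<forall>\<^sub>F k in at_top. \<bar>?I\<bar> \<le> (8 * C + 2 * M) / k"
    using eventually_ge_at_top[of C] by eventually_elim (rule bound)
  ultimately have "\<bar>?I\<bar> \<le> 0" by (intro tendsto_lowerbound) auto
  then show ?thesis by simp
qed

text \<open>Substituting \<open>pi - t\<close> in the reflected integral, the two kernels add up to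
  \<open>sin (l * pi)\<close> by the addition theorem, independently of \<open>t\<close>. What
  remains is a multiple of the integral of \<open>q\<close>.\<close>

lemma sl_sol_approx_sum_reflect:
  assumes q: "continuous_on {0..pi} q" and I: "integral {0..pi} q = 0"
  shows "sl_sol_approx q h l + sl_sol_approx (\<lambda>x. q (pi - x)) h l = 2 * sl_sol_approx (\<lambda>x. 0) h l"
proof -
  let ?f = "\<lambda>t. sin (l * (pi - t)) * (q t * cos (l * t))" and ?g = "\<lambda>t. sin (l * t) * (q t * cos (l * (pi - t)))"
  have c: "continuous_on {0..pi} ?f" "continuous_on {0..pi} ?g" by (intro continuous_intros q)+
  have "integral {0..pi} (\<lambda>t. sin (l * (pi - t)) * (q (pi - t) * cos (l * t))) = integral {0..pi} ?g"
    using integral_reflect_interval[OF c(2)] by simp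
  moreover have "integral {0..pi} ?f + integral {0..pi} ?g = integral {0..pi} (\<lambda>t. ?f t + ?g t)"
    by (intro Henstock_Kurzweil_Integration.integral_add[symmetric] integrable_continuous_interval c)
  moreover have "(\<lambda>t. ?f t + ?g t) = (\<lambda>t. sin (l * pi) * complex_of_real (q t))"
  proof
    fix t
    have "l * (pi - t) + l * t = l * pi" by (simp add: algebra_simps)
    then have "sin (l * pi) = sin (l * (pi - t)) * cos (l * t) + cos (l * (pi - t)) * sin (l * t)"
      by (metis sin_add)
    then show "?f t + ?g t = sin (l * pi) * complex_of_real (q t)" by algebra
  qed
  moreover have "integral {0..pi} (\<lambda>t. complex_of_real (q t)) = 0"
    using integral_unique[OF has_integral_of_real[OF integrable_integral[OF integrable_continuous_interval[OF q]]]] I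
    by simp
  ultimately have "integral {0..pi} ?f + integral {0..pi} (\<lambda>t. sin (l * (pi - t)) * (q (pi - t) * cos (l * t))) = 0"
    by simp
  then show ?thesis by (simp add: sl_sol_approx_def add_divide_distrib[symmetric] algebra_simps)
qed

text \<open>Below, \<open>E\<close> takes the value \<open>\<kappa> + 1/\<kappa> - 2 \<kappa>\<^sub>0\<close> at an eigenvalue, with \<open>\<kappa>\<^sub>0 = \<plusminus>1\<close> of the same sign as \<open>\<kappa>\<close>.
  All residues of \<open>E\<close> over the characteristic function thus have the same sign, while their sum is
  \<open>0\<close> because the terms of order \<open>1/\<lambda>\<close> in \<open>E\<close> cancel.\<close>

lemma sl_norming_eq:
  assumes q: "continuous_on {0..pi} q" and eq: "\<And>z. sl_char q h z = sl_char (\<lambda>x. 0) h z"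
    and p: "sl_char q h p = 0"
  shows "sl_sol q 1 h p pi = sl_sol (\<lambda>x. 0) 1 h p pi"
proof -
  note q' = continuous_reflect[OF q]
  let ?q = "\<lambda>x. q (pi - x)" and ?o = "\<lambda>x::real. 0::real"
  define E where "E z = sl_sol q 1 h z pi + sl_sol ?q 1 h z pi - 2 * sl_sol ?o 1 h z pi" for z
  have pi: "pi \<in> {0..pi}" by simp
  have E: "E holomorphic_on UNIV"
    unfolding E_def[abs_def] by (intro holomorphic_intros sl_sol_entire q q' continuous_zero) auto
  obtain C1 C2 C3 where "sl_est q h C1" "sl_est ?q h C2" "sl_est ?o h C3"
    using sl_est_exists[OF q] sl_est_exists[OF q'] sl_est_exists[OF continuous_zero] by metis
  then have e: "sl_est q h (max C1 (max C2 C3))" "sl_est ?q h (max C1 (max C2 C3))" "sl_est ?o h (max C1 (max C2 C3))"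
    by (auto elim!: sl_est_mono)
  define C where "C = max C1 (max C2 C3)"
  note e = e[folded C_def]
  have C: "1 \<le> C" using e by (simp add: sl_est_def)
  have key: "\<exists>t I. 0 < t \<and> 0 < I \<and> sl_sol q 1 h z pi = t * sl_sol ?o 1 h z pi \<and>
      E z / deriv (sl_char q h) z = - complex_of_real ((t + 1 / t - 2) / I)" if z: "sl_char q h z = 0" for z
  proof -
    let ?k = "sl_sol q 1 h z pi" and ?m = "sl_sol ?o 1 h z pi" and ?d = "deriv (sl_char q h) z"
    have z0: "sl_char ?o h z = 0" using z eq by simp
    have "sl_char ?o h = sl_char q h" using eq by (intro ext) simp
    then have d: "deriv (sl_char ?o h) z = ?d" by simp
    obtain I where I: "0 < I" "?k * ?d = - complex_of_real I" by (rule sl_char_deriv[OF q z])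
    obtain I0 where I0: "0 < I0" "?m * ?d = - complex_of_real I0"
      by (rule sl_char_deriv[OF continuous_zero z0, unfolded d])
    have d0: "?d \<noteq> 0" using I by auto
    have k0: "?m * ?m = 1" using sl_char_zero_norming[OF continuous_zero z0] by simp
    then have m0: "?m \<noteq> 0" by auto
    \<comment> \<open>Both problems share the derivative \<open>?d\<close>, so the ratio of the
      values at \<open>pi\<close> is a ratio of two positive norm integrals. This is what makes the
      two values have the same sign.\<close>
    define t where "t = I / I0"
    have t: "0 < t" using I I0 by (simp add: t_def)
    have "?k * ?d = t * ?m * ?d" using I I0 by (simp add: t_def mult.assoc)
    then have k: "?k = t * ?m" using d0 by simp
    have "?k * sl_sol ?q 1 h z pi = 1" using sl_char_zero_norming[OF q z] by simp
    then have "t * (?m * sl_sol ?q 1 h z pi) = 1" using k by (simp add: mult.assoc)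
    then have "?m * sl_sol ?q 1 h z pi = 1 / t" using t by (simp add: field_simps)
    then have "?m * (?m * sl_sol ?q 1 h z pi) = ?m / t" by simp
    then have k': "sl_sol ?q 1 h z pi = ?m / t" using k0 by (simp add: mult.assoc[symmetric])
    have "E z = ?m * complex_of_real (t + 1 / t - 2)"
      unfolding E_def k k' by (simp add: algebra_simps)
    also have "\<dots> / ?d = complex_of_real (t + 1 / t - 2) * (?m * ?m) / (?m * ?d)"
      using m0 d0 by (simp add: field_simps)
    also have "\<dots> = - complex_of_real ((t + 1 / t - 2) / I0)" using k0 I0 by simp
    finally show ?thesis using t I0 k by blast
  qed
  have nonneg: "0 \<le> t + 1 / t - 2" if "0 < t" for t :: real
  proof -
    have "t + 1 / t - 2 = (t - 1)\<^sup>2 / t" using that by (simp add: field_simps power2_eq_square)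
    then show ?thesis using that by simp
  qed
  have "Re (E p / deriv (sl_char q h) p) = 0"
  \<comment> \<open>With \<open>n = real N + 1 / 2\<close>, \<open>E\<close> has order
    \<open>1 / n^2\<close> and the characteristic function order \<open>n\<close>, up to the common
    exponential; the resulting cube beats the radius \<open>n^2\<close>. The 64 is four remainder
    terms times 16.\<close>
  proof (rule residues_eq_0_of_circle_decay[where f = E and g = "sl_char q h" and B = "\<lambda>N. 64 * C / (real N + 1 / 2) ^ 3",
        OF E sl_char_entire[OF q] sl_char_simple_zeros[OF q] _ circle_radii])
    fix z assume "sl_char q h z = 0"
    then obtain t I where "0 < t" "0 < I" "E z / deriv (sl_char q h) z = - complex_of_real ((t + 1 / t - 2) / I)"
      using key by blast
    then show "Re (E z / deriv (sl_char q h) z) \<le> 0" using nonneg[of t] by (simp del: of_real_divide)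
  next
    show "(\<lambda>N. 64 * C / (real N + 1 / 2) ^ 3 * (real N + 1 / 2)\<^sup>2) \<longlonglongrightarrow> 0" by real_asymp
    obtain N0 where N0: "16 * C < real N0" using reals_Archimedean2 by blast
    show "\<forall>\<^sub>F N in sequentially. \<forall>z. norm z = (real N + 1 / 2)\<^sup>2 \<longrightarrow> sl_char q h z \<noteq> 0 \<and>
        norm (E z / sl_char q h z) \<le> 64 * C / (real N + 1 / 2) ^ 3"
      using eventually_ge_at_top[of N0]
    proof (eventually_elim, intro allI impI)
      fix N and z :: complex assume "N0 \<le> N" and z: "norm z = (real N + 1 / 2)\<^sup>2"
      then have N: "16 * C \<le> real N" using N0 by linarith
      let ?l = "csqrt z" and ?e = "exp (\<bar>Im (csqrt z)\<bar> * pi)" and ?n = "real N + 1 / 2"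
      note c = sl_char_circle_lower[OF e(1) N z]
      let ?r = "\<lambda>q. sl_sol q 1 h z pi - sl_sol_approx q h ?l"
      have r: "norm (?r q) \<le> C * ?e / ?n\<^sup>2" "norm (?r ?q) \<le> C * ?e / ?n\<^sup>2" "norm (?r ?o) \<le> C * ?e / ?n\<^sup>2"
        using sl_estD(2)[OF e(1) c(2)] sl_estD(2)[OF e(2) c(2)] sl_estD(2)[OF e(3) c(2)] unfolding c(1) by simp_all
      have "E z = ?r q + ?r ?q - 2 * ?r ?o"
        using sl_sol_approx_sum_reflect[OF q sl_char_eq_imp_integral_zero[OF q eq], of h ?l]
        by (simp add: E_def algebra_simps)
      also have "norm \<dots> \<le> norm (?r q) + norm (?r ?q) + 2 * norm (?r ?o)"
        using norm_triangle_ineq4[of "?r q + ?r ?q" "2 * ?r ?o"] norm_triangle_ineq[of "?r q" "?r ?q"]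
        unfolding norm_mult[of 2] norm_numeral by linarith
      also have "\<dots> \<le> 4 * (C * ?e / ?n\<^sup>2)" using r by linarith
      finally have E: "norm (E z) \<le> 4 * (C * ?e / ?n\<^sup>2)" .
      have n: "0 < ?n" by (simp add: add_nonneg_pos)
      then have pos: "0 < ?n * ?e / 16" by simp
      have "norm (E z) / norm (sl_char q h z) \<le> 4 * (C * ?e / ?n\<^sup>2) / (?n * ?e / 16)"
        using E c(3) pos C unfolding c(1) by (intro frac_le) auto
      also have "\<dots> = 64 * C / ?n ^ 3" using n by (simp add: power2_eq_square power3_eq_cube)
      finally have "norm (E z / sl_char q h z) \<le> 64 * C / ?n ^ 3" by (simp add: norm_divide)
      moreover have "0 < norm (sl_char q h z)" using pos c(3) unfolding c(1) by linarith
      ultimately show "sl_char q h z \<noteq> 0 \<and> norm (E z / sl_char q h z) \<le> 64 * C / ?n ^ 3" by auto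
    qed
  qed (assumption | rule p)+
  moreover obtain t I where t: "0 < t" "0 < I" "sl_sol q 1 h p pi = t * sl_sol ?o 1 h p pi"
    "E p / deriv (sl_char q h) p = - complex_of_real ((t + 1 / t - 2) / I)"
    using key[OF p] by blast
  ultimately have "t + 1 / t - 2 = 0" by (simp del: of_real_divide)
  then have "(t - 1)\<^sup>2 = 0" using t(1) by (simp add: field_simps power2_eq_square)
  then show ?thesis using t(3) by simp
qed

text \<open>At an eigenvalue each solution is its value at \<open>pi\<close> times the reflected
  one, and those values agree for the two potentials. Elsewhere the growth rates over
  \<open>x\<close> and over \<open>pi - x\<close> add up to that over \<open>pi\<close>, one power
  of \<open>l\<close> below the characteristic function.\<close>

lemma sl_sol_cross_eq:
  assumes q: "continuous_on {0..pi} q" and eq: "\<And>z. sl_char q h z = sl_char (\<lambda>x. 0) h z"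
    and x: "x \<in> {0..pi}"
  shows "sl_sol q 1 h w x * sl_sol (\<lambda>x. 0) 1 h w (pi - x) = sl_sol (\<lambda>x. 0) 1 h w x * sl_sol (\<lambda>x. q (pi - x)) 1 h w (pi - x)"
proof -
  note q' = continuous_reflect[OF q]
  let ?q = "\<lambda>x. q (pi - x)" and ?o = "\<lambda>x::real. 0::real"
  have x': "pi - x \<in> {0..pi}" using x by auto
  define W where "W z = sl_sol q 1 h z x * sl_sol ?o 1 h z (pi - x) - sl_sol ?o 1 h z x * sl_sol ?q 1 h z (pi - x)" for z
  obtain C1 C2 C3 where "sl_est q h C1" "sl_est ?q h C2" "sl_est ?o h C3"
    using sl_est_exists[OF q] sl_est_exists[OF q'] sl_est_exists[OF continuous_zero] by metis
  then have e: "sl_est q h (max C1 (max C2 C3))" "sl_est ?q h (max C1 (max C2 C3))" "sl_est ?o h (max C1 (max C2 C3))"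
    by (auto elim!: sl_est_mono)
  define C where "C = max C1 (max C2 C3)"
  note e = e[folded C_def]
  have C: "1 \<le> C" using e by (simp add: sl_est_def)
  have "W w = 0"
  proof (rule entire_eq_0_of_circle_decay[where f = W, OF _ sl_char_entire[OF q] sl_char_simple_zeros[OF q] _ circle_radii circle_decay])
    show "W holomorphic_on UNIV"
      unfolding W_def[abs_def] by (intro holomorphic_intros sl_sol_entire q q' continuous_zero x x')
    fix z assume z: "sl_char q h z = 0"
    then have z0: "sl_char ?o h z = 0" using eq by simp
    have "sl_sol q 1 h z x = sl_sol q 1 h z pi * sl_sol ?q 1 h z (pi - x)"
      using sl_char_zero_reflect[OF q z x'] by simp
    moreover have "sl_sol ?o 1 h z x = sl_sol ?o 1 h z pi * sl_sol ?o 1 h z (pi - x)"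
      using sl_char_zero_reflect[OF continuous_zero z0 x'] by simp
    ultimately show "W z = 0" using sl_norming_eq[OF q eq z] by (simp add: W_def)
  next
    obtain N0 where N0: "16 * C < real N0" using reals_Archimedean2 by blast
    show "\<forall>\<^sub>F N in sequentially. \<forall>z. norm z = (real N + 1 / 2)\<^sup>2 \<longrightarrow> sl_char q h z \<noteq> 0 \<and>
        norm (W z / sl_char q h z) \<le> 32 * C\<^sup>2 / (real N + 1 / 2)"
      using eventually_ge_at_top[of N0]
    proof (eventually_elim, intro allI impI)
      fix N and z :: complex assume "N0 \<le> N" and z: "norm z = (real N + 1 / 2)\<^sup>2"
      then have N: "16 * C \<le> real N" using N0 by linarith
      let ?l = "csqrt z" and ?e = "\<lambda>x. exp (\<bar>Im (csqrt z)\<bar> * x)" and ?n = "real N + 1 / 2"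
      note c = sl_char_circle_lower[OF e(1) N z]
      have ee: "?e x * ?e (pi - x) = ?e pi" by (simp add: exp_add[symmetric] algebra_simps)
      have prod: "norm (a * b) \<le> C\<^sup>2 * ?e pi" if "norm a \<le> C * ?e x" "norm b \<le> C * ?e (pi - x)" for a b :: complex
      proof -
        have "norm (a * b) \<le> (C * ?e x) * (C * ?e (pi - x))"
          unfolding norm_mult using that C by (intro mult_mono) auto
        also have "\<dots> = C\<^sup>2 * (?e x * ?e (pi - x))" by (simp add: power2_eq_square)
        finally show ?thesis unfolding ee .
      qed
      have "norm (W z) \<le> C\<^sup>2 * ?e pi + C\<^sup>2 * ?e pi"
        unfolding W_def
        by (intro order_trans[OF norm_triangle_ineq4] add_mono prod)
          (use sl_estD(1)[OF e(1) c(2) x] sl_estD(1)[OF e(3) c(2) x] sl_estD(1)[OF e(2) c(2) x'] sl_estD(1)[OF e(3) c(2) x'] in simp_all)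
      then have W: "norm (W z) \<le> 2 * C\<^sup>2 * ?e pi" by simp
      have n: "0 < ?n" by (simp add: add_nonneg_pos)
      then have pos: "0 < ?n * ?e pi / 16" by simp
      have "norm (W z) / norm (sl_char q h z) \<le> 2 * C\<^sup>2 * ?e pi / (?n * ?e pi / 16)"
        using W c(3) pos C unfolding c(1) by (intro frac_le) auto
      also have "\<dots> = 32 * C\<^sup>2 / ?n" using n by simp
      finally have "norm (W z / sl_char q h z) \<le> 32 * C\<^sup>2 / ?n" by (simp add: norm_divide)
      moreover have "0 < norm (sl_char q h z)" using pos c(3) unfolding c(1) by linarith
      ultimately show "sl_char q h z \<noteq> 0 \<and> norm (W z / sl_char q h z) \<le> 32 * C\<^sup>2 / ?n" by auto
    qed
  qed
  then show ?thesis by (simp add: W_def)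
qed

lemma vector_derivative_eq_on_interval:
  fixes f g :: "real \<Rightarrow> complex"
  assumes "\<And>x. x \<in> {0..pi} \<Longrightarrow> f x = g x" and x: "x \<in> {0..pi}"
    and f: "(f has_vector_derivative f') (at x within {0..pi})" and g: "(g has_vector_derivative g') (at x within {0..pi})"
  shows "f' = g'"
proof -
  have "(g has_vector_derivative f') (at x within {0..pi})"
    by (rule has_vector_derivative_transform[OF x _ f]) (use assms(1) in auto)
  then show ?thesis
    using vector_derivative_unique_within_closed_interval[of 0 pi x g f' g'] x g by simp
qed

text \<open>At the non-real point \<open>\<i>\<close> the solution \<open>f\<close> has no zeros. The cross relation and the Wronskians give
  \<open>f\<^sup>2 = g\<^sup>2\<close>; differentiating this twice leaves \<open>q f\<^sup>4 = 0\<close>.\<close>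

lemma sl_char_eq_imp_zero:
  assumes q: "continuous_on {0..pi} q" and eq: "\<And>z. sl_char q h z = sl_char (\<lambda>x. 0) h z"
    and x: "x \<in> {0..pi}"
  shows "q x = 0"
proof -
  note q' = continuous_reflect[OF q]
  let ?o = "\<lambda>x::real. 0::real"
  define f where "f = sl_sol q 1 h \<i>"
  define f' where "f' = sl_sol' q 1 h \<i>"
  define g where "g = sl_sol ?o 1 h \<i>"
  define g' where "g' = sl_sol' ?o 1 h \<i>"
  define u where "u x = sl_sol (\<lambda>x. q (pi - x)) 1 h \<i> (pi - x)" for x
  define u' where "u' x = - sl_sol' (\<lambda>x. q (pi - x)) 1 h \<i> (pi - x)" for x
  define v where "v x = sl_sol ?o 1 h \<i> (pi - x)" for x
  define v' where "v' x = - sl_sol' ?o 1 h \<i> (pi - x)" for x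
  have ode_f: "sl_ode q \<i> f f'" and ode_g: "sl_ode ?o \<i> g g'"
    unfolding f_def f'_def g_def g'_def by (intro sl_ode_sl_sol q continuous_zero)+
  have ode_u: "sl_ode q \<i> u u'"
    using sl_ode_reflect[OF sl_ode_sl_sol[OF q'], of \<i> 1 h] by (simp add: u_def[abs_def] u'_def[abs_def])
  have ode_v: "sl_ode ?o \<i> v v'"
    using sl_ode_reflect[OF sl_ode_sl_sol[OF continuous_zero], of \<i> 1 h] by (simp add: v_def[abs_def] v'_def[abs_def])
  let ?D = "sl_char q h \<i>"
  have D: "?D \<noteq> 0" using sl_char_zero_real[OF q, of h \<i>] by (auto simp: complex_eq_iff)
  \<comment> \<open>Evaluated at \<open>pi\<close>, both Wronskians are minus a characteristic
    function at \<open>\<i>\<close>; since the two characteristic functions coincide, the nonzero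
    constant is the same and can be cancelled.\<close>
  have w1: "f t * u' t - f' t * u t = - ?D" if t: "t \<in> {0..pi}" for t
  proof -
    have "f pi * u' pi - f' pi * u pi = - ?D"
      using q' by (simp add: f_def f'_def u_def u'_def sl_char_def)
    then show ?thesis using sl_ode_wronskian_const[OF ode_f ode_u t] sl_ode_wronskian_const[OF ode_f ode_u, of pi] by simp
  qed
  have w2: "g t * v' t - g' t * v t = - ?D" if t: "t \<in> {0..pi}" for t
  proof -
    have "g pi * v' pi - g' pi * v pi = - ?D"
      unfolding eq using continuous_zero by (simp add: g_def g'_def v_def v'_def sl_char_def)
    then show ?thesis using sl_ode_wronskian_const[OF ode_g ode_v t] sl_ode_wronskian_const[OF ode_g ode_v, of pi] by simp
  qed
  have cross: "f t * v t = g t * u t" if "t \<in> {0..pi}" for t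
    using sl_sol_cross_eq[OF q eq that, of \<i>] by (simp add: f_def g_def u_def v_def)
  have df: "(f has_vector_derivative f' t) (at t within {0..pi})" "(f' has_vector_derivative (q t - \<i>) * f t) (at t within {0..pi})"
    and dg: "(g has_vector_derivative g' t) (at t within {0..pi})" "(g' has_vector_derivative (0 - \<i>) * g t) (at t within {0..pi})"
    and du: "(u has_vector_derivative u' t) (at t within {0..pi})"
    and dv: "(v has_vector_derivative v' t) (at t within {0..pi})" if "t \<in> {0..pi}" for t
    using that ode_f ode_g ode_u ode_v by (auto simp: sl_ode_def)
  have cross': "f t * v' t + f' t * v t = g t * u' t + g' t * u t" if t: "t \<in> {0..pi}" for t
    using vector_derivative_eq_on_interval[OF cross t has_vector_derivative_mult[OF df(1)[OF t] dv[OF t]]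
        has_vector_derivative_mult[OF dg(1)[OF t] du[OF t]]] by simp
  have sq: "f t * f t = g t * g t" if t: "t \<in> {0..pi}" for t
  proof -
    \<comment> \<open>Expand the left side, replace \<open>f * v'\<close> by means of
      \<open>cross'\<close> and \<open>f * v\<close> by \<open>g * u\<close>; the terms with
      \<open>g' * u\<close> cancel.\<close>
    have "f t * f t * (g t * v' t - g' t * v t) = g t * g t * (f t * u' t - f' t * u t)"
      using cross[OF t] cross'[OF t] by algebra
    then show ?thesis unfolding w1[OF t] w2[OF t] using D by simp
  qed
  have sq': "f t * f' t = g t * g' t" if t: "t \<in> {0..pi}" for t
    using vector_derivative_eq_on_interval[OF sq t has_vector_derivative_mult[OF df(1)[OF t] df(1)[OF t]]
        has_vector_derivative_mult[OF dg(1)[OF t] dg(1)[OF t]]] by (simp add: mult.commute)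
  have "f x * ((q x - \<i>) * f x) + f' x * f' x = g x * ((0 - \<i>) * g x) + g' x * g' x"
    using vector_derivative_eq_on_interval[OF sq' x has_vector_derivative_mult[OF df(1)[OF x] df(2)[OF x]]
        has_vector_derivative_mult[OF dg(1)[OF x] dg(2)[OF x]]] by simp
  \<comment> \<open>After \<open>sq\<close> the equation reads \<open>q * f^2 + f'^2 = g'^2\<close>.
    Multiplying by \<open>f^2 = g^2\<close> turns the squared derivatives into
    \<open>(f * f')^2\<close> and \<open>(g * g')^2\<close>, which agree by
    \<open>sq'\<close>.\<close>
  then have "q x * (f x * f x) * (f x * f x) = 0" using sq[OF x] sq'[OF x] by algebra
  moreover have "f x \<noteq> 0" unfolding f_def by (rule sl_sol_nonreal_nonzero[OF q x]) simp
  ultimately show ?thesis by simp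
qed

theorem theorem1p4:
  fixes \<alpha> :: real and q q' :: "real \<Rightarrow> real"
  assumes "0 < \<alpha>" and "\<alpha> < pi"
    and "abs_continuous_on {0..pi} q"
    and "AE x in lebesgue_on {0..pi}. (q has_real_derivative q' x) (at x within {0..pi})"
    and "L2_real_on {0..pi} q'"
    and "\<And>n. sl_mu q \<alpha> (pi - \<alpha>) n = sl_mu (\<lambda>x. 0) \<alpha> (pi - \<alpha>) n"
  shows "\<forall>x\<in>{0..pi}. q x = 0"
proof -
  let ?h = "- cot \<alpha>" and ?o = "\<lambda>x::real. 0::real"
  have q: "continuous_on {0..pi} q" using assms(3) by (rule abs_continuous_on_imp_continuous_on)
  obtain m :: "nat \<Rightarrow> real" where m: "strict_mono m" "range (\<lambda>n. complex_of_real (m n)) = {\<mu>. sl_char q ?h \<mu> = 0}"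
    using sl_char_zeros_enum[OF q] by blast
  obtain m0 :: "nat \<Rightarrow> real" where m0: "strict_mono m0" "range (\<lambda>n. complex_of_real (m0 n)) = {\<mu>. sl_char ?o ?h \<mu> = 0}"
    using sl_char_zeros_enum[OF continuous_zero] by blast
  have "m = sl_mu q \<alpha> (pi - \<alpha>)"
    by (rule sl_mu_eqI[symmetric, OF m(1)]) (simp only: m(2) sl_spectrum_eq[OF q])
  also have "\<dots> = sl_mu ?o \<alpha> (pi - \<alpha>)" using assms(6) by blast
  also have "\<dots> = m0"
    by (rule sl_mu_eqI[OF m0(1)]) (simp only: m0(2) sl_spectrum_eq[OF continuous_zero])
  finally have "{\<mu>. sl_char q ?h \<mu> = 0} = {\<mu>. sl_char ?o ?h \<mu> = 0}" using m(2) m0(2) by simp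
  then have "sl_char q ?h z = sl_char ?o ?h z" for z
    using sl_char_eq_of_zeros[OF q continuous_zero] by blast
  then show ?thesis using sl_char_eq_imp_zero[OF q] by blast
qed

end
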